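(* Let $K\subset(0,\alpha_c)$ be compact, where $\alpha_c=\frac{3\sqrt3}{2}$. For $\alpha\in K$ set $\lambda_m=\alpha m$ and $\varphi_m(\alpha):=m\Theta(\alpha)+\beta(\alpha)$. Define the positive, $\pi$-periodic profile $$\mathcal P_\alpha(\varphi):=\left[\sum_{j=1}^\infty\rho(\alpha)^{2j}\cos^2\bigl(\varphi+j\omega(\alpha)\bigr)\right]^{1/2}.$$ Then, uniformly for $\alpha\in K$, as $m\to\infty$, $$\frac{\sqrt m}{H_e(\alpha)^m}\,\|R_m(\alpha m)\|_{2,C}=\sqrt{\frac\pi2}\,B(\alpha)\,\mathcal P_\alpha\bigl(\varphi_m(\alpha)\bigr)+O_K(m^{-1}).$$ The profile has the closed form $$\mathcal P_\alpha(\varphi)^2=\frac{\rho(\alpha)^2}{2[1-\rho(\alpha)^2]}+\frac12\operatorname{Re}\left\{\frac{\rho(\alpha)^2\exp\bigl(2i[\varphi+\omega(\alpha)]\bigr)}{1-\rho(\alpha)^2\exp(2i\omega(\alpha))}\right\}.$$ Moreover, $\mathcal P_\alpha(\varphi)$ is bounded above and away from zero uniformly in $(\alpha,\varphi)\in K\times\mathbb R$.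
   Context: For $\lambda>0$, $F_\lambda(x)=\exp\!\left(-\lambda\frac{1-x}{1+x}\right)$ for $-1<x\le 1$ and $F_\lambda(-1)=0$. Its Chebyshev coefficients are $a_k(\lambda)=\frac2\pi\int_{-1}^1\frac{F_\lambda(x)T_k(x)}{\sqrt{1-x^2}}\,dx$, $k\ge0$ ($T_k$ the Chebyshev polynomials of the first kind). The projection remainder is $R_m(\lambda)=F_\lambda-\frac{a_0(\lambda)}2-\sum_{k=1}^ma_k(\lambda)T_k$, and $\|g\|_{2,C}^2=\int_{-1}^1\frac{|g(x)|^2}{\sqrt{1-x^2}}\,dx$. For $0<\alpha<\alpha_c$ let $\zeta_\alpha$ be the unique root of $\alpha(\zeta^3-\zeta)+1=0$ in the open first quadrant. Write $$\frac{\zeta_\alpha-1}{\zeta_\alpha+1}=\rho(\alpha)e^{i\omega(\alpha)},\qquad 0<\rho(\alpha)<1,\quad 0<\omega(\alpha)<\pi .$$ Let $\psi_\alpha(\zeta_\alpha)=\log\rho(\alpha)+i\omega(\alpha)+\alpha\zeta_\alpha^2$, $H_e(\alpha)=\exp(\operatorname{Re}\psi_\alpha(\zeta_\alpha))$, $\Theta(\alpha)=\operatorname{Im}\psi_\alpha(\zeta_\alpha)$. Further $$\frac{4\sqrt\alpha}{\sqrt\pi}\,\frac{\zeta_\alpha}{\sqrt{3-2\alpha\zeta_\alpha}}=B(\alpha)e^{i\beta(\alpha)},$$ where $\sqrt{3-2\alpha\zeta_\alpha}$ is chosen continuously from the positive square root of $3$ as $\alpha\downarrow0$, $B(\alpha)>0$,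 and $\beta$ is a continuous argument (with $\beta(\alpha)\to\pi/3$ as $\alpha\downarrow0$). $O_K$ denotes an implied constant depending only on $K$. *)

theory Defs
  imports "HOL-Analysis.Analysis" "HOL-Computational_Algebra.Polynomial"
begin

definition F :: "real \<Rightarrow> real \<Rightarrow> real" where
  "F l x = (if x = -1 then 0 else exp (- l * ((1 - x) / (1 + x))))"

fun cheb_T :: "nat \<Rightarrow> real poly" where
  "cheb_T 0 = 1"
| "cheb_T (Suc 0) = [:0, 1:]"
| "cheb_T (Suc (Suc n)) = [:0, 2:] * cheb_T (Suc n) - cheb_T n"

definition cheb_coeff :: "real \<Rightarrow> nat \<Rightarrow> real" where
  "cheb_coeff l k = 2 / pi * (LBINT x=-1..1. F l x * poly (cheb_T k) x / sqrt (1 - x\<^sup>2))"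

definition remainder :: "nat \<Rightarrow> real \<Rightarrow> real \<Rightarrow> real" where
  "remainder m l x =
     F l x - cheb_coeff l 0 / 2 - (\<Sum>k=1..m. cheb_coeff l k * poly (cheb_T k) x)"

definition norm_2C :: "(real \<Rightarrow> real) \<Rightarrow> real" where
  "norm_2C g = sqrt (LBINT x=-1..1. \<bar>g x\<bar>\<^sup>2 / sqrt (1 - x\<^sup>2))"

text \<open>All functions of \<open>a\<close> below are meaningful only for \<open>0 < a < alpha_c\<close>.\<close>

definition alpha_c :: real where
  "alpha_c = 3 * sqrt 3 / 2"

definition zeta :: "real \<Rightarrow> complex" where
  "zeta a = (THE z. Re z > 0 \<and> Im z > 0 \<and> of_real a * (z ^ 3 - z) + 1 = 0)"

definition rho :: "real \<Rightarrow> real" where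
  "rho a = cmod ((zeta a - 1) / (zeta a + 1))"

definition omega :: "real \<Rightarrow> real" where
  "omega a = (THE w. 0 < w \<and> w < pi \<and>
     (zeta a - 1) / (zeta a + 1) = of_real (rho a) * exp (\<i> * of_real w))"

definition psi_saddle :: "real \<Rightarrow> complex" where
  "psi_saddle a = of_real (ln (rho a)) + \<i> * of_real (omega a) + of_real a * (zeta a)\<^sup>2"

definition H_e :: "real \<Rightarrow> real" where
  "H_e a = exp (Re (psi_saddle a))"

definition Theta :: "real \<Rightarrow> real" where
  "Theta a = Im (psi_saddle a)"

text \<open>
  The branch of \<open>sqrt (3 - 2 a \<zeta>\<^sub>a)\<close> continued from the positive root of 3 as \<open>a\<close> decreases
  to 0. The radicand has no zero on the interval, so the conditions determine the function
  there, and \<open>SOME\<close> makes a genuine choice only outside the interval.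
  The same holds for \<open>beta\<close>, since \<open>amplitude\<close> has no zero there.
\<close>

definition sqrt_branch :: "real \<Rightarrow> complex" where
  "sqrt_branch = (SOME s. continuous_on {0<..<alpha_c} s \<and>
     (\<forall>a\<in>{0<..<alpha_c}. (s a)\<^sup>2 = 3 - 2 * of_real a * zeta a) \<and>
     (s \<longlongrightarrow> of_real (sqrt 3)) (at_right 0))"

definition amplitude :: "real \<Rightarrow> complex" where
  "amplitude a = of_real (4 * sqrt a / sqrt pi) * (zeta a / sqrt_branch a)"

definition B :: "real \<Rightarrow> real" where
  "B a = cmod (amplitude a)"

definition beta :: "real \<Rightarrow> real" where
  "beta = (SOME b. continuous_on {0<..<alpha_c} b \<and>
     (\<forall>a\<in>{0<..<alpha_c}. amplitude a = of_real (B a) * exp (\<i> * of_real (b a))) \<and>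
     (b \<longlongrightarrow> pi / 3) (at_right 0))"

definition phase :: "nat \<Rightarrow> real \<Rightarrow> real" where
  "phase m a = real m * Theta a + beta a"

text \<open>The sum over \<open>j \<ge> 1\<close> is indexed by \<open>j = Suc i\<close>.\<close>

definition profile :: "real \<Rightarrow> real \<Rightarrow> real" where
  "profile a \<phi> =
     sqrt (\<Sum>i. rho a ^ (2 * Suc i) * (cos (\<phi> + real (Suc i) * omega a))\<^sup>2)"

end

theory Submission
  imports Defs "HOL-Complex_Analysis.Cauchy_Integral_Theorem" "HOL-Probability.Distributions"
    "HOL-Real_Asymp.Real_Asymp"
begin

text \<open>
  Put \<open>w(z) = (z - 1) / (z + 1)\<close>. The substitution \<open>x = (1 - t\<^sup>2) / (1 + t\<^sup>2)\<close> turns \<open>F\<^sub>\<lambda>\<close> into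
  \<open>exp (- \<lambda> t\<^sup>2)\<close> and \<open>T\<^sub>k\<close> into the real part of the \<open>k\<close>-th power of a point of the unit circle.
  Hence \<open>(-1)\<^sup>k a\<^sub>k(\<lambda>)\<close> is, up to the factor \<open>2 / \<pi>\<close>, the integral over the imaginary axis \<open>z = i t\<close> of
  \<open>exp (\<lambda> z\<^sup>2) w(z)\<^sup>k / (1 - z\<^sup>2)\<close> with respect to \<open>t\<close>. For \<open>\<lambda> = \<alpha> m\<close> and \<open>k = m + j\<close> the integrand is
  \<open>E(z)\<^sup>m g\<^sub>j(z)\<close> with \<open>E(z) = exp (\<alpha> z\<^sup>2) w(z)\<close> and \<open>g\<^sub>j(z) = w(z)\<^sup>j / (1 - z\<^sup>2)\<close>; the critical points
  of \<open>log E\<close> are the roots of \<open>\<alpha> (z\<^sup>3 - z) + 1\<close>, among them \<open>\<zeta>\<close> and its conjugate.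

  The contour may be any vertical line to the right of the imaginary axis, and on the line through
  \<open>\<zeta>\<close> the modulus of \<open>E\<close> is largest exactly at \<open>\<zeta>\<close> and its conjugate. More precisely it is
  dominated on the upper half of that line by a Gaussian centred at \<open>\<zeta>\<close> (\<open>line_majorant\<close>), which follows from
  nothing more than \<open>1 + x \<le> exp x\<close>. Near \<open>\<zeta>\<close> one expands \<open>log E\<close> to third and \<open>g\<^sub>j\<close> to first
  order. The linear and cubic terms are odd and integrate to zero against the Gaussian, which is
  why the relative error is \<open>O(1 / m)\<close> and not \<open>O(1 / sqrt m)\<close>. All constants depend only on bounds
  for the real part of \<open>\<zeta>\<close> (\<open>laplace_uniform\<close>, \<open>saddle_laplace\<close>). Since \<open>|w| < 1\<close>, the functions
  \<open>g\<^sub>j\<close> are of size \<open>O(1 / j)\<close> on the line, and so is the error for the coefficient \<open>m + j\<close>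
  (\<open>cheb_coeff_asymptotics\<close>).

  By Parseval's identity the norm of the remainder is, up to \<open>sqrt (\<pi> / 2)\<close>, the \<open>\<ell>\<^sup>2\<close> norm of the
  coefficients \<open>a\<^sub>k\<close> with \<open>k > m\<close> (\<open>norm_2C_remainder\<close>). The leading terms of the normalised
  coefficients are \<open>B \<rho>\<^sup>j cos (\<phi> + j \<omega>)\<close>, whose \<open>\<ell>\<^sup>2\<close> norm is \<open>B\<close> times the profile, and the errors
  \<open>O(1 / (m j))\<close> are square summable over \<open>j\<close>, so the triangle inequality in \<open>\<ell>\<^sup>2\<close> gives the claim.

  The parameter is handled through \<open>c = Re \<zeta>\<close>. Since the roots of the cubic add up to zero, its
  real root is \<open>- 2 c\<close>, whence \<open>\<alpha> = 1 / (2 c (4 c\<^sup>2 - 1))\<close> and \<open>\<zeta> = c + i sqrt (3 c\<^sup>2 - 1)\<close> with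
  \<open>c > 1 / sqrt 3\<close>. This is a decreasing bijection onto \<open>(0, \<alpha>\<^sub>c)\<close>, so a compact set of parameters
  corresponds to a compact set of values of \<open>c\<close>, and \<open>\<alpha> \<rightarrow> 0\<close> means \<open>c \<rightarrow> \<infinity>\<close>.
\<close>

section \<open>Line integrals and Gaussian integrals\<close>

text \<open>
  Cauchy's theorem for the infinite strip or sector between two lines: both integrals are limits of
  differences of one primitive of \<open>f\<close>, and the bound \<open>g\<close> on the segments that join the lines makes
  the two differences get arbitrarily close.
\<close>

lemma line_integral_shift:
  fixes f :: "complex \<Rightarrow> complex" and g :: "real \<Rightarrow> real"
  assumes S: "convex S" "open S" and f: "f holomorphic_on S"
    and a: "\<And>t::real. a + of_real t * d \<in> S" and b: "\<And>t::real. b + of_real t * e \<in> S"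
    and ia: "integrable lborel (\<lambda>t::real. f (a + of_real t * d))"
    and ib: "integrable lborel (\<lambda>t::real. f (b + of_real t * e))"
    and g: "\<And>t z. z \<in> closed_segment (a + of_real t * d) (b + of_real t * e) \<Longrightarrow> cmod (f z) \<le> g t"
    and lim: "((\<lambda>t. g t * cmod (a + of_real t * d - (b + of_real t * e))) \<longlongrightarrow> 0) at_top"
      "((\<lambda>t. g t * cmod (a + of_real t * d - (b + of_real t * e))) \<longlongrightarrow> 0) at_bot"
  shows "d * (\<integral>t. f (a + of_real t * d) \<partial>lborel) = e * (\<integral>t. f (b + of_real t * e) \<partial>lborel)"
proof -
  obtain P where P: "\<And>z. z \<in> S \<Longrightarrow> (P has_field_derivative f z) (at z within S)"
    using holomorphic_convex_primitive' [OF S f] by blast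
  note cont = holomorphic_on_imp_continuous_on [OF f]
  have bound: "cmod (P (a + of_real t * d) - P (b + of_real t * e))
      \<le> g t * cmod (a + of_real t * d - (b + of_real t * e))" for t
  proof (rule field_differentiable_bound [OF convex_closed_segment _ g])
    fix z assume z: "z \<in> closed_segment (a + of_real t * d) (b + of_real t * e)"
    have "closed_segment (a + of_real t * d) (b + of_real t * e) \<subseteq> S"
      by (intro closed_segment_subset a b S)
    with z show "(P has_field_derivative f z) (at z within closed_segment (a + of_real t * d) (b + of_real t * e))"
      by (intro has_field_derivative_subset [OF P]) auto
  qed auto
  have top: "((\<lambda>t. P (a + of_real t * d) - P (b + of_real t * e)) \<longlongrightarrow> 0) at_top"
    and bot: "((\<lambda>t. P (a + of_real t * d) - P (b + of_real t * e)) \<longlongrightarrow> 0) at_bot"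
    by (rule Lim_null_comparison [OF always_eventually [OF allI [OF bound]] lim(1)],
        rule Lim_null_comparison [OF always_eventually [OF allI [OF bound]] lim(2)])
  have *: "(\<lambda>n. P (a + of_real (real n) * d) - P (a + of_real (- real n) * d))
              \<longlonglongrightarrow> d * (\<integral>t. f (a + of_real t * d) \<partial>lborel)"
    if a: "\<And>t::real. a + of_real t * d \<in> S"
      and ia: "integrable lborel (\<lambda>t::real. f (a + of_real t * d))" for a d
  proof -
    let ?g = "\<lambda>t::real. d * f (a + of_real t * d)"
    have FTC: "(\<integral>t. indicator {-real n..real n} t *\<^sub>R ?g t \<partial>lborel)
                 = P (a + of_real (real n) * d) - P (a + of_real (- real n) * d)" for n
    proof (rule integral_FTC_atLeastAtMost)
      fix t :: real
      have "((\<lambda>t. a + of_real t * d) has_vector_derivative d) (at t within {-real n..real n})"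
        by (auto intro!: derivative_eq_intros simp: has_vector_derivative_def scaleR_conv_of_real)
      from field_vector_diff_chain_within [OF this has_field_derivative_subset [OF P]] a
      show "((\<lambda>t. P (a + of_real t * d)) has_vector_derivative ?g t) (at t within {-real n..real n})"
        by (auto simp: o_def image_subset_iff mult.commute)
    next
      show "continuous_on {-real n..real n} ?g"
        by (intro continuous_intros continuous_on_compose2 [OF cont]) (use a in auto)
    qed auto
    have "(\<lambda>n. \<integral>t. indicator {-real n..real n} t *\<^sub>R ?g t \<partial>lborel) \<longlonglongrightarrow> (\<integral>t. ?g t \<partial>lborel)"
    proof (rule integral_dominated_convergence [where w = "\<lambda>t. norm (?g t)"])
      have ig: "integrable lborel ?g" using ia by auto
      show "integrable lborel (\<lambda>t. norm (?g t))" using integrable_norm [OF ig] .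
      show "?g \<in> borel_measurable lborel" using ig by auto
      show "(\<lambda>t. indicator {- real n..real n} t *\<^sub>R ?g t) \<in> borel_measurable lborel" for n
        using ig by auto
      have "(\<lambda>n. indicator {- real n..real n} t *\<^sub>R ?g t) \<longlonglongrightarrow> ?g t" for t :: real
      proof (rule tendsto_eventually)
        obtain N :: nat where "\<bar>t\<bar> \<le> real N" using real_arch_simple by blast
        then show "\<forall>\<^sub>F n in sequentially. indicator {- real n..real n} t *\<^sub>R ?g t = ?g t"
          by (intro eventually_sequentiallyI [of N]) (auto simp: indicator_def)
      qed
      then show "AE t in lborel. (\<lambda>n. indicator {- real n..real n} t *\<^sub>R ?g t) \<longlonglongrightarrow> ?g t"
        by blast
    qed (auto simp: indicator_def)
    then show ?thesis
      using ia by (simp add: FTC)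
  qed
  have t1: "(\<lambda>n. P (a + of_real (real n) * d) - P (b + of_real (real n) * e)) \<longlonglongrightarrow> 0"
    using filterlim_compose [OF top filterlim_real_sequentially] .
  have "filterlim (\<lambda>n. - real n) at_bot sequentially"
    by (simp add: filterlim_uminus_at_top [symmetric] filterlim_real_sequentially)
  from filterlim_compose [OF bot this]
  have t2: "(\<lambda>n. P (a + of_real (- real n) * d) - P (b + of_real (- real n) * e)) \<longlonglongrightarrow> 0" .
  have "(\<lambda>n. (P (a + of_real (real n) * d) - P (a + of_real (- real n) * d))
        - (P (b + of_real (real n) * e) - P (b + of_real (- real n) * e))) \<longlonglongrightarrow> 0"
    using tendsto_diff [OF t1 t2] by (simp add: algebra_simps)
  with tendsto_diff [OF * [OF a ia] * [OF b ib]]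
  have "d * (\<integral>t. f (a + of_real t * d) \<partial>lborel) - e * (\<integral>t. f (b + of_real t * e) \<partial>lborel) = 0"
    using LIMSEQ_unique by blast
  then show ?thesis by simp
qed

lemma csqrt_of_real_mult_nonneg:
  assumes "r > 0" shows "csqrt (of_real r * z) = of_real (sqrt r) * csqrt z"
proof (rule csqrt_unique)
  show "(of_real (sqrt r) * csqrt z)\<^sup>2 = of_real r * z"
    using assms by (simp add: power_mult_distrib flip: of_real_power)
  show "0 < Re (of_real (sqrt r) * csqrt z) \<or> Re (of_real (sqrt r) * csqrt z) = 0
              \<and> 0 \<le> Im (of_real (sqrt r) * csqrt z)"
    using csqrt_principal [of z] assms by auto
qed

lemma gaussian_has_integral:
  fixes k :: real
  assumes "k > 0"
  shows "integrable lborel (\<lambda>s::real. exp (- (k * s\<^sup>2)))"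
    and "(\<integral>s. exp (- (k * s\<^sup>2)) \<partial>lborel) = sqrt pi / sqrt k"
proof -
  have 0: "has_bochner_integral lborel (\<lambda>x::real. exp (- x\<^sup>2)) (sqrt pi)"
    using has_bochner_integral_even_function [OF gaussian_moment_0] by simp
  have e: "exp (- (0 + sqrt k * s)\<^sup>2) = exp (- (k * s\<^sup>2))" for s
    using assms by (simp add: power_mult_distrib)
  show "integrable lborel (\<lambda>s::real. exp (- (k * s\<^sup>2)))"
    using lborel_integrable_real_affine [OF has_bochner_integral_iff [THEN iffD1, THEN conjunct1, OF 0], of "sqrt k" 0]
      assms unfolding e by simp
  have "sqrt pi = sqrt k * (\<integral>s. exp (- (k * s\<^sup>2)) \<partial>lborel)"
    using has_bochner_integral_integral_eq [OF 0] assms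
      lborel_integral_real_affine [of "sqrt k" "\<lambda>x. exp (- x\<^sup>2)" 0] unfolding e by simp
  then show "(\<integral>s. exp (- (k * s\<^sup>2)) \<partial>lborel) = sqrt pi / sqrt k"
    using assms by (simp add: field_simps)
qed

lemma norm_exp_gaussian:
  "cmod (exp (- (Q * (of_real s)\<^sup>2))) = exp (- (Re Q * s\<^sup>2))"
  by (simp add: norm_exp_eq_Re flip: of_real_power)

lemma complex_gaussian_integrable:
  assumes "Re Q > 0"
  shows "integrable lborel (\<lambda>s::real. exp (- (Q * (of_real s)\<^sup>2)))"
  by (rule Bochner_Integration.integrable_bound [OF gaussian_has_integral(1) [OF assms]])
     (auto simp: norm_exp_gaussian intro!: borel_measurable_continuous_onI continuous_intros)

text \<open>
  Substituting \<open>z = d s\<close> with \<open>d\<close> the principal square root of \<open>Q\<close> gives the integral of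
  \<open>exp (- z\<^sup>2)\<close> along the ray direction \<open>d\<close>. As \<open>Re Q > 0\<close> means \<open>|Im d| < Re d\<close>, the line can be
  turned to the real axis while the integrand stays small at infinity; this fixes the branch.
\<close>

lemma complex_gaussian_integral:
  assumes "Re Q > 0"
  shows "(\<integral>s. exp (- (Q * (of_real s)\<^sup>2)) \<partial>lborel) = of_real (sqrt pi) / csqrt Q"
proof -
  define d where "d = csqrt Q"
  have Q: "Q = d\<^sup>2" by (simp add: d_def)
  have "Q \<noteq> 0" using assms by auto
  have dne: "d \<noteq> 0" using \<open>Q \<noteq> 0\<close> by (simp add: d_def)
  have "Re d \<ge> 0" unfolding d_def using csqrt_principal[of Q] by auto
  have sq: "(Im d)\<^sup>2 < (Re d)\<^sup>2" using assms by (simp add: Q power2_eq_square)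
  then have "Re d \<noteq> 0" by (auto simp: not_less)
  with \<open>Re d \<ge> 0\<close> have rd: "Re d > 0" by simp
  \<comment> \<open>On the segment between the points of the two lines with parameter \<open>t\<close> the integrand is at most \<open>exp (- k t\<^sup>2)\<close>.\<close>
  define k where "k = (Re d)\<^sup>2 - (Im d)\<^sup>2"
  have k: "k > 0" using sq by (simp add: k_def)
  define f :: "complex \<Rightarrow> complex" where "f = (\<lambda>z. exp (- z\<^sup>2))"
  have len: "cmod (0 + of_real t * d - (0 + of_real t * of_real (Re d))) = \<bar>t\<bar> * \<bar>Im d\<bar>" for t :: real
  proof -
    have "0 + of_real t * d - (0 + of_real t * of_real (Re d)) = of_real t * (\<i> * of_real (Im d))"
      by (simp add: complex_eq_iff)
    then show ?thesis by (simp add: norm_mult)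
  qed
  have "d * (\<integral>t. f (0 + of_real t * d) \<partial>lborel)
      = of_real (Re d) * (\<integral>t. f (0 + of_real t * of_real (Re d)) \<partial>lborel)"
  proof (rule line_integral_shift [where S = UNIV and g = "\<lambda>t. exp (- (k * t\<^sup>2))"])
    show "integrable lborel (\<lambda>t. f (0 + of_real t * d))"
      using complex_gaussian_integrable [OF assms]
      by (simp add: f_def Q power_mult_distrib mult.commute)
    show "integrable lborel (\<lambda>t. f (0 + of_real t * of_real (Re d)))"
      using complex_gaussian_integrable [of "(of_real (Re d))\<^sup>2"] rd
      by (simp add: f_def power_mult_distrib mult.commute)
    fix t z assume "z \<in> closed_segment (0 + of_real t * d) (0 + of_real t * of_real (Re d))"
    then obtain u where u: "0 \<le> u" "u \<le> 1"
      and z: "z = (1 - u) *\<^sub>R (of_real t * d) + u *\<^sub>R (of_real t * of_real (Re d))"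
      by (auto simp: closed_segment_def)
    have re: "Re z = t * Re d" and im: "Im z = (1 - u) * (t * Im d)"
      by (simp_all add: z algebra_simps)
    have "(Im z)\<^sup>2 \<le> (t * Im d)\<^sup>2"
      unfolding im power_mult_distrib [of "1 - u"] using u
      by (intro mult_left_le_one_le) (auto simp: power_le_one)
    then show "cmod (f z) \<le> exp (- (k * t\<^sup>2))"
      by (simp add: f_def norm_exp_eq_Re Re_power2 re k_def power_mult_distrib algebra_simps)
  next
    show "((\<lambda>t. exp (- (k * t\<^sup>2)) * cmod (0 + of_real t * d - (0 + of_real t * of_real (Re d)))) \<longlongrightarrow> 0) at_top"
      "((\<lambda>t. exp (- (k * t\<^sup>2)) * cmod (0 + of_real t * d - (0 + of_real t * of_real (Re d)))) \<longlongrightarrow> 0) at_bot"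
      unfolding len using k by real_asymp+
  qed (auto simp: f_def intro!: holomorphic_intros)
  also have "(\<lambda>t. f (0 + of_real t * of_real (Re d)))
           = (\<lambda>t. of_real (exp (- ((Re d)\<^sup>2 * t\<^sup>2))))"
    by (rule ext) (simp add: f_def exp_of_real [symmetric] power_mult_distrib mult.commute del: exp_of_real)
  also have "of_real (Re d) * (\<integral>t. complex_of_real (exp (- ((Re d)\<^sup>2 * t\<^sup>2))) \<partial>lborel) = of_real (sqrt pi)"
    using gaussian_has_integral(2) [of "(Re d)\<^sup>2"] rd by simp
  finally have "d * (\<integral>t. f (of_real t * d) \<partial>lborel) = of_real (sqrt pi)" by simp
  moreover have "(\<lambda>t. f (of_real t * d)) = (\<lambda>s. exp (- (Q * (of_real s)\<^sup>2)))"
    by (rule ext) (simp add: f_def Q power_mult_distrib mult.commute)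
  ultimately show ?thesis using dne by (simp add: d_def field_simps)
qed

section \<open>Laplace integrals with uniform constants\<close>

lemma pow_le_exp:
  fixes e X :: real
  assumes "e > 0" "X \<ge> 0"
  shows "X ^ n \<le> (fact n / e ^ n) * exp (e * X)"
proof -
  have "(\<Sum>i\<in>{n}. (e * X) ^ i /\<^sub>R fact i) \<le> (\<Sum>i. (e * X) ^ i /\<^sub>R fact i)"
    using assms by (intro sum_le_suminf summable_exp_generic) auto
  then have "(e * X) ^ n / fact n \<le> exp (e * X)"
    by (simp add: exp_def divide_inverse mult.commute)
  then show ?thesis using assms by (simp add: field_simps power_mult_distrib)
qed

text \<open>
  Write \<open>exp (m L) = exp (- m Q s\<^sup>2) exp z\<close>, where \<open>z\<close> collects the cubic term and the error of \<open>L\<close>.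
  For small \<open>s\<close> one has \<open>|z| \<le> \<kappa> m s\<^sup>2 / 2\<close>, so the factor \<open>exp |z|\<close> in the remainder of the
  exponential series costs only half of the Gaussian decay. The bound is stated through
  \<open>m s\<^sup>2\<close>, since powers of this quantity are absorbed by the Gaussian.
\<close>

lemma laplace_near:
  fixes Q \<tau> L g g0 g1 :: complex and s \<kappa> T A :: real
  assumes m: "m \<ge> 1" and \<kappa>: "\<kappa> > 0" and T: "T \<ge> 0" and s: "\<bar>s\<bar> \<le> 1" "4 * T * \<bar>s\<bar> \<le> \<kappa>"
    and Q: "\<kappa> \<le> Re Q" and \<tau>: "cmod \<tau> \<le> T" and A: "A \<ge> 0"
    and g0: "cmod g0 \<le> A" and g1: "cmod g1 \<le> A"
    and L: "cmod (L + Q * of_real (s\<^sup>2) - \<tau> * of_real (s ^ 3)) \<le> T * s ^ 4"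
    and g: "cmod (g - g0 - g1 * of_real s) \<le> A * s\<^sup>2"
  shows "cmod (exp (of_nat m * L) * g - exp (- (of_nat m * Q * of_real (s\<^sup>2)))
            * (g0 + g1 * of_real s + of_nat m * \<tau> * g0 * of_real (s ^ 3)))
         \<le> A / real m * ((real m * s\<^sup>2) + 3 * T * (real m * s\<^sup>2)^2 + 4 * T\<^sup>2 * (real m * s\<^sup>2) ^ 3)
            * exp (- (\<kappa> / 2 * (real m * s\<^sup>2)))"
proof -
  define X where "X = real m * s\<^sup>2"
  have X: "X \<ge> 0" by (simp add: X_def)
  define r where "r = L + Q * of_real (s\<^sup>2) - \<tau> * of_real (s ^ 3)"
  define z where "z = of_nat m * (\<tau> * of_real (s ^ 3) + r)"
  define E where "E = exp (- (of_nat m * Q * of_real (s\<^sup>2)))"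
  have r: "cmod r \<le> T * s ^ 4" using L by (simp add: r_def)
  have s43: "s ^ 4 \<le> \<bar>s\<bar> ^ 3"
  proof -
    have "s ^ 4 = \<bar>s\<bar> ^ 3 * \<bar>s\<bar>" by (simp add: power_numeral_reduce flip: abs_mult)
    also have "\<dots> \<le> \<bar>s\<bar> ^ 3" using s(1) by (intro mult_left_le) auto
    finally show ?thesis .
  qed
  have "cmod (\<tau> * of_real (s ^ 3) + r) \<le> T * \<bar>s\<bar> ^ 3 + T * s ^ 4"
    by (rule norm_triangle_mono) (use r \<tau> in \<open>auto simp: norm_mult norm_power intro!: mult_right_mono\<close>)
  also have "\<dots> \<le> 2 * T * \<bar>s\<bar> ^ 3" using mult_left_mono [OF s43 T] by simp
  finally have z1: "cmod z \<le> real m * (2 * T * \<bar>s\<bar> ^ 3)"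
    unfolding z_def norm_mult norm_of_nat by (rule mult_left_mono) simp
  have z2: "cmod z \<le> \<kappa> / 2 * X"
  proof -
    have "real m * (2 * T * \<bar>s\<bar> ^ 3) = real m * s\<^sup>2 * (4 * T * \<bar>s\<bar>) / 2"
      by (simp add: power_numeral_reduce field_simps flip: abs_mult)
    also have "\<dots> \<le> real m * s\<^sup>2 * \<kappa> / 2" using s(2) by (intro divide_right_mono mult_left_mono) auto
    also have "\<dots> = \<kappa> / 2 * X" by (simp add: X_def)
    finally show ?thesis using z1 by linarith
  qed
  have expL: "exp (of_nat m * L) = E * exp z"
    unfolding E_def z_def r_def exp_add [symmetric] by (rule arg_cong [where f = exp]) (simp add: algebra_simps)
  have ez: "cmod (exp z) \<le> exp (cmod z)" by (rule norm_exp)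
  have ez1: "cmod (exp z - 1) \<le> cmod z * exp (cmod z)"
    using Taylor_exp_field [of z 0] by (simp add: mult.commute)
  have ez2: "cmod (exp z - 1 - z) \<le> (cmod z)\<^sup>2 * exp (cmod z)"
    using Taylor_exp_field [of z 1] by (simp add: mult.commute power2_eq_square diff_diff_eq)
  \<comment> \<open>Each summand on the right is a second order remainder, or a product of two first order terms.\<close>
  have id: "exp (of_nat m * L) * g - E * (g0 + g1 * of_real s + of_nat m * \<tau> * g0 * of_real (s ^ 3))
      = E * (exp z * (g - g0 - g1 * of_real s) + (exp z - 1) * (g1 * of_real s)
          + (exp z - 1 - z) * g0 + of_nat m * r * g0)"
    unfolding expL z_def by (simp add: algebra_simps)
  let ?e = "exp (cmod z)"
  have e1: "1 \<le> ?e" by simp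
  have b1: "cmod (exp z * (g - g0 - g1 * of_real s)) \<le> ?e * (A * s\<^sup>2)"
    unfolding norm_mult by (intro mult_mono ez g) auto
  have b2: "cmod ((exp z - 1) * (g1 * of_real s)) \<le> ?e * (A * (2 * T * (real m * s ^ 4)))"
  proof -
    have "cmod ((exp z - 1) * (g1 * of_real s)) \<le> (cmod z * ?e) * (A * \<bar>s\<bar>)"
      unfolding norm_mult norm_of_real by (intro mult_mono ez1 g1) (use A in auto)
    also have "\<dots> \<le> ((real m * (2 * T * \<bar>s\<bar> ^ 3)) * ?e) * (A * \<bar>s\<bar>)"
      using A by (intro mult_right_mono z1) auto
    also have "\<dots> = ?e * (A * (2 * T * (real m * s ^ 4)))"
      by (simp add: power_numeral_reduce flip: abs_mult)
    finally show ?thesis .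
  qed
  have b3: "cmod ((exp z - 1 - z) * g0) \<le> ?e * (A * (4 * T\<^sup>2 * ((real m)\<^sup>2 * s ^ 6)))"
  proof -
    have "cmod ((exp z - 1 - z) * g0) \<le> ((cmod z)\<^sup>2 * ?e) * A"
      unfolding norm_mult by (intro mult_mono ez2 g0) auto
    also have "\<dots> \<le> ((real m * (2 * T * \<bar>s\<bar> ^ 3))\<^sup>2 * ?e) * A"
      using A by (intro mult_right_mono power_mono z1) auto
    also have "\<dots> = ?e * (A * (4 * T\<^sup>2 * ((real m)\<^sup>2 * s ^ 6)))"
      by (simp add: power_mult_distrib power_even_abs flip: power_mult)
    finally show ?thesis .
  qed
  have b4: "cmod (of_nat m * r * g0) \<le> ?e * (A * (T * (real m * s ^ 4)))"
  proof -
    have "cmod (of_nat m * r * g0) \<le> real m * (T * s ^ 4) * A"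
      unfolding norm_mult norm_of_nat by (intro mult_mono mult_left_mono r g0) (use T in auto)
    also have "\<dots> \<le> ?e * (real m * (T * s ^ 4) * A)"
      using mult_right_mono [OF e1, of "real m * (T * s ^ 4) * A"] T A by simp
    finally show ?thesis by (simp add: mult_ac)
  qed
  have sum: "cmod (exp z * (g - g0 - g1 * of_real s) + (exp z - 1) * (g1 * of_real s)
          + (exp z - 1 - z) * g0 + of_nat m * r * g0)
       \<le> ?e * (A * s\<^sup>2) + ?e * (A * (2 * T * (real m * s ^ 4)))
         + ?e * (A * (4 * T\<^sup>2 * ((real m)\<^sup>2 * s ^ 6))) + ?e * (A * (T * (real m * s ^ 4)))"
    by (intro norm_triangle_mono b1 b2 b3 b4)
  also have "\<dots> = ?e * (A / real m * (X + 3 * T * X\<^sup>2 + 4 * T\<^sup>2 * X ^ 3))"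
    using m by (simp add: X_def power_mult_distrib field_simps power2_eq_square power_numeral_reduce)
  finally have S: "cmod (exp z * (g - g0 - g1 * of_real s) + (exp z - 1) * (g1 * of_real s)
          + (exp z - 1 - z) * g0 + of_nat m * r * g0) \<le> ?e * (A / real m * (X + 3 * T * X\<^sup>2 + 4 * T\<^sup>2 * X ^ 3))" .
  have nE: "cmod E \<le> exp (- (\<kappa> * X))"
    using mult_right_mono [OF Q X] by (simp add: E_def norm_exp_eq_Re X_def mult_ac)
  have "cmod (exp (of_nat m * L) * g - E * (g0 + g1 * of_real s + of_nat m * \<tau> * g0 * of_real (s ^ 3)))
     \<le> exp (- (\<kappa> * X)) * (?e * (A / real m * (X + 3 * T * X\<^sup>2 + 4 * T\<^sup>2 * X ^ 3)))"
    unfolding id norm_mult [of E] by (intro mult_mono nE S) auto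
  also have "\<dots> \<le> exp (- (\<kappa> * X)) * (exp (\<kappa> / 2 * X) * (A / real m * (X + 3 * T * X\<^sup>2 + 4 * T\<^sup>2 * X ^ 3)))"
    using z2 A T X by (intro mult_left_mono mult_right_mono) auto
  also have "\<dots> = (A / real m * (X + 3 * T * X\<^sup>2 + 4 * T\<^sup>2 * X ^ 3)) * (exp (- (\<kappa> * X)) * exp (\<kappa> / 2 * X))"
    by simp
  also have "exp (- (\<kappa> * X)) * exp (\<kappa> / 2 * X) = exp (- (\<kappa> / 2 * X))"
    unfolding exp_add [symmetric] by (simp add: algebra_simps)
  finally show ?thesis by (simp add: E_def X_def)
qed

text \<open>
  Away from the maximum nothing cancels, but \<open>1 \<le> s\<^sup>2 / \<delta>\<^sup>2\<close> there; inserting this factor produces the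
  same form of bound as near the maximum, so that both can be integrated together.
\<close>

lemma laplace_far:
  fixes Q \<tau> f g0 g1 :: complex and s \<kappa> T A :: real
  assumes m: "m \<ge> 1" and \<kappa>: "\<kappa> > 0" and T: "T \<ge> 0" and \<delta>: "0 < \<delta>" "\<delta> \<le> \<bar>s\<bar>"
    and Q: "\<kappa> \<le> Re Q" and \<tau>: "cmod \<tau> \<le> T" and A: "A \<ge> 0"
    and g0: "cmod g0 \<le> A" and g1: "cmod g1 \<le> A"
    and f: "cmod f \<le> A * exp (- (\<kappa> * real m * s\<^sup>2))"
  shows "cmod (f - exp (- (of_nat m * Q * of_real (s\<^sup>2)))
            * (g0 + g1 * of_real s + of_nat m * \<tau> * g0 * of_real (s ^ 3)))
         \<le> A / real m * ((2 / \<delta>\<^sup>2 + 1 / \<delta>) * (real m * s\<^sup>2) + T / \<delta> * (real m * s\<^sup>2)^2)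
            * exp (- (\<kappa> / 2 * (real m * s\<^sup>2)))"
proof -
  define X where "X = real m * s\<^sup>2"
  have X: "X \<ge> 0" by (simp add: X_def)
  define E where "E = exp (- (of_nat m * Q * of_real (s\<^sup>2)))"
  have nE: "cmod E \<le> exp (- (\<kappa> * X))"
    using mult_right_mono [OF Q X] by (simp add: E_def norm_exp_eq_Re X_def mult_ac)
  have "cmod (g0 + g1 * of_real s + of_nat m * \<tau> * g0 * of_real (s ^ 3))
        \<le> A + A * \<bar>s\<bar> + real m * T * A * \<bar>s\<bar> ^ 3"
    unfolding norm_mult norm_of_nat norm_of_real norm_power power_abs
    by (intro norm_triangle_mono g0)
       (use T A g0 g1 \<tau> in \<open>auto simp: norm_mult norm_power intro!: mult_mono mult_right_mono\<close>)
  then have "cmod (E * (g0 + g1 * of_real s + of_nat m * \<tau> * g0 * of_real (s ^ 3)))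
        \<le> exp (- (\<kappa> * X)) * (A + A * \<bar>s\<bar> + real m * T * A * \<bar>s\<bar> ^ 3)"
    unfolding norm_mult [of E] by (intro mult_mono nE) auto
  with f have "cmod (f - E * (g0 + g1 * of_real s + of_nat m * \<tau> * g0 * of_real (s ^ 3)))
        \<le> A * exp (- (\<kappa> * X)) + exp (- (\<kappa> * X)) * (A + A * \<bar>s\<bar> + real m * T * A * \<bar>s\<bar> ^ 3)"
    by (intro order_trans [OF norm_triangle_ineq4] add_mono) (auto simp: X_def mult_ac)
  also have "\<dots> = A * exp (- (\<kappa> * X)) * (2 + \<bar>s\<bar> + real m * T * \<bar>s\<bar> ^ 3)"
    by (simp add: algebra_simps)
  also have "\<dots> \<le> A * exp (- (\<kappa> * X)) * (2 * (s\<^sup>2 / \<delta>\<^sup>2) + s\<^sup>2 / \<delta> + real m * T * (s ^ 4 / \<delta>))"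
  proof (intro mult_left_mono add_mono)
    have "1 \<le> s\<^sup>2 / \<delta>\<^sup>2" using power_mono [OF \<delta>(2), of 2] \<delta>(1) by simp
    then show "2 \<le> 2 * (s\<^sup>2 / \<delta>\<^sup>2)" by simp
    have *: "\<delta> * \<bar>s\<bar> \<le> s\<^sup>2" using mult_right_mono [OF \<delta>(2), of "\<bar>s\<bar>"] by (simp add: power2_eq_square)
    then show "\<bar>s\<bar> \<le> s\<^sup>2 / \<delta>" using \<delta>(1) by (simp add: field_simps)
    have "\<delta> * \<bar>s\<bar> ^ 3 \<le> \<bar>s\<bar> * \<bar>s\<bar> ^ 3" using \<delta>(2) by (intro mult_right_mono) auto
    also have "\<dots> = s ^ 4" by (simp add: power_numeral_reduce flip: abs_mult)
    finally show "\<bar>s\<bar> ^ 3 \<le> s ^ 4 / \<delta>" using \<delta>(1) by (simp add: field_simps)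
  qed (use A T in auto)
  also have "\<dots> = A / real m * ((2 / \<delta>\<^sup>2 + 1 / \<delta>) * X + T / \<delta> * X\<^sup>2) * exp (- (\<kappa> * X))"
    using m \<delta>(1) by (simp add: X_def power2_eq_square field_simps power_numeral_reduce)
  also have "\<dots> \<le> A / real m * ((2 / \<delta>\<^sup>2 + 1 / \<delta>) * X + T / \<delta> * X\<^sup>2) * exp (- (\<kappa> / 2 * X))"
    using \<delta>(1) A T X \<kappa> by (intro mult_left_mono) auto
  finally show ?thesis by (simp add: E_def X_def)
qed

lemma integral_odd_eq_0:
  fixes f :: "real \<Rightarrow> complex"
  assumes "\<And>x. f (- x) = - f x"
  shows "(\<integral>x. f x \<partial>lborel) = 0"
  using lborel_integral_real_affine [of "-1" f 0] assms by simp

text \<open>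
  The first factor bounds the coefficients of the polynomials in \<open>m s\<^sup>2\<close> from \<open>laplace_near\<close> and
  \<open>laplace_far\<close>, the second is the price of absorbing \<open>X\<close>, \<open>X\<^sup>2\<close>, \<open>X\<^sup>3\<close> into \<open>exp (\<kappa> X / 4)\<close>, and the
  last comes from the integral of the remaining Gaussian.
\<close>

definition laplace_const :: "real \<Rightarrow> real \<Rightarrow> real \<Rightarrow> real" where
  "laplace_const \<kappa> T \<delta> = (1 + 3 * T + 4 * T\<^sup>2 + 2 / \<delta>\<^sup>2 + 1 / \<delta> + T / \<delta>)
      * (1 / (\<kappa>/4) + 2 / (\<kappa>/4)^2 + 6 / (\<kappa>/4)^3) * (sqrt pi / sqrt (\<kappa> / 4))"

lemma laplace_const_nonneg:
  "\<kappa> > 0 \<Longrightarrow> T \<ge> 0 \<Longrightarrow> \<delta> > 0 \<Longrightarrow> laplace_const \<kappa> T \<delta> \<ge> 0"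
  by (simp add: laplace_const_def)

text \<open>
  The amplitude \<open>g\<close> and the exponent \<open>L\<close> need be known only near \<open>s = 0\<close>; elsewhere \<open>f\<close> just has to
  be dominated by a Gaussian. After subtraction of the model
  \<open>exp (- m Q s\<^sup>2) (g0 + g1 s + m \<tau> g0 s\<^sup>3)\<close> the error is at most \<open>(const A / m) exp (- \<kappa> m s\<^sup>2 / 4)\<close>
  on the whole line, and the two odd terms of the model do not contribute to the integral.
  Keeping the amplitude bound \<open>A\<close> separate from the constant is what later makes the
  estimate summable over the index of the coefficient.
\<close>

lemma laplace_uniform:
  fixes \<kappa> T \<delta> A :: real and m :: nat and f :: "real \<Rightarrow> complex" and Q \<tau> g0 g1 :: complex
  assumes \<kappa>: "\<kappa> > 0" and T: "T \<ge> 0" and \<delta>: "0 < \<delta>" "\<delta> \<le> 1" "4 * T * \<delta> \<le> \<kappa>"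
    and m: "m \<ge> 1" and A: "A \<ge> 0" and meas: "f \<in> borel_measurable lborel"
    and Q: "\<kappa> \<le> Re Q" and \<tau>: "cmod \<tau> \<le> T" and g0: "cmod g0 \<le> A" and g1: "cmod g1 \<le> A"
    and f: "\<And>s. cmod (f s) \<le> A * exp (- (\<kappa> * real m * s\<^sup>2))"
    and near: "\<And>s. \<bar>s\<bar> \<le> \<delta> \<Longrightarrow> (\<exists>L g. f s = exp (of_nat m * L) * g \<and>
                 cmod (L + Q * of_real (s\<^sup>2) - \<tau> * of_real (s ^ 3)) \<le> T * s ^ 4 \<and>
                 cmod (g - g0 - g1 * of_real s) \<le> A * s\<^sup>2)"
  shows "cmod ((\<integral>s. f s \<partial>lborel) - g0 * of_real (sqrt pi / sqrt (real m)) / csqrt Q)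
             \<le> laplace_const \<kappa> T \<delta> * A / (real m * sqrt (real m))"
proof -
  define K where "K = (1 + 3 * T + 4 * T\<^sup>2 + 2 / \<delta>\<^sup>2 + 1 / \<delta> + T / \<delta>)
      * (1 / (\<kappa>/4) + 2 / (\<kappa>/4)^2 + 6 / (\<kappa>/4)^3)"
  have K0: "K \<ge> 0" using \<kappa> T \<delta> by (simp add: K_def)
  define C where "C = laplace_const \<kappa> T \<delta>"
  have C_eq: "C = K * (sqrt pi / sqrt (\<kappa> / 4))" by (simp add: C_def laplace_const_def K_def)
  have poly: "(a * X + b * X\<^sup>2 + c * X ^ 3) * exp (- (\<kappa> / 2 * X)) \<le> K * exp (- (\<kappa> / 4 * X))"
    if "X \<ge> 0" "0 \<le> a" "0 \<le> b" "0 \<le> c"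
       "a \<le> 1 + 2 / \<delta>\<^sup>2 + 1 / \<delta>" "b \<le> 3 * T + T / \<delta>" "c \<le> 4 * T\<^sup>2" for X a b c
  proof -
    define D where "D = 1 + 3 * T + 4 * T\<^sup>2 + 2 / \<delta>\<^sup>2 + 1 / \<delta> + T / \<delta>"
    have pos: "0 \<le> 2 / \<delta>\<^sup>2" "0 \<le> 1 / \<delta>" "0 \<le> T / \<delta>" "0 \<le> T\<^sup>2" using \<delta> T by auto
    have D: "a \<le> D" "b \<le> D" "c \<le> D" "0 \<le> D" using that pos T by (auto simp: D_def)
    have "a * X + b * X\<^sup>2 + c * X ^ 3 \<le> D * X + D * X\<^sup>2 + D * X ^ 3"
      by (intro add_mono mult_right_mono D) (use that in auto)
    also have "\<dots> = D * (X ^ 1 + X\<^sup>2 + X ^ 3)" by (simp add: algebra_simps)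
    also have "\<dots> \<le> D * ((fact 1 / (\<kappa>/4) ^ 1) * exp (\<kappa>/4 * X) + (fact 2 / (\<kappa>/4) ^ 2) * exp (\<kappa>/4 * X)
                + (fact 3 / (\<kappa>/4) ^ 3) * exp (\<kappa>/4 * X))"
      using \<kappa> that by (intro mult_left_mono add_mono pow_le_exp D) auto
    also have "\<dots> = K * exp (\<kappa>/4 * X)"
    proof -
      have "K = D * (1 / (\<kappa>/4) + 2 / (\<kappa>/4)^2 + 6 / (\<kappa>/4)^3)" by (simp add: K_def D_def)
      then show ?thesis by (simp add: fact_numeral distrib_left distrib_right)
    qed
    finally have "(a * X + b * X\<^sup>2 + c * X ^ 3) * exp (- (\<kappa> / 2 * X)) \<le> K * exp (\<kappa>/4 * X) * exp (- (\<kappa> / 2 * X))"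
      by (intro mult_right_mono) auto
    also have "\<dots> = K * (exp (\<kappa>/4 * X) * exp (- (\<kappa> / 2 * X)))" by simp
    also have "exp (\<kappa>/4 * X) * exp (- (\<kappa> / 2 * X)) = exp (- (\<kappa> / 4 * X))"
      unfolding exp_add [symmetric] by (simp add: algebra_simps)
    finally show ?thesis .
  qed
  define E where "E = (\<lambda>s::real. exp (- (of_nat m * Q * of_real (s\<^sup>2))))"
  define odd_part where "odd_part = (\<lambda>s. E s * (g1 * of_real s + of_nat m * \<tau> * g0 * of_real (s ^ 3)))"
  define err where "err = (\<lambda>s. f s - E s * (g0 + g1 * of_real s + of_nat m * \<tau> * g0 * of_real (s ^ 3)))"
  have err: "cmod (err s) \<le> K * A / real m * exp (- (\<kappa> / 4 * real m * s\<^sup>2))" for s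
  proof -
    define X where "X = real m * s\<^sup>2"
    have X: "X \<ge> 0" by (simp add: X_def)
    have pos: "0 \<le> 2 / \<delta>\<^sup>2" "0 \<le> 1 / \<delta>" "0 \<le> T / \<delta>" using \<delta> T by auto
    have "\<exists>a b c. 0 \<le> a \<and> 0 \<le> b \<and> 0 \<le> c \<and>
     a \<le> 1 + 2 / \<delta>\<^sup>2 + 1 / \<delta> \<and> b \<le> 3 * T + T / \<delta> \<and> c \<le> 4 * T\<^sup>2 \<and>
     cmod (err s) \<le> A / real m * (a * X + b * X\<^sup>2 + c * X ^ 3) * exp (- (\<kappa> / 2 * X))"
    proof (cases "\<bar>s\<bar> \<le> \<delta>")
      case True
      then obtain L g where Lg: "f s = exp (of_nat m * L) * g"
           "cmod (L + Q * of_real (s\<^sup>2) - \<tau> * of_real (s ^ 3)) \<le> T * s ^ 4"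
           "cmod (g - g0 - g1 * of_real s) \<le> A * s\<^sup>2" using near by blast
      have s: "\<bar>s\<bar> \<le> 1" "4 * T * \<bar>s\<bar> \<le> \<kappa>"
        using True \<delta> mult_left_mono [OF True, of "4 * T"] T by auto
      show ?thesis
        using laplace_near [OF m \<kappa> T s Q \<tau> A g0 g1 Lg(2,3)] pos T
        by (intro exI [of _ 1] exI [of _ "3*T"] exI [of _ "4 * T\<^sup>2"])
           (auto simp: err_def E_def X_def Lg(1))
    next
      case False
      then show ?thesis
        using laplace_far [OF m \<kappa> T \<delta>(1) _ Q \<tau> A g0 g1 f, of s] pos T
        by (intro exI [of _ "2 / \<delta>\<^sup>2 + 1 / \<delta>"] exI [of _ "T / \<delta>"] exI [of _ 0])
           (auto simp: err_def E_def X_def)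
    qed
    then obtain a b c where abc: "0 \<le> a" "0 \<le> b" "0 \<le> c"
      "a \<le> 1 + 2 / \<delta>\<^sup>2 + 1 / \<delta>" "b \<le> 3 * T + T / \<delta>" "c \<le> 4 * T\<^sup>2"
      and e: "cmod (err s) \<le> A / real m * (a * X + b * X\<^sup>2 + c * X ^ 3) * exp (- (\<kappa> / 2 * X))" by blast
    have "cmod (err s) \<le> A / real m * ((a * X + b * X\<^sup>2 + c * X ^ 3) * exp (- (\<kappa> / 2 * X)))"
      using e by (simp add: mult.assoc)
    also have "\<dots> \<le> A / real m * (K * exp (- (\<kappa> / 4 * X)))"
      by (intro mult_left_mono poly X abc) (use A in auto)
    finally show ?thesis by (simp add: X_def mult_ac)
  qed
  have \<kappa>m: "\<kappa> / 4 * real m > 0" "\<kappa> * real m > 0" using \<kappa> m by auto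
  have mQ: "Re (of_nat m * Q) > 0" using m Q \<kappa> by simp
  have iE: "integrable lborel E"
    using complex_gaussian_integrable [OF mQ] by (simp add: E_def mult.assoc)
  have ibd: "integrable lborel (\<lambda>s. K * A / real m * exp (- (\<kappa> / 4 * real m * s\<^sup>2)))"
    by (intro integrable_mult_right gaussian_has_integral \<kappa>m)
  have merr: "err \<in> borel_measurable lborel"
  proof -
    have "(\<lambda>s. E s * (g0 + g1 * of_real s + of_nat m * \<tau> * g0 * of_real (s ^ 3))) \<in> borel_measurable lborel"
      unfolding E_def by (auto intro!: borel_measurable_continuous_onI continuous_intros)
    then show ?thesis unfolding err_def using meas by simp
  qed
  have ierr: "integrable lborel err"
    by (rule Bochner_Integration.integrable_bound [OF ibd merr])
       (use err K0 A in \<open>auto intro!: order_trans [OF err] divide_right_mono\<close>)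
  have int_f: "integrable lborel f"
    by (rule Bochner_Integration.integrable_bound
          [OF integrable_mult_right [OF gaussian_has_integral(1) [OF \<kappa>m(2)], of A] meas])
       (use f A in auto)
  have feq: "f s = err s + (g0 * E s + odd_part s)" for s by (simp add: err_def odd_part_def algebra_simps)
  have odd_part_eq: "odd_part = (\<lambda>s. f s - err s - g0 * E s)" using feq by (auto simp: fun_eq_iff)
  have iodd: "integrable lborel odd_part" unfolding odd_part_eq using int_f ierr iE by auto
  have "(\<integral>s. odd_part s \<partial>lborel) = 0"
    by (rule integral_odd_eq_0) (simp add: odd_part_def E_def algebra_simps)
  then have "(\<integral>s. f s \<partial>lborel) = (\<integral>s. err s \<partial>lborel) + g0 * (\<integral>s. E s \<partial>lborel)"
    unfolding feq using ierr iE iodd by simp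
  also have "(\<integral>s. E s \<partial>lborel) = of_real (sqrt pi) / csqrt (of_nat m * Q)"
    using complex_gaussian_integral [OF mQ] by (simp add: E_def mult.assoc)
  also have "csqrt (of_nat m * Q) = of_real (sqrt (real m)) * csqrt Q"
    using csqrt_of_real_mult_nonneg [of "real m" Q] m by simp
  finally have "(\<integral>s. f s \<partial>lborel) - g0 * of_real (sqrt pi / sqrt (real m)) / csqrt Q = (\<integral>s. err s \<partial>lborel)"
    by simp
  also have "cmod \<dots> \<le> (\<integral>s. K * A / real m * exp (- (\<kappa> / 4 * real m * s\<^sup>2)) \<partial>lborel)"
    using ierr ibd err by (intro order_trans [OF integral_norm_bound] integral_mono) auto
  also have "\<dots> = K * A / real m * (sqrt pi / sqrt (\<kappa> / 4 * real m))"
    using gaussian_has_integral(2) [OF \<kappa>m(1)] by simp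
  also have "\<dots> = C * A / (real m * sqrt (real m))"
    by (simp add: C_eq real_sqrt_mult real_sqrt_divide mult_ac)
  finally show "cmod ((\<integral>s. f s \<partial>lborel) - g0 * of_real (sqrt pi / sqrt (real m)) / csqrt Q)
             \<le> laplace_const \<kappa> T \<delta> * A / (real m * sqrt (real m))" by (simp add: C_def)
qed

section \<open>The saddle point and the vertical line through it\<close>

text \<open>
  The parameter \<open>\<alpha>\<close> whose saddle point has real part \<open>c\<close>. The formula comes from the cubic
  \<open>\<alpha> (z\<^sup>3 - z) + 1\<close>: with roots \<open>c \<plusminus> i y\<close> and \<open>- 2 c\<close>, inserting the real root gives \<open>\<alpha>\<close> and the sum of
  the products of pairs of roots gives \<open>y\<^sup>2 = 3 c\<^sup>2 - 1\<close>.
\<close>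

definition saddle_rate :: "real \<Rightarrow> real" where
  "saddle_rate c = 1 / (2 * c * (4 * c\<^sup>2 - 1))"

definition saddle_im :: "real \<Rightarrow> real" where
  "saddle_im c = sqrt (3 * c\<^sup>2 - 1)"

definition saddle_pt :: "real \<Rightarrow> complex" where
  "saddle_pt c = Complex c (saddle_im c)"

definition cayley :: "complex \<Rightarrow> complex" where
  "cayley z = (z - 1) / (z + 1)"

text \<open>
  For \<open>z \<noteq> 1\<close> this is \<open>w(z)\<^sup>j / (1 - z\<^sup>2)\<close> with \<open>j = i + 1\<close> and \<open>w\<close> the Cayley transform. The pole of \<open>1 / (1 - z\<^sup>2)\<close> at
  \<open>z = 1\<close> is cancelled by the zero of \<open>w\<close>, and in this form the function is regular there, which
  matters because the saddle line passes through \<open>1\<close> when \<open>c = 1\<close>.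
\<close>

definition kern :: "nat \<Rightarrow> complex \<Rightarrow> complex" where
  "kern i z = - (cayley z ^ i / (1 + z)\<^sup>2)"

lemma saddle_pt_simps [simp]: "Re (saddle_pt c) = c" "Im (saddle_pt c) = saddle_im c"
  by (simp_all add: saddle_pt_def)

context
  fixes c :: real
  assumes c0: "0 < c" and c3: "1 < 3 * c\<^sup>2"
begin

lemma saddle_im_pos: "saddle_im c > 0"
  using c3 by (simp add: saddle_im_def)

lemma saddle_im_sq: "(saddle_im c)\<^sup>2 = 3 * c\<^sup>2 - 1"
  using c3 by (simp add: saddle_im_def)

lemma two_c_gt_1: "2 * c > 1"
proof (rule ccontr)
  assume "\<not> 2 * c > 1"
  then have "c\<^sup>2 \<le> (1/2)\<^sup>2" using c0 by (intro power_mono) auto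
  with c3 show False by (simp add: power2_eq_square)
qed

lemma four_c_sq_gt_1: "4 * c\<^sup>2 - 1 > 0"
  using c3 by simp

lemma saddle_rate_pos: "saddle_rate c > 0"
  using c0 four_c_sq_gt_1 by (simp add: saddle_rate_def)

lemma saddle_rate_eq: "saddle_rate c * (2 * c * (4 * c\<^sup>2 - 1)) = 1"
  using c0 four_c_sq_gt_1 by (simp add: saddle_rate_def)

lemma saddle_pt_cubic: "of_real (saddle_rate c) * ((saddle_pt c) ^ 3 - saddle_pt c) + 1 = 0"
proof -
  have e: "saddle_im c * saddle_im c = 3 * c * c - 1"
    using saddle_im_sq by (simp add: power2_eq_square)
  have re: "Re ((saddle_pt c) ^ 3 - saddle_pt c) = - (2 * c * (4 * c\<^sup>2 - 1))"
  proof -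
    have "Re ((saddle_pt c) ^ 3 - saddle_pt c) = c * c * c - 3 * c * (saddle_im c * saddle_im c) - c"
      by (simp add: power3_eq_cube algebra_simps)
    then show ?thesis unfolding e by (simp add: algebra_simps power2_eq_square)
  qed
  have im: "Im ((saddle_pt c) ^ 3 - saddle_pt c) = 0"
  proof -
    have "Im ((saddle_pt c) ^ 3 - saddle_pt c) = saddle_im c * (3 * c * c - saddle_im c * saddle_im c - 1)"
      by (simp add: power3_eq_cube algebra_simps)
    then show ?thesis unfolding e by simp
  qed
  show ?thesis
    using re im saddle_rate_eq by (simp add: complex_eq_iff)
qed

lemma saddle_pt_sq_ne: "(saddle_pt c)\<^sup>2 \<noteq> 1"
proof
  assume "(saddle_pt c)\<^sup>2 = 1"
  then have "(saddle_pt c) ^ 3 = saddle_pt c" by (simp add: power3_eq_cube power2_eq_square)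
  then show False using saddle_pt_cubic by simp
qed

text \<open>
  The critical point equation in the form in which it eliminates \<open>1 / (1 - z\<^sup>2)\<close> from values at the
  saddle.
\<close>

lemma saddle_pt_inverse: "1 / ((saddle_pt c)\<^sup>2 - 1) = - (of_real (saddle_rate c) * saddle_pt c)"
proof -
  have "- (of_real (saddle_rate c) * saddle_pt c) * ((saddle_pt c)\<^sup>2 - 1) = 1"
    using saddle_pt_cubic by (simp add: algebra_simps power3_eq_cube power2_eq_square)
  then show ?thesis using saddle_pt_sq_ne by (intro divide_eq_imp) auto
qed

text \<open>
  Let \<open>c + i \<eta>\<close> be the saddle and \<open>\<alpha> = saddle_rate c\<close>. With \<open>u = y\<^sup>2\<close>, \<open>v = \<eta>\<^sup>2\<close>, \<open>p = (c - 1)\<^sup>2\<close>, \<open>q = (c + 1)\<^sup>2\<close> the quotient of the rational factors at \<open>u\<close> and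
  \<open>v\<close> is exactly \<open>1 + x (q + v) / (q + u)\<close> with \<open>x = 2 \<alpha> (u - v)\<close>; this identity is the saddle point
  equation in disguise. Bounding it by the exponential leaves
  \<open>exp (- x (u - v) / (q + u))\<close> after multiplication with \<open>exp (- x)\<close>.
\<close>

lemma line_majorant_real:
  assumes u: "u \<ge> 0"
  shows "((c - 1)\<^sup>2 + u) / ((c + 1)\<^sup>2 + u) * exp (- (2 * saddle_rate c * (u - (saddle_im c)\<^sup>2)))
    \<le> ((c - 1)\<^sup>2 + (saddle_im c)\<^sup>2) / ((c + 1)\<^sup>2 + (saddle_im c)\<^sup>2)
       * exp (- (2 * saddle_rate c * (u - (saddle_im c)\<^sup>2)\<^sup>2 / ((c + 1)\<^sup>2 + u)))"
proof -
  define p q v where "p = (c - 1)\<^sup>2" and "q = (c + 1)\<^sup>2" and "v = (saddle_im c)\<^sup>2"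
  define x where "x = 2 * saddle_rate c * (u - v)"
  have v: "v = 3 * c\<^sup>2 - 1" by (simp add: v_def saddle_im_sq)
  have q: "q + u > 0" "q + v > 0" using c0 u c3 by (auto simp: q_def v add_pos_nonneg)
  have pv: "p + v = 2 * c * (2 * c - 1)" by (simp add: p_def v power2_eq_square algebra_simps)
  have qv: "q + v = 2 * c * (2 * c + 1)" by (simp add: q_def v power2_eq_square algebra_simps)
  have pv0: "p + v > 0" unfolding pv using two_c_gt_1 c0 by simp
  have qp: "q - p = 4 * c" by (simp add: p_def q_def power2_eq_square algebra_simps)
  have "2 * saddle_rate c * ((p + v) * (q + v)) = 4 * c * (saddle_rate c * (2 * c * (4 * c\<^sup>2 - 1)))"
    unfolding pv qv by (simp add: algebra_simps power2_eq_square)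
  then have r: "2 * saddle_rate c * ((p + v) * (q + v)) = q - p"
    unfolding saddle_rate_eq qp by simp
  have "(p + u) * (q + v) = (p + v) * (q + u) + (q - p) * (u - v)" by (simp add: algebra_simps)
  also have "\<dots> = (p + v) * (q + u) + x * ((p + v) * (q + v))"
    unfolding r [symmetric] x_def by simp
  finally have e: "(p + u) * (q + v) = (p + v) * (q + u) + x * ((p + v) * (q + v))" .
  have alg: "(e * a + x * (e * b)) / (a * b) = e / b * (1 + x * (b / a))" if "a > 0" "b > 0" for a b e :: real
    using that by (simp add: field_simps)
  have "(p + u) / (q + u) = ((p + u) * (q + v)) / ((q + u) * (q + v))" using q by simp
  also have "\<dots> = (p + v) / (q + v) * (1 + x * ((q + v) / (q + u)))"
    unfolding e by (rule alg [OF q])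
  also have "\<dots> \<le> (p + v) / (q + v) * exp (x * ((q + v) / (q + u)))"
    using q pv0 by (intro mult_left_mono exp_ge_add_one_self) auto
  finally have "(p + u) / (q + u) * exp (- x) \<le> (p + v) / (q + v) * exp (x * ((q + v) / (q + u))) * exp (- x)"
    by (rule mult_right_mono) simp
  also have "\<dots> = (p + v) / (q + v) * exp (x * ((q + v) / (q + u)) - x)"
    by (simp add: exp_diff exp_minus divide_inverse mult.assoc)
  also have "x * ((q + v) / (q + u)) - x = - (2 * saddle_rate c * (u - v)\<^sup>2 / (q + u))"
    using q by (simp add: x_def field_simps power2_eq_square)
  finally show ?thesis by (simp add: p_def q_def v_def x_def)
qed

text \<open>
  Converts the exponent, quadratic in \<open>y\<^sup>2 - \<eta>\<^sup>2\<close>, into one that is quadratic in \<open>y - \<eta>\<close>, using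
  \<open>(y + \<eta>)\<^sup>2 \<ge> y\<^sup>2 + \<eta>\<^sup>2\<close>.
\<close>

lemma line_majorant_exponent:
  assumes y: "y \<ge> 0"
  shows "(saddle_im c)\<^sup>2 / (4 * c\<^sup>2 + 2 * c) * (y - saddle_im c)\<^sup>2
           \<le> (y\<^sup>2 - (saddle_im c)\<^sup>2)\<^sup>2 / ((c + 1)\<^sup>2 + y\<^sup>2)"
proof -
  define v where "v = saddle_im c"
  have v: "v > 0" using saddle_im_pos by (simp add: v_def)
  have q: "4 * c\<^sup>2 + 2 * c = (c + 1)\<^sup>2 + v\<^sup>2"
    unfolding v_def saddle_im_sq by (simp add: power2_eq_square algebra_simps)
  have pos: "(c + 1)\<^sup>2 + v\<^sup>2 > 0" "(c + 1)\<^sup>2 + y\<^sup>2 > 0" using c0 by (simp_all add: add_pos_nonneg)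
  have "v\<^sup>2 * ((c + 1)\<^sup>2 + y\<^sup>2) \<le> (y\<^sup>2 + v\<^sup>2) * ((c + 1)\<^sup>2 + v\<^sup>2)"
    by (simp add: algebra_simps)
  also have "\<dots> \<le> (y + v)\<^sup>2 * ((c + 1)\<^sup>2 + v\<^sup>2)"
    using y v less_imp_le [OF pos(1)] by (intro mult_right_mono) (simp_all add: power2_sum)
  finally have "v\<^sup>2 / ((c + 1)\<^sup>2 + v\<^sup>2) \<le> (y + v)\<^sup>2 / ((c + 1)\<^sup>2 + y\<^sup>2)"
    using pos by (simp add: field_simps)
  then have "v\<^sup>2 / ((c + 1)\<^sup>2 + v\<^sup>2) * (y - v)\<^sup>2 \<le> (y + v)\<^sup>2 / ((c + 1)\<^sup>2 + y\<^sup>2) * (y - v)\<^sup>2"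
    by (rule mult_right_mono) simp
  also have "\<dots> = (y\<^sup>2 - v\<^sup>2)\<^sup>2 / ((c + 1)\<^sup>2 + y\<^sup>2)"
    by (simp add: power2_eq_square algebra_simps)
  finally show ?thesis unfolding q by (simp add: v_def)
qed

lemma norm_cayley_sq: "(cmod (cayley (Complex c y)))\<^sup>2 = ((c - 1)\<^sup>2 + y\<^sup>2) / ((c + 1)\<^sup>2 + y\<^sup>2)"
  by (simp add: cayley_def norm_divide power_divide cmod_power2)

lemma norm_cayley_sq': "(cmod (cayley (Complex c y)))\<^sup>2 = 1 - 4 * c / ((c + 1)\<^sup>2 + y\<^sup>2)"
proof -
  have "(c + 1)\<^sup>2 + y\<^sup>2 > 0" using c0 by (simp add: add_pos_nonneg)
  then show ?thesis unfolding norm_cayley_sq by (simp add: field_simps power2_eq_square)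
qed

text \<open>
  The global form of the statement that the vertical line is a path of steepest-descent type:
  there is no second maximum on the upper half of the line, and the bound controls the tail as well
  as the neighbourhood of the saddle.
\<close>

lemma line_majorant:
  fixes y :: real
  assumes y: "y \<ge> 0"
  defines "\<kappa> \<equiv> saddle_rate c * (saddle_im c)\<^sup>2 / (4 * c\<^sup>2 + 2 * c)"
    and "z \<equiv> Complex c y" and "E \<equiv> \<lambda>z. exp (of_real (saddle_rate c) * z\<^sup>2) * cayley z"
  shows "cmod (E z) \<le> cmod (E (saddle_pt c)) * exp (- (\<kappa> * (y - saddle_im c)\<^sup>2))"
proof (rule power2_le_imp_le)
  have E: "(cmod (E (Complex c t)))\<^sup>2 = exp (2 * saddle_rate c * (c\<^sup>2 - t\<^sup>2)) *
      (((c - 1)\<^sup>2 + t\<^sup>2) / ((c + 1)\<^sup>2 + t\<^sup>2))" for t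
    unfolding E_def norm_mult power_mult_distrib norm_cayley_sq
    by (simp add: norm_exp_eq_Re Re_power2 flip: exp_double)
  have "(cmod (E z))\<^sup>2 = exp (2 * saddle_rate c * (c\<^sup>2 - (saddle_im c)\<^sup>2)) *
     (((c - 1)\<^sup>2 + y\<^sup>2) / ((c + 1)\<^sup>2 + y\<^sup>2) * exp (- (2 * saddle_rate c * (y\<^sup>2 - (saddle_im c)\<^sup>2))))"
  proof -
    have "exp (2 * saddle_rate c * (c\<^sup>2 - y\<^sup>2)) = exp (2 * saddle_rate c * (c\<^sup>2 - (saddle_im c)\<^sup>2)) *
         exp (- (2 * saddle_rate c * (y\<^sup>2 - (saddle_im c)\<^sup>2)))"
      unfolding exp_add [symmetric] by (rule arg_cong [where f = exp]) (simp add: algebra_simps)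
    then show ?thesis unfolding z_def E by simp
  qed
  also have "\<dots> \<le> exp (2 * saddle_rate c * (c\<^sup>2 - (saddle_im c)\<^sup>2)) *
     (((c - 1)\<^sup>2 + (saddle_im c)\<^sup>2) / ((c + 1)\<^sup>2 + (saddle_im c)\<^sup>2)
       * exp (- (2 * saddle_rate c * (y\<^sup>2 - (saddle_im c)\<^sup>2)\<^sup>2 / ((c + 1)\<^sup>2 + y\<^sup>2))))"
    by (intro mult_left_mono line_majorant_real) auto
  also have "\<dots> \<le> exp (2 * saddle_rate c * (c\<^sup>2 - (saddle_im c)\<^sup>2)) *
     (((c - 1)\<^sup>2 + (saddle_im c)\<^sup>2) / ((c + 1)\<^sup>2 + (saddle_im c)\<^sup>2)
       * exp (- (2 * (\<kappa> * (y - saddle_im c)\<^sup>2))))"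
  proof -
    have "2 * saddle_rate c * ((saddle_im c)\<^sup>2 / (4 * c\<^sup>2 + 2 * c) * (y - saddle_im c)\<^sup>2)
          \<le> 2 * saddle_rate c * ((y\<^sup>2 - (saddle_im c)\<^sup>2)\<^sup>2 / ((c + 1)\<^sup>2 + y\<^sup>2))"
      using saddle_rate_pos by (intro mult_left_mono line_majorant_exponent y) auto
    then show ?thesis
      by (intro mult_left_mono) (auto simp: \<kappa>_def)
  qed
  also have "\<dots> = (cmod (E (saddle_pt c)) * exp (- (\<kappa> * (y - saddle_im c)\<^sup>2)))\<^sup>2"
    unfolding power_mult_distrib saddle_pt_def E by (simp add: mult.assoc flip: exp_double)
  finally show "(cmod (E z))\<^sup>2 \<le> (cmod (E (saddle_pt c)) * exp (- (\<kappa> * (y - saddle_im c)\<^sup>2)))\<^sup>2" .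
qed auto

lemma norm_cayley_power_le:
  "cmod (cayley (Complex c y)) ^ i \<le> exp (- (real i * (2 * c / ((c + 1)\<^sup>2 + y\<^sup>2))))"
proof (rule power2_le_imp_le)
  have "(cmod (cayley (Complex c y)) ^ i)\<^sup>2 = ((cmod (cayley (Complex c y)))\<^sup>2) ^ i"
    by (simp add: mult.commute flip: power_mult)
  also have "\<dots> \<le> exp (- (4 * c / ((c + 1)\<^sup>2 + y\<^sup>2))) ^ i"
  proof (rule power_mono)
    show "(cmod (cayley (Complex c y)))\<^sup>2 \<le> exp (- (4 * c / ((c + 1)\<^sup>2 + y\<^sup>2)))"
      unfolding norm_cayley_sq' using exp_ge_add_one_self [of "- (4 * c / ((c + 1)\<^sup>2 + y\<^sup>2))"] by simp
  qed simp
  also have "\<dots> = (exp (- (real i * (2 * c / ((c + 1)\<^sup>2 + y\<^sup>2)))))\<^sup>2"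
    by (simp add: field_simps flip: exp_of_nat_mult exp_double)
  finally show "(cmod (cayley (Complex c y)) ^ i)\<^sup>2 \<le> (exp (- (real i * (2 * c / ((c + 1)\<^sup>2 + y\<^sup>2)))))\<^sup>2" .
qed simp

text \<open>
  The decay in the index: \<open>|w|\<^sup>2 = 1 - 4 c / N\<close> with \<open>N = |z + 1|\<^sup>2\<close>, so \<open>|w|\<^sup>i \<le> 1 / (1 + 2 c i / N)\<close>, and the
  weight \<open>1 / N\<close> of the kernel compensates that \<open>|w|\<close> tends to \<open>1\<close> along the line.
\<close>

lemma kern_le: "cmod (kern i (Complex c y)) \<le> 1 / (2 * c) / real (Suc i)"
proof -
  define N where "N = (c + 1)\<^sup>2 + y\<^sup>2"
  have "4 * c \<le> (c + 1)\<^sup>2" using zero_le_power2 [of "c - 1"] by (simp add: power2_eq_square algebra_simps)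
  then have N: "N > 0" "4 * c \<le> N" using c0 by (auto simp: N_def add_pos_nonneg add_increasing2)
  have "1 + Complex c y = Complex (c + 1) y" by (simp add: complex_eq_iff)
  then have "cmod (kern i (Complex c y)) = cmod (cayley (Complex c y)) ^ i / N"
    by (simp add: kern_def norm_divide norm_power cmod_power2 N_def)
  also have "\<dots> \<le> exp (- (real i * (2 * c / N))) / N"
    using N norm_cayley_power_le [of y i] by (intro divide_right_mono) (auto simp: N_def)
  also have "\<dots> \<le> inverse (1 + real i * (2 * c / N)) / N"
    using N c0 unfolding exp_minus
    by (intro divide_right_mono le_imp_inverse_le exp_ge_add_one_self) (auto intro!: add_pos_nonneg)
  also have "inverse (1 + real i * (2 * c / N)) / N = 1 / (N + real i * (2 * c))"
  proof -
    have "N * (1 + real i * (2 * c / N)) = N + real i * (2 * c)" using N by (simp add: distrib_left)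
    moreover have "inverse a / N = 1 / (N * a)" for a by (simp add: divide_inverse)
    ultimately show ?thesis by simp
  qed
  also have "\<dots> \<le> 1 / (2 * c * real (Suc i))"
    using N c0 by (intro divide_left_mono) (auto simp: algebra_simps intro!: mult_pos_pos add_pos_nonneg)
  finally show ?thesis by (simp add: field_simps)
qed

end

section \<open>Taylor expansions on the saddle line\<close>

lemma Taylor_third_order:
  fixes f0 f1 f2 f3 f4 :: "complex \<Rightarrow> complex"
  assumes S: "convex S" "w \<in> S" "z \<in> S"
    and d: "\<And>x. x \<in> S \<Longrightarrow> (f0 has_field_derivative f1 x) (at x)"
      "\<And>x. x \<in> S \<Longrightarrow> (f1 has_field_derivative f2 x) (at x)"
      "\<And>x. x \<in> S \<Longrightarrow> (f2 has_field_derivative f3 x) (at x)"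
      "\<And>x. x \<in> S \<Longrightarrow> (f3 has_field_derivative f4 x) (at x)"
    and b: "\<And>x. x \<in> S \<Longrightarrow> cmod (f4 x) \<le> b"
  shows "cmod (f0 z - f0 w - f1 w * (z - w) - f2 w * (z - w)\<^sup>2 / 2 - f3 w * (z - w) ^ 3 / 6)
           \<le> b / 6 * cmod (z - w) ^ 4"
proof -
  define f where "f = (\<lambda>n::nat. if n = 0 then f0 else if n = 1 then f1 else if n = 2 then f2
                        else if n = 3 then f3 else f4)"
  have "cmod (f 0 z - (\<Sum>i\<le>3. f i w * (z - w) ^ i / fact i)) \<le> b * cmod (z - w) ^ Suc 3 / fact 3"
  proof (rule complex_Taylor [where S = S])
    fix i :: nat and x assume "x \<in> S" "i \<le> 3"
    then have "i = 0 \<or> i = 1 \<or> i = 2 \<or> i = 3" by auto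
    with \<open>x \<in> S\<close> d [of x] show "(f i has_field_derivative f (Suc i) x) (at x within S)"
      by (auto simp: f_def intro: has_field_derivative_at_within)
  qed (use S b in \<open>auto simp: f_def\<close>)
  then show ?thesis
    by (simp add: f_def eval_nat_numeral atMost_Suc algebra_simps)
qed

lemma Taylor_first_order:
  fixes f0 f1 f2 :: "complex \<Rightarrow> complex"
  assumes S: "convex S" "w \<in> S" "z \<in> S"
    and d: "\<And>x. x \<in> S \<Longrightarrow> (f0 has_field_derivative f1 x) (at x)"
      "\<And>x. x \<in> S \<Longrightarrow> (f1 has_field_derivative f2 x) (at x)"
    and b: "\<And>x. x \<in> S \<Longrightarrow> cmod (f2 x) \<le> b"
  shows "cmod (f0 z - f0 w - f1 w * (z - w)) \<le> b * cmod (z - w) ^ 2"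
proof -
  define f where "f = (\<lambda>n::nat. if n = 0 then f0 else if n = 1 then f1 else f2)"
  have "cmod (f 0 z - (\<Sum>i\<le>1. f i w * (z - w) ^ i / fact i)) \<le> b * cmod (z - w) ^ Suc 1 / fact 1"
  proof (rule complex_Taylor [where S = S])
    fix i :: nat and x assume "x \<in> S" "i \<le> 1"
    then have "i = 0 \<or> i = 1" by auto
    with \<open>x \<in> S\<close> d [of x] show "(f i has_field_derivative f (Suc i) x) (at x within S)"
      by (auto simp: f_def intro: has_field_derivative_at_within)
  qed (use S b in \<open>auto simp: f_def\<close>)
  then show ?thesis
    by (simp add: f_def algebra_simps power2_eq_square)
qed

lemma one_minus_sq_ne_0:
  fixes z :: complex
  assumes "Im z > 0" shows "1 - z\<^sup>2 \<noteq> 0" "z - 1 \<noteq> 0" "z + 1 \<noteq> 0"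
proof -
  show a: "z - 1 \<noteq> 0" and b: "z + 1 \<noteq> 0" using assms by (auto simp: complex_eq_iff)
  have "1 - z\<^sup>2 = - ((z - 1) * (z + 1))" by (simp add: algebra_simps power2_eq_square)
  with a b show "1 - z\<^sup>2 \<noteq> 0" by simp
qed

lemma inverse_bounds:
  fixes z :: complex
  assumes b: "b > 0" "1 \<le> b * Im z"
  shows "cmod (1 / (z - 1)) \<le> b" "cmod (1 / (z + 1)) \<le> b" "cmod (1 / (1 - z\<^sup>2)) \<le> b\<^sup>2"
proof -
  have *: "cmod (1 / w) \<le> b" if "Im w = Im z" for w
  proof -
    have "Im z \<le> cmod w" using abs_Im_le_cmod [of w] that by linarith
    then have "1 \<le> b * cmod w" using b by (intro order_trans [OF b(2) mult_left_mono]) auto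
    then have "cmod w > 0" by (cases "w = 0") auto
    then show ?thesis using \<open>1 \<le> b * cmod w\<close> by (simp add: norm_divide field_simps)
  qed
  show 1: "cmod (1 / (z - 1)) \<le> b" and 2: "cmod (1 / (z + 1)) \<le> b"
    by (intro *; simp)+
  have "cmod (1 / (1 - z\<^sup>2)) = cmod (1 / (z - 1)) * cmod (1 / (z + 1))"
    by (simp add: norm_mult norm_divide flip: norm_minus_cancel [of "1 - z\<^sup>2"])
       (simp add: norm_mult [symmetric] algebra_simps power2_eq_square)
  also have "\<dots> \<le> b * b" by (intro mult_mono 1 2) (use b in auto)
  finally show "cmod (1 / (1 - z\<^sup>2)) \<le> b\<^sup>2" by (simp add: power2_eq_square)
qed

lemma kern_eq:
  assumes "Im z > 0"
  shows "kern i z = 1 / (1 - z\<^sup>2) * cayley z ^ Suc i"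
proof -
  have e: "1 - z\<^sup>2 = - ((z - 1) * (z + 1))" by (simp add: algebra_simps power2_eq_square)
  show ?thesis unfolding kern_def e cayley_def
    using one_minus_sq_ne_0 [OF assms] by (simp add: power2_eq_square add.commute)
qed

lemma cayley_has_derivative:
  assumes "Im z > 0"
  shows "(cayley has_field_derivative - (2 * (1 / (1 - z\<^sup>2)) * cayley z)) (at z)"
proof -
  have e: "1 - z\<^sup>2 = - ((z - 1) * (z + 1))" by (simp add: algebra_simps power2_eq_square)
  show ?thesis
    unfolding cayley_def e using one_minus_sq_ne_0 [OF assms]
    by (auto intro!: derivative_eq_intros simp: divide_simps)
qed

lemma inv_has_derivative:
  fixes z :: complex
  assumes "Im z > 0"
  shows "((\<lambda>z. 1 / (1 - z\<^sup>2)) has_field_derivative 2 * z * (1 / (1 - z\<^sup>2))\<^sup>2) (at z)"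
  using one_minus_sq_ne_0 [OF assms]
  by (auto intro!: derivative_eq_intros simp: divide_simps power2_eq_square)

text \<open>
  The functions \<open>kern1 i\<close> and \<open>kern2 i\<close> are the first two derivatives of \<open>kern i\<close>, simplified with \<open>w' = - 2 h w\<close> and
  \<open>h' = 2 z h\<^sup>2\<close>, where \<open>h = 1 / (1 - z\<^sup>2)\<close>.
\<close>

definition kern1 :: "nat \<Rightarrow> complex \<Rightarrow> complex" where
  "kern1 i z = 2 * (z - of_nat (Suc i)) * (1 / (1 - z\<^sup>2))\<^sup>2 * cayley z ^ Suc i"

definition kern2 :: "nat \<Rightarrow> complex \<Rightarrow> complex" where
  "kern2 i z = (2 * (1 / (1 - z\<^sup>2))\<^sup>2
      + 4 * (z - of_nat (Suc i)) * (2 * z - of_nat (Suc i)) * (1 / (1 - z\<^sup>2)) ^ 3) * cayley z ^ Suc i"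

lemma cayley_power_has_derivative:
  assumes "Im z > 0"
  shows "((\<lambda>z. cayley z ^ Suc i) has_field_derivative
            - (2 * of_nat (Suc i) * (1 / (1 - z\<^sup>2)) * cayley z ^ Suc i)) (at z)"
  by (rule DERIV_cong [OF DERIV_power [OF cayley_has_derivative [OF assms]]]) simp

lemma kern_has_derivative:
  assumes "Im z > 0"
  shows "(kern i has_field_derivative kern1 i z) (at z)"
proof -
  have alg: "2 * z * h\<^sup>2 * W + - (2 * n * h * W) * h = 2 * (z - n) * h\<^sup>2 * W" for h W n :: complex
    by (simp add: algebra_simps power2_eq_square)
  have "((\<lambda>z. 1 / (1 - z\<^sup>2) * cayley z ^ Suc i) has_field_derivative kern1 i z) (at z)"
    by (rule DERIV_cong [OF DERIV_mult [OF inv_has_derivative [OF assms] cayley_power_has_derivative [OF assms]]])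
       (unfold kern1_def, rule alg)
  moreover have "eventually (\<lambda>z. kern i z = 1 / (1 - z\<^sup>2) * cayley z ^ Suc i) (nhds z)"
  proof -
    have "eventually (\<lambda>z. z \<in> {z. Im z > 0}) (nhds z)"
      by (rule eventually_nhds_in_open) (use assms in \<open>auto simp: open_halfspace_Im_gt\<close>)
    then show ?thesis by (rule eventually_mono) (simp only: kern_eq mem_Collect_eq)
  qed
  ultimately show ?thesis
    by (subst DERIV_cong_ev [OF refl _ refl]) auto
qed

lemma kern1_has_derivative:
  assumes "Im z > 0"
  shows "(kern1 i has_field_derivative kern2 i z) (at z)"
proof -
  have d: "((\<lambda>z. (2 * (z - of_nat (Suc i))) * (1 / (1 - z\<^sup>2))\<^sup>2) has_field_derivative
     2 * (1 / (1 - z\<^sup>2))\<^sup>2 + 2 * (z - of_nat (Suc i)) * (2 * (1 / (1 - z\<^sup>2)) * (2 * z * (1 / (1 - z\<^sup>2))\<^sup>2))) (at z)"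
    by (rule derivative_eq_intros inv_has_derivative assms refl)+ simp
  have alg: "(2 * h\<^sup>2 + 2 * (z - n) * (2 * h * (2 * z * h\<^sup>2))) * W + - (2 * n * h * W) * (2 * (z - n) * h\<^sup>2)
      = (2 * h\<^sup>2 + 4 * (z - n) * (2 * z - n) * h ^ 3) * W" for h W n :: complex
    by (simp add: algebra_simps power2_eq_square power3_eq_cube)
  show ?thesis
    unfolding kern1_def [abs_def]
    by (rule DERIV_cong [OF DERIV_mult [OF d cayley_power_has_derivative [OF assms]]])
       (unfold kern2_def, rule alg)
qed

text \<open>
  A logarithm of \<open>exp (\<alpha> z\<^sup>2) w(z)\<close> on the upper half plane, where both principal logarithms are
  holomorphic.
\<close>

definition psi :: "real \<Rightarrow> complex \<Rightarrow> complex" where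
  "psi \<alpha> z = Ln (z - 1) - Ln (z + 1) + of_real \<alpha> * z\<^sup>2"

lemma exp_psi:
  assumes "Im z > 0"
  shows "exp (psi \<alpha> z) = exp (of_real \<alpha> * z\<^sup>2) * cayley z"
  using one_minus_sq_ne_0 [OF assms] by (simp add: psi_def exp_add exp_diff cayley_def)

lemma psi_derivatives:
  assumes "Im z > 0"
  shows "(psi \<alpha> has_field_derivative 1 / (z - 1) - 1 / (z + 1) + 2 * of_real \<alpha> * z) (at z)"
    and "((\<lambda>z. 1 / (z - 1) - 1 / (z + 1) + 2 * of_real \<alpha> * z) has_field_derivative
            2 * of_real \<alpha> - (1 / (z - 1))\<^sup>2 + (1 / (z + 1))\<^sup>2) (at z)"
    and "((\<lambda>z. 2 * of_real \<alpha> - (1 / (z - 1))\<^sup>2 + (1 / (z + 1))\<^sup>2) has_field_derivative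
            2 * (1 / (z - 1)) ^ 3 - 2 * (1 / (z + 1)) ^ 3) (at z)"
    and "((\<lambda>z. 2 * (1 / (z - 1)) ^ 3 - 2 * (1 / (z + 1)) ^ 3) has_field_derivative
            6 * (1 / (z + 1)) ^ 4 - 6 * (1 / (z - 1)) ^ 4) (at z)"
proof -
  note ne = one_minus_sq_ne_0 [OF assms]
  have np: "z - 1 \<notin> \<real>\<^sub>\<le>\<^sub>0" "z + 1 \<notin> \<real>\<^sub>\<le>\<^sub>0" using assms by (auto simp: complex_nonpos_Reals_iff)
  show "(psi \<alpha> has_field_derivative 1 / (z - 1) - 1 / (z + 1) + 2 * of_real \<alpha> * z) (at z)"
    unfolding psi_def [abs_def] using np by (auto intro!: derivative_eq_intros simp: divide_inverse)
  have m: "((\<lambda>z. 1 / (z - 1)) has_field_derivative - ((1 / (z - 1))\<^sup>2)) (at z)"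
    using ne by (auto intro!: derivative_eq_intros simp: divide_simps power2_eq_square)
  have p: "((\<lambda>z. 1 / (z + 1)) has_field_derivative - ((1 / (z + 1))\<^sup>2)) (at z)"
    using ne by (auto intro!: derivative_eq_intros simp: divide_simps power2_eq_square)
  show "((\<lambda>z. 1 / (z - 1) - 1 / (z + 1) + 2 * of_real \<alpha> * z) has_field_derivative
            2 * of_real \<alpha> - (1 / (z - 1))\<^sup>2 + (1 / (z + 1))\<^sup>2) (at z)"
    by (rule m p derivative_eq_intros refl)+ simp
  show "((\<lambda>z. 2 * of_real \<alpha> - (1 / (z - 1))\<^sup>2 + (1 / (z + 1))\<^sup>2) has_field_derivative
            2 * (1 / (z - 1)) ^ 3 - 2 * (1 / (z + 1)) ^ 3) (at z)"
    by (rule m p derivative_eq_intros refl)+ (simp add: power_numeral_reduce mult_ac)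
  show "((\<lambda>z. 2 * (1 / (z - 1)) ^ 3 - 2 * (1 / (z + 1)) ^ 3) has_field_derivative
            6 * (1 / (z + 1)) ^ 4 - 6 * (1 / (z - 1)) ^ 4) (at z)"
    by (rule m p derivative_eq_intros refl)+ (simp add: power_numeral_reduce mult_ac)
qed

lemma psi_critical:
  assumes "0 < c" "1 < 3 * c\<^sup>2"
  shows "1 / (saddle_pt c - 1) - 1 / (saddle_pt c + 1) + 2 * of_real (saddle_rate c) * saddle_pt c = 0"
    and "2 * of_real (saddle_rate c) - (1 / (saddle_pt c - 1))\<^sup>2 + (1 / (saddle_pt c + 1))\<^sup>2
          = 2 * (of_real (saddle_rate c) * (3 - 2 * of_real (saddle_rate c) * saddle_pt c))"
proof -
  define z a where "z = saddle_pt c" and "a = complex_of_real (saddle_rate c)"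
  have im: "Im z > 0" using saddle_im_pos [OF assms] by (simp add: z_def)
  note ne = one_minus_sq_ne_0 [OF im]
  have inv: "1 / (z\<^sup>2 - 1) = - (a * z)" using saddle_pt_inverse [OF assms] by (simp add: z_def a_def)
  have fac: "z\<^sup>2 - 1 = (z - 1) * (z + 1)" by (simp add: algebra_simps power2_eq_square)
  have d: "1 / (z - 1) - 1 / (z + 1) = 2 * (1 / (z\<^sup>2 - 1))"
    unfolding fac using ne by (simp add: divide_simps)
  have s: "1 / (z - 1) + 1 / (z + 1) = 2 * z * (1 / (z\<^sup>2 - 1))"
    unfolding fac using ne by (simp add: divide_simps)
  show "1 / (z - 1) - 1 / (z + 1) + 2 * a * z = 0" unfolding d inv by simp
  have cub: "a * z ^ 3 = a * z - 1" using saddle_pt_cubic [OF assms] 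
    by (simp add: z_def a_def algebra_simps add_eq_0_iff)
  have "(1 / (z - 1))\<^sup>2 - (1 / (z + 1))\<^sup>2 = (1 / (z - 1) - 1 / (z + 1)) * (1 / (z - 1) + 1 / (z + 1))"
    by (simp add: square_diff_square_factored power2_eq_square algebra_simps)
  also have "\<dots> = 4 * a * (a * z ^ 3)" unfolding d s inv by (simp add: power3_eq_cube)
  also have "\<dots> = 4 * a * (a * z - 1)" unfolding cub ..
  finally show "2 * a - (1 / (z - 1))\<^sup>2 + (1 / (z + 1))\<^sup>2 = 2 * (a * (3 - 2 * a * z))"
    by (simp add: algebra_simps)
qed

section \<open>Uniform asymptotics of the saddle-line integral\<close>

text \<open>
  The factor of the integrand that is raised to the power \<open>m\<close>; its value at the saddle is
  \<open>exp (psi_saddle \<alpha>)\<close> for \<open>\<alpha> = saddle_rate c\<close>.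
\<close>

definition growth :: "real \<Rightarrow> complex \<Rightarrow> complex" where
  "growth c z = exp (of_real (saddle_rate c) * z\<^sup>2) * cayley z"

text \<open>
  The integrand on the part of the saddle line above the real axis, normalised by its value at the
  saddle and parametrised by the signed distance \<open>s\<close> from it. Extending it by zero below the real axis
  gives a function on the whole line to which Laplace's method applies; the lower half contributes
  the conjugate.
\<close>

definition upper_line :: "real \<Rightarrow> nat \<Rightarrow> nat \<Rightarrow> real \<Rightarrow> complex" where
  "upper_line c m i s = (if s \<le> - saddle_im c then 0
     else (growth c (Complex c (saddle_im c + s)) / growth c (saddle_pt c)) ^ m
            * kern i (Complex c (saddle_im c + s)))"

text \<open>
  Half of the second derivative of \<open>psi\<close> at the saddle, that is the coefficient \<open>Q\<close> in
  \<open>psi (\<zeta> + i s) = psi \<zeta> - Q s\<^sup>2 + \<dots>\<close>.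
\<close>

definition saddle_curv :: "real \<Rightarrow> complex" where
  "saddle_curv c = of_real (saddle_rate c) * (3 - 2 * of_real (saddle_rate c) * saddle_pt c)"

lemma admissible_mono:
  fixes c c1 :: real
  assumes "0 < c1" "1 < 3 * c1\<^sup>2" "c1 \<le> c"
  shows "0 < c" "1 < 3 * c\<^sup>2" "saddle_im c1 \<le> saddle_im c" "saddle_rate c \<le> saddle_rate c1"
proof -
  have sq: "c1\<^sup>2 \<le> c\<^sup>2" using assms by (intro power_mono) auto
  show "0 < c" "1 < 3 * c\<^sup>2" "saddle_im c1 \<le> saddle_im c"
    using assms sq by (auto simp: saddle_im_def intro: less_le_trans)
  have s4: "1 < 4 * c\<^sup>2" "1 < 4 * c1\<^sup>2" using assms(2) sq by linarith+
  have "2 * c1 * (4 * c1\<^sup>2 - 1) \<le> 2 * c * (4 * c\<^sup>2 - 1)"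
    using assms sq by (intro mult_mono) auto
  then show "saddle_rate c \<le> saddle_rate c1"
    unfolding saddle_rate_def using assms s4 by (intro divide_left_mono mult_pos_pos) auto
qed

lemma growth_saddle_ne_0: "0 < c \<Longrightarrow> 1 < 3 * c\<^sup>2 \<Longrightarrow> growth c (saddle_pt c) \<noteq> 0"
  unfolding growth_def using exp_psi [of "saddle_pt c" "saddle_rate c"] saddle_im_pos [of c]
  by (metis exp_not_eq_zero saddle_pt_simps(2))

text \<open>
  The Gaussian majorant of the modulus forces the real part of the quadratic coefficient to be at
  least as large; here it is checked directly.
\<close>

lemma Re_saddle_curv:
  assumes "0 < c" "1 < 3 * c\<^sup>2"
  shows "saddle_rate c * (saddle_im c)\<^sup>2 / (4 * c\<^sup>2 + 2 * c) \<le> Re (saddle_curv c)"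
proof -
  have p: "4 * c\<^sup>2 - 1 > 0" "saddle_rate c > 0" using assms saddle_rate_pos four_c_sq_gt_1 by auto
  have "2 * c * saddle_rate c = 1 / (4 * c\<^sup>2 - 1)" using assms by (simp add: saddle_rate_def)
  then have "Re (saddle_curv c) = saddle_rate c * (3 - 1 / (4 * c\<^sup>2 - 1))"
    by (simp add: saddle_curv_def mult_ac)
  also have "3 - 1 / (4 * c\<^sup>2 - 1) = 4 * (3 * c\<^sup>2 - 1) / (4 * c\<^sup>2 - 1)"
    using p by (simp add: field_simps)
  finally have R: "Re (saddle_curv c) = saddle_rate c * (4 * (saddle_im c)\<^sup>2 / (4 * c\<^sup>2 - 1))"
    using assms by (simp add: saddle_im_sq)
  have "(saddle_im c)\<^sup>2 / (4 * c\<^sup>2 + 2 * c) \<le> 4 * (saddle_im c)\<^sup>2 / (4 * c\<^sup>2 - 1)"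
    by (rule frac_le) (use p assms in auto)
  then show ?thesis unfolding R times_divide_eq_right [symmetric]
    using p by (intro mult_left_mono) auto
qed

lemma upper_line_measurable:
  assumes "0 < c" "1 < 3 * c\<^sup>2"
  shows "upper_line c m i \<in> borel_measurable lborel"
proof -
  have e: "Complex c (saddle_im c + s) = of_real c + \<i> * of_real (saddle_im c + s)" for s
    by (simp add: complex_eq_iff)
  have ne: "of_real c + \<i> * of_real (saddle_im c + s) + 1 \<noteq> (0 :: complex)"
           "1 + (of_real c + \<i> * of_real (saddle_im c + s)) \<noteq> (0 :: complex)" for s
    using assms by (auto simp: complex_eq_iff)
  have "continuous_on UNIV (\<lambda>s. (growth c (Complex c (saddle_im c + s)) / growth c (saddle_pt c)) ^ m
            * kern i (Complex c (saddle_im c + s)))"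
    unfolding e growth_def kern_def cayley_def divide_inverse [of _ "exp (_ * (saddle_pt c)\<^sup>2) * _"]
    by (intro continuous_intros) (use ne in auto)
  then have "(\<lambda>s. (growth c (Complex c (saddle_im c + s)) / growth c (saddle_pt c)) ^ m
            * kern i (Complex c (saddle_im c + s))) \<in> borel_measurable lborel"
    by (simp add: borel_measurable_continuous_onI)
  then show ?thesis unfolding upper_line_def [abs_def] by measurable
qed

lemma exp_cube_le:
  fixes t :: real assumes "t > 0" "j > 0"
  shows "j\<^sup>2 * exp (- (j * t)) \<le> 6 / t ^ 3 / j"
proof -
  have "(j * t) ^ 3 \<le> fact 3 / 1 ^ 3 * exp (1 * (j * t))"
    by (rule pow_le_exp) (use assms in auto)
  then have "(j * t) ^ 3 \<le> 6 * exp (j * t)" by (simp add: fact_numeral)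
  then have "(j * t) ^ 3 * exp (- (j * t)) \<le> 6" unfolding exp_minus by (simp add: divide_simps)
  then show ?thesis using assms by (simp add: field_simps power_mult_distrib power_numeral_reduce)
qed

text \<open>
  All data of Laplace's method are bounded in terms of \<open>c1\<close> and \<open>c2\<close>: \<open>b\<close> bounds \<open>1 / (z \<plusminus> 1)\<close> on the
  segment \<open>S\<close> around the saddle, \<open>T\<close> the third order term and the remainder of \<open>psi\<close>, and \<open>A0 / j\<close>
  the kernel, its derivative, and its second derivative. The derivatives carry factors up to
  \<open>j\<^sup>2\<close>, which are beaten by the geometric decay of \<open>w\<^sup>j\<close> on \<open>S\<close> (\<open>exp_cube_le\<close>).
\<close>

lemma saddle_laplace:
  fixes c1 c2 :: real
  assumes c1: "0 < c1" "1 < 3 * c1\<^sup>2" and c12: "c1 \<le> c2"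
  shows "\<exists>C\<ge>0. \<forall>c\<in>{c1..c2}. \<forall>m\<ge>1. \<forall>i.
     cmod ((\<integral>s. upper_line c m i s \<partial>lborel)
          - kern i (saddle_pt c) * of_real (sqrt pi / sqrt (real m)) / csqrt (saddle_curv c))
       \<le> C / (real (Suc i) * (real m * sqrt (real m)))"
proof -
  note adm2 = admissible_mono [OF c1 c12]
  define h where "h = saddle_im c1"
  define Y where "Y = saddle_im c2"
  have h: "h > 0" and hY: "h \<le> Y" using saddle_im_pos [OF c1] adm2 by (auto simp: h_def Y_def)
  define b where "b = 2 / h"
  define Z where "Z = c2 + 2 * Y"
  \<comment> \<open>Chosen so that \<open>|w|\<^sup>j \<le> exp (- j t)\<close> on \<open>S\<close>.\<close>
  define t where "t = 2 * c1 / ((c2 + 1)\<^sup>2 + (2 * Y)\<^sup>2)"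
  \<comment> \<open>A lower bound, over the range of \<open>c\<close>, for the rate in \<open>line_majorant\<close>.\<close>
  define \<kappa> where "\<kappa> = saddle_rate c2 * h\<^sup>2 / (4 * c2\<^sup>2 + 2 * c2)"
  define T where "T = b ^ 3 + 2 * b ^ 4"
  define \<delta> where "\<delta> = min 1 (min (h / 2) (\<kappa> / (4 * T)))"
  define G1 where "G1 = 2 * (Z + 1) * (b\<^sup>2)\<^sup>2"
  define G2 where "G2 = 2 * (b\<^sup>2)\<^sup>2 + 4 * (Z + 1) * (2 * Z + 1) * (b\<^sup>2) ^ 3"
  define A0 where "A0 = 1 / (2 * c1) + G1 * (6 / t ^ 3) + G2 * (6 / t ^ 3)"
  have b: "b > 0" using h by (simp add: b_def)
  have Z: "Z > 0" using adm2 h hY by (simp add: Z_def)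
  have t: "t > 0" using adm2 c1 by (simp add: t_def add_pos_nonneg)
  have \<kappa>: "\<kappa> > 0" using saddle_rate_pos [OF adm2(1,2)] h adm2(1)
    by (simp add: \<kappa>_def add_pos_pos)
  have T: "T > 0" using b by (simp add: T_def add_pos_pos)
  have \<delta>: "0 < \<delta>" "\<delta> \<le> 1" "\<delta> \<le> h / 2" "4 * T * \<delta> \<le> \<kappa>"
  proof -
    show "0 < \<delta>" "\<delta> \<le> 1" "\<delta> \<le> h / 2" using h \<kappa> T by (auto simp: \<delta>_def)
    have "\<delta> \<le> \<kappa> / (4 * T)" by (simp add: \<delta>_def)
    then show "4 * T * \<delta> \<le> \<kappa>" using T by (simp add: field_simps)
  qed
  have G: "G1 \<ge> 0" "G2 \<ge> 0" using Z b by (auto simp: G1_def G2_def)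
  have A0p: "0 \<le> 1 / (2 * c1)" "0 \<le> G1 * (6 / t ^ 3)" "0 \<le> G2 * (6 / t ^ 3)" using c1 t G by auto
  then have A0: "A0 \<ge> 0" by (simp add: A0_def)
  define C where "C = laplace_const \<kappa> T \<delta>"
  have C: "C \<ge> 0" using laplace_const_nonneg \<kappa> T \<delta> by (simp add: C_def)
  have "cmod ((\<integral>s. upper_line c m i s \<partial>lborel)
          - kern i (saddle_pt c) * of_real (sqrt pi / sqrt (real m)) / csqrt (saddle_curv c))
       \<le> C * A0 / (real (Suc i) * (real m * sqrt (real m)))"
    if c: "c1 \<le> c" "c \<le> c2" and m: "m \<ge> 1" for c and m i :: nat
  proof -
    note adm = admissible_mono [OF c1 c(1)]
    note adm' = admissible_mono [OF adm(1,2) c(2)]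
    define \<alpha> where "\<alpha> = saddle_rate c"
    define \<eta> where "\<eta> = saddle_im c"
    define w where "w = saddle_pt c"
    define j where "j = real (Suc i)"
    have j: "j \<ge> 1" by (simp add: j_def)
    have \<eta>: "h \<le> \<eta>" "\<eta> \<le> Y" using adm(3) adm'(3) by (auto simp: h_def Y_def \<eta>_def)
    have wim: "Im w = \<eta>" "Im w > 0" "Re w = c" using \<eta> h by (auto simp: w_def \<eta>_def)
    define S where "S = {x. Re x = c \<and> h / 2 \<le> Im x \<and> Im x \<le> 2 * Y}"
    have S: "convex S"
    proof -
      have "S = {x. Re x \<ge> c} \<inter> {x. Re x \<le> c} \<inter> {x. Im x \<ge> h / 2} \<inter> {x. Im x \<le> 2 * Y}" by (auto simp: S_def)
      then show ?thesis
        by (simp only:) (intro convex_Int convex_halfspace_Im_ge convex_halfspace_Im_le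
            convex_halfspace_Re_ge convex_halfspace_Re_le)
    qed
    have wS: "w \<in> S" using wim \<eta> h by (auto simp: S_def)
    have Spos: "Im x > 0" if "x \<in> S" for x using that h by (auto simp: S_def)
    have Sinv: "cmod (1 / (x - 1)) \<le> b" "cmod (1 / (x + 1)) \<le> b" "cmod (1 / (1 - x\<^sup>2)) \<le> b\<^sup>2"
      if "x \<in> S" for x
    proof -
      have "1 \<le> b * Im x" using that h by (simp add: b_def S_def field_simps)
      with b show "cmod (1 / (x - 1)) \<le> b" "cmod (1 / (x + 1)) \<le> b" "cmod (1 / (1 - x\<^sup>2)) \<le> b\<^sup>2"
        using inverse_bounds by auto
    qed
    have SZ: "cmod x \<le> Z" if "x \<in> S" for x
      using cmod_le [of x] that adm Spos [OF that] c by (auto simp: S_def Z_def)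
    have Wle: "cmod (cayley x ^ Suc i) \<le> exp (- (j * t))" if "x \<in> S" for x
    proof -
      have "x = Complex c (Im x)" using that by (simp add: S_def complex_eq_iff)
      then have "cmod (cayley x ^ Suc i) \<le> exp (- (j * (2 * c / ((c + 1)\<^sup>2 + (Im x)\<^sup>2))))"
        using norm_cayley_power_le [OF adm(1,2), of "Im x" "Suc i"] by (simp add: norm_power j_def del: power_Suc of_nat_Suc)
      also have "\<dots> \<le> exp (- (j * t))"
      proof -
        have "(c + 1)\<^sup>2 + (Im x)\<^sup>2 \<le> (c2 + 1)\<^sup>2 + (2 * Y)\<^sup>2"
          using that c adm(1) h by (intro add_mono power_mono) (auto simp: S_def)
        then have "t \<le> 2 * c / ((c + 1)\<^sup>2 + (Im x)\<^sup>2)"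
          unfolding t_def using c c1 adm(1) by (intro frac_le) (auto simp: add_pos_nonneg)
        then have "j * t \<le> j * (2 * c / ((c + 1)\<^sup>2 + (Im x)\<^sup>2))" using j by (intro mult_left_mono) auto
        then show ?thesis by simp
      qed
      finally show ?thesis .
    qed
    have jW: "j\<^sup>2 * cmod (cayley x ^ Suc i) \<le> 6 / t ^ 3 / j" if "x \<in> S" for x
    proof -
      have "j\<^sup>2 * cmod (cayley x ^ Suc i) \<le> j\<^sup>2 * exp (- (j * t))"
        by (intro mult_left_mono Wle that) auto
      also have "\<dots> \<le> 6 / t ^ 3 / j" using exp_cube_le [OF t] j by auto
      finally show ?thesis .
    qed
    have jZ: "cmod (x - of_nat (Suc i)) \<le> (Z + 1) * j" if "x \<in> S" for x
    proof -
      have "cmod (x - of_nat (Suc i)) \<le> Z + j"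
        using norm_triangle_ineq4 [of x "of_nat (Suc i)"] SZ [OF that] by (simp add: j_def del: of_nat_Suc)
      also have "\<dots> \<le> (Z + 1) * j" using mult_left_mono [OF j, of Z] Z by (simp add: algebra_simps)
      finally show ?thesis .
    qed
    have k1: "cmod (kern1 i x) \<le> A0 / j" if "x \<in> S" for x
    proof -
      have "cmod (kern1 i x) = 2 * cmod (x - of_nat (Suc i)) * (cmod (1 / (1 - x\<^sup>2)))\<^sup>2 * cmod (cayley x ^ Suc i)"
        by (simp only: kern1_def norm_mult norm_power norm_numeral)
      also have "\<dots> \<le> 2 * ((Z + 1) * j) * (b\<^sup>2)\<^sup>2 * cmod (cayley x ^ Suc i)"
        by (intro mult_right_mono mult_mono jZ power_mono Sinv that) (use Z j in auto)
      also have "\<dots> = G1 * (j * cmod (cayley x ^ Suc i))" by (simp add: G1_def mult_ac)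
      also have "\<dots> \<le> G1 * (j\<^sup>2 * cmod (cayley x ^ Suc i))"
        using j G by (intro mult_left_mono mult_right_mono) (auto simp: power2_eq_square)
      also have "\<dots> \<le> G1 * (6 / t ^ 3 / j)" by (intro mult_left_mono jW that G)
      also have "\<dots> = G1 * (6 / t ^ 3) / j" by simp
      also have "\<dots> \<le> A0 / j" using A0p j by (intro divide_right_mono) (auto simp: A0_def)
      finally show ?thesis .
    qed
    have k2: "cmod (kern2 i x) \<le> A0 / j" if "x \<in> S" for x
    proof -
      have 2: "cmod (2 * x - of_nat (Suc i)) \<le> (2 * Z + 1) * j"
      proof -
        have "cmod (2 * x - of_nat (Suc i)) \<le> 2 * Z + j"
          using norm_triangle_ineq4 [of "2 * x" "of_nat (Suc i)"] SZ [OF that]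
          by (simp add: j_def norm_mult del: of_nat_Suc)
        also have "\<dots> \<le> (2 * Z + 1) * j" using mult_left_mono [OF j, of Z] Z by (simp add: algebra_simps)
        finally show ?thesis .
      qed
      have "cmod (kern2 i x) = cmod (2 * (1 / (1 - x\<^sup>2))\<^sup>2
          + 4 * (x - of_nat (Suc i)) * (2 * x - of_nat (Suc i)) * (1 / (1 - x\<^sup>2)) ^ 3) * cmod (cayley x ^ Suc i)"
        by (simp only: kern2_def norm_mult)
      also have "cmod (2 * (1 / (1 - x\<^sup>2))\<^sup>2
          + 4 * (x - of_nat (Suc i)) * (2 * x - of_nat (Suc i)) * (1 / (1 - x\<^sup>2)) ^ 3)
        \<le> 2 * (b\<^sup>2)\<^sup>2 + 4 * ((Z + 1) * j) * ((2 * Z + 1) * j) * (b\<^sup>2) ^ 3"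
        unfolding norm_mult norm_power norm_numeral
        by (rule norm_triangle_mono; unfold norm_mult norm_power norm_numeral;
            intro mult_mono jZ 2 power_mono Sinv that order_refl)
           (use Z j in auto)
      also have "\<dots> \<le> 2 * (b\<^sup>2)\<^sup>2 * j\<^sup>2 + 4 * ((Z + 1) * j) * ((2 * Z + 1) * j) * (b\<^sup>2) ^ 3"
        using j mult_left_mono [OF one_le_power [OF j, of 2], of "b ^ 4"] by simp
      also have "\<dots> = G2 * j\<^sup>2" by (simp add: G2_def algebra_simps power2_eq_square)
      finally have "cmod (kern2 i x) \<le> G2 * j\<^sup>2 * cmod (cayley x ^ Suc i)"
        by (simp add: mult_right_mono)
      also have "\<dots> = G2 * (j\<^sup>2 * cmod (cayley x ^ Suc i))" by simp
      also have "\<dots> \<le> G2 * (6 / t ^ 3 / j)" by (intro mult_left_mono jW that G)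
      also have "\<dots> = G2 * (6 / t ^ 3) / j" by simp
      also have "\<dots> \<le> A0 / j" using A0p j by (intro divide_right_mono) (auto simp: A0_def)
      finally show ?thesis .
    qed
    have k0: "cmod (kern i (Complex c y)) \<le> A0 / j" for y
    proof -
      have "cmod (kern i (Complex c y)) \<le> 1 / (2 * c) / j" unfolding j_def by (rule kern_le [OF adm(1,2)])
      also have "\<dots> \<le> 1 / (2 * c1) / j" using c c1 j by (intro divide_right_mono divide_left_mono) auto
      also have "\<dots> \<le> A0 / j" using A0p j by (intro divide_right_mono) (auto simp: A0_def)
      finally show ?thesis .
    qed
    define \<kappa>c where "\<kappa>c = saddle_rate c * (saddle_im c)\<^sup>2 / (4 * c\<^sup>2 + 2 * c)"
    have \<kappa>c: "\<kappa> \<le> \<kappa>c"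
    proof -
      have "saddle_rate c2 * h\<^sup>2 \<le> saddle_rate c * (saddle_im c)\<^sup>2"
        using adm' \<eta> h saddle_rate_pos [OF adm(1,2)]
        by (intro mult_mono power_mono) (auto simp: \<eta>_def)
      moreover have "4 * c\<^sup>2 + 2 * c \<le> 4 * c2\<^sup>2 + 2 * c2"
        using c adm(1) by (intro add_mono mult_left_mono power_mono) auto
      ultimately show ?thesis
        unfolding \<kappa>_def \<kappa>c_def using adm(1) saddle_rate_pos [OF adm(1,2)]
        by (intro frac_le) (auto simp: add_pos_pos)
    qed
    define U where "U = 2 * (1 / (w - 1)) ^ 3 - 2 * (1 / (w + 1)) ^ 3"
    define \<tau> where "\<tau> = - \<i> * U / 6"
    have \<tau>: "cmod \<tau> \<le> T"
    proof -
      have "cmod U \<le> 2 * b ^ 3 + 2 * b ^ 3" unfolding U_def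
        by (rule order_trans [OF norm_triangle_ineq4 add_mono]; unfold norm_mult norm_power norm_numeral;
            intro mult_left_mono power_mono Sinv wS) auto
      moreover have "0 < b ^ 3" "0 < b ^ 4" using b by simp_all
      moreover have "cmod \<tau> = cmod U / 6" by (simp add: \<tau>_def norm_mult norm_divide)
      ultimately show ?thesis unfolding T_def by linarith
    qed
    have "cmod ((\<integral>s. upper_line c m i s \<partial>lborel)
          - kern i w * of_real (sqrt pi / sqrt (real m)) / csqrt (saddle_curv c))
       \<le> C * (A0 / j) / (real m * sqrt (real m))"
    unfolding C_def
    proof (rule laplace_uniform [OF \<kappa> less_imp_le [OF T] \<delta>(1,2,4) m])
      show "0 \<le> A0 / j" using A0 j by simp
      show "upper_line c m i \<in> borel_measurable lborel" by (rule upper_line_measurable [OF adm(1,2)])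
      show "\<kappa> \<le> Re (saddle_curv c)" using Re_saddle_curv [OF adm(1,2)] \<kappa>c by (simp add: \<kappa>c_def)
      show "cmod \<tau> \<le> T" by (rule \<tau>)
      show "cmod (kern i w) \<le> A0 / j" using k0 [of "saddle_im c"] by (simp add: w_def saddle_pt_def)
      show "cmod (kern1 i w * \<i>) \<le> A0 / j" using k1 [OF wS] by (simp add: norm_mult)
      fix s
      show "cmod (upper_line c m i s) \<le> A0 / j * exp (- (\<kappa> * real m * s\<^sup>2))"
        proof (cases "s \<le> - saddle_im c")
          case True then show ?thesis using A0 j by (simp add: upper_line_def)
        next
          case False
          then have y: "saddle_im c + s \<ge> 0" by simp
          have "cmod (growth c (Complex c (saddle_im c + s)))
              \<le> cmod (growth c w) * exp (- (\<kappa>c * s\<^sup>2))"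
            using line_majorant [OF adm(1,2) y] by (simp add: growth_def \<kappa>c_def w_def)
          then have "cmod (growth c (Complex c (saddle_im c + s)) / growth c w) \<le> exp (- (\<kappa>c * s\<^sup>2))"
            using growth_saddle_ne_0 [OF adm(1,2)] by (simp add: norm_divide w_def divide_le_eq mult.commute)
          also have "\<dots> \<le> exp (- (\<kappa> * s\<^sup>2))" using mult_right_mono [OF \<kappa>c, of "s\<^sup>2"] by simp
          finally have "cmod (growth c (Complex c (saddle_im c + s)) / growth c w) ^ m \<le> exp (- (\<kappa> * s\<^sup>2)) ^ m"
            by (rule power_mono) simp
          also have "\<dots> = exp (- (\<kappa> * real m * s\<^sup>2))" by (simp add: mult_ac flip: exp_of_nat_mult)
          finally have "cmod ((growth c (Complex c (saddle_im c + s)) / growth c w) ^ m * kern i (Complex c (saddle_im c + s)))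
             \<le> exp (- (\<kappa> * real m * s\<^sup>2)) * (A0 / j)"
            unfolding norm_mult norm_power by (intro mult_mono k0) auto
          then show ?thesis using False by (simp add: upper_line_def w_def mult.commute)
        qed
    next
      show "(\<exists>L g. upper_line c m i s = exp (of_nat m * L) * g \<and>
                 cmod (L + saddle_curv c * of_real (s\<^sup>2) - \<tau> * of_real (s ^ 3)) \<le> T * s ^ 4 \<and>
                 cmod (g - kern i w - kern1 i w * \<i> * of_real s) \<le> A0 / j * s\<^sup>2)" if s: "\<bar>s\<bar> \<le> \<delta>" for s :: real
      proof -
        define z where "z = Complex c (\<eta> + s)"
        have zw: "z - w = \<i> * of_real s" by (simp add: z_def w_def saddle_pt_def \<eta>_def complex_eq_iff)
        have zS: "z \<in> S" using s \<delta>(3) \<eta> by (auto simp: S_def z_def)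
        define L where "L = psi \<alpha> z - psi \<alpha> w"
        have "\<not> s \<le> - saddle_im c" using s \<delta>(3) \<eta> h by (auto simp: \<eta>_def)
        then have f: "upper_line c m i s = exp (of_nat m * L) * kern i z"
          using exp_psi [OF Spos [OF zS], of \<alpha>] exp_psi [OF wim(2), of \<alpha>]
          by (simp add: upper_line_def growth_def z_def w_def \<eta>_def L_def \<alpha>_def exp_of_nat_mult exp_diff)
        have "cmod (psi \<alpha> z - psi \<alpha> w - (1 / (w - 1) - 1 / (w + 1) + 2 * of_real \<alpha> * w) * (z - w)
               - (2 * of_real \<alpha> - (1 / (w - 1))\<^sup>2 + (1 / (w + 1))\<^sup>2) * (z - w)\<^sup>2 / 2
               - U * (z - w) ^ 3 / 6)
              \<le> 12 * b ^ 4 / 6 * cmod (z - w) ^ 4"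
          unfolding U_def
        proof (rule Taylor_third_order [OF S wS zS psi_derivatives])
          fix x assume "x \<in> S"
          then have "cmod (6 * (1 / (x + 1)) ^ 4 - 6 * (1 / (x - 1)) ^ 4) \<le> 6 * b ^ 4 + 6 * b ^ 4"
            by - (rule order_trans [OF norm_triangle_ineq4 add_mono]; unfold norm_mult norm_power norm_numeral;
              intro mult_left_mono power_mono Sinv; simp)
          then show "cmod (6 * (1 / (x + 1)) ^ 4 - 6 * (1 / (x - 1)) ^ 4) \<le> 12 * b ^ 4" by simp
        qed (use Spos in auto)
        moreover have "1 / (w - 1) - 1 / (w + 1) + 2 * of_real \<alpha> * w = 0"
          "2 * of_real \<alpha> - (1 / (w - 1))\<^sup>2 + (1 / (w + 1))\<^sup>2 = 2 * saddle_curv c"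
          using psi_critical [OF adm(1,2)] by (simp_all add: w_def \<alpha>_def saddle_curv_def)
        moreover have "(z - w)\<^sup>2 = - of_real (s\<^sup>2)" "(z - w) ^ 3 = - \<i> * of_real (s ^ 3)" "cmod (z - w) = \<bar>s\<bar>"
        proof -
          have i3: "\<i> ^ 3 = - \<i>" by (simp add: power3_eq_cube)
          show "(z - w) ^ 3 = - \<i> * of_real (s ^ 3)" unfolding zw power_mult_distrib i3 by simp
        qed (simp_all add: zw power_mult_distrib norm_mult)
        ultimately have "cmod (L - 2 * saddle_curv c * (- of_real (s\<^sup>2)) / 2
               - U * (- \<i> * of_real (s ^ 3)) / 6)
              \<le> 12 * b ^ 4 / 6 * \<bar>s\<bar> ^ 4" by (simp add: L_def)
        moreover have "L - 2 * saddle_curv c * (- of_real (s\<^sup>2)) / 2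
               - U * (- \<i> * of_real (s ^ 3)) / 6
            = L + saddle_curv c * of_real (s\<^sup>2) - \<tau> * of_real (s ^ 3)"
          by (simp add: \<tau>_def algebra_simps)
        ultimately have "cmod (L + saddle_curv c * of_real (s\<^sup>2) - \<tau> * of_real (s ^ 3)) \<le> 12 * b ^ 4 / 6 * s ^ 4"
          by simp
        also have "\<dots> \<le> T * s ^ 4" using b by (intro mult_right_mono) (auto simp: T_def)
        finally have L: "cmod (L + saddle_curv c * of_real (s\<^sup>2) - \<tau> * of_real (s ^ 3)) \<le> T * s ^ 4" .
        have "cmod (kern i z - kern i w - kern1 i w * (z - w)) \<le> A0 / j * (cmod (z - w))\<^sup>2"
          by (rule Taylor_first_order [OF S wS zS kern_has_derivative kern1_has_derivative k2])
             (use Spos in auto)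
        then have "cmod (kern i z - kern i w - kern1 i w * \<i> * of_real s) \<le> A0 / j * s\<^sup>2"
          by (simp add: zw norm_mult mult.assoc)
        with f L show ?thesis by blast
      qed
    qed
    then show ?thesis by (simp add: j_def w_def)
  qed
  then show ?thesis using C A0 by (intro exI [of _ "C * A0"]) auto
qed

section \<open>Cosine series and Parseval's identity\<close>

text \<open>
  The three term recurrence is the quadratic equation \<open>u\<^sup>2 = 2 (Re u) u - 1\<close> satisfied by the points of
  the unit circle.
\<close>

lemma poly_cheb_T_Re:
  assumes "cmod u = 1"
  shows "poly (cheb_T k) (Re u) = Re (u ^ k)"
proof (induction k rule: cheb_T.induct)
  case (3 n)
  have "u * cnj u = 1" using assms by (simp add: complex_norm_square [symmetric])
  moreover have "cnj u = 2 * of_real (Re u) - u" by (simp add: complex_eq_iff)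
  ultimately have "u ^ 2 = 2 * of_real (Re u) * u - 1" by (simp add: algebra_simps power2_eq_square)
  then have "u ^ Suc (Suc n) = (2 * of_real (Re u) * u - 1) * u ^ n"
    by (simp add: power2_eq_square)
  also have "\<dots> = of_real (2 * Re u) * u ^ Suc n - u ^ n" by (simp add: algebra_simps)
  finally have "Re (u ^ Suc (Suc n)) = 2 * Re u * Re (u ^ Suc n) - Re (u ^ n)" by simp
  then show ?case using 3 by (simp del: power_Suc)
qed auto

lemma poly_cheb_T_cos: "poly (cheb_T k) (cos t) = cos (real k * t)"
  using poly_cheb_T_Re [of "cis t" k] unfolding Complex.DeMoivre by simp

lemma cheb_weight_integral:
  assumes f: "continuous_on {-1..1} f"
  shows "(LBINT x=-1..1. f x / sqrt (1 - x\<^sup>2)) = integral {0..pi} (\<lambda>t. f (cos t))"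
proof -
  let ?g = "\<lambda>x. f x / sqrt (1 - x\<^sup>2)"
  have im: "cos ` {0<..<pi} = {-1<..<1}"
  proof (intro equalityI subsetI)
    fix x assume "x \<in> cos ` {0<..<pi}"
    then obtain t where t: "0 < t" "t < pi" "x = cos t" by auto
    then show "x \<in> {-1<..<1}"
      using cos_monotone_0_pi [of 0 t] cos_monotone_0_pi [of t pi] by auto
  next
    fix x :: real assume "x \<in> {-1<..<1}"
    then show "x \<in> cos ` {0<..<pi}"
      using arccos_lt_bounded [of x] by (intro image_eqI [of _ _ "arccos x"]) auto
  qed
  have fcos: "continuous_on {0..pi} (\<lambda>t. f (cos t))"
    by (intro continuous_on_compose2 [OF f] continuous_intros) auto
  have eq: "\<bar>- sin t\<bar> * ?g (cos t) = f (cos t)" if "t \<in> {0<..<pi}" for t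
    using that sin_gt_zero [of t] by (simp add: sin_squared_eq [symmetric])
  have "(\<lambda>t. f (cos t)) absolutely_integrable_on {0<..<pi}"
    by (rule set_integrable_subset [OF absolutely_integrable_continuous_real [OF fcos]]) auto
  then have abs: "(\<lambda>t. \<bar>- sin t\<bar> * ?g (cos t)) absolutely_integrable_on {0<..<pi}"
    by (subst set_integrable_cong [OF refl refl eq]) auto
  have "?g absolutely_integrable_on (cos ` {0<..<pi}) \<and>
     integral (cos ` {0<..<pi}) ?g = integral {0<..<pi} (\<lambda>t. \<bar>- sin t\<bar> * ?g (cos t))"
  proof (subst has_absolute_integral_change_of_variables_1' [symmetric])
    show "inj_on cos {0<..<pi}" by (rule inj_onI, rule cos_inj_pi) auto
    show "(cos has_field_derivative - sin t) (at t within {0<..<pi})" for t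
      by (auto intro!: derivative_eq_intros)
  qed (use abs in auto)
  then have ai: "?g absolutely_integrable_on {-1<..<1}"
    and int: "integral {-1<..<1} ?g = integral {0<..<pi} (\<lambda>t. \<bar>- sin t\<bar> * ?g (cos t))"
    unfolding im by auto
  have "continuous_on {-1<..<1} ?g"
  proof (intro continuous_intros continuous_on_subset [OF f])
    show "\<forall>x\<in>{- 1<..<1}. sqrt (1 - x\<^sup>2) \<noteq> 0"
      using abs_square_eq_1 by (auto simp: abs_square_eq_1 power2_eq_1_iff)
  qed auto
  then have "(\<lambda>x. indicator {-1<..<1} x *\<^sub>R ?g x) \<in> borel_measurable borel"
    by (intro borel_measurable_continuous_on_indicator) auto
  then have si: "set_integrable lborel {-1<..<1} ?g"
    using ai unfolding set_integrable_def by (subst (asm) integrable_completion) auto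
  have "(LBINT x=-1..1. ?g x) = (LBINT x:{-1<..<1}. ?g x)"
  proof -
    have "(- 1 :: ereal) \<le> 1" by (simp add: one_ereal_def)
    then show ?thesis using interval_integral_Ioo [of "-1" 1 ?g] by simp
  qed
  also have "\<dots> = integral {-1<..<1} ?g" by (rule set_borel_integral_eq_integral(2) [OF si])
  also have "\<dots> = integral {0<..<pi} (\<lambda>t. f (cos t))"
    unfolding int by (rule integral_cong) (rule eq)
  also have "\<dots> = integral {0..pi} (\<lambda>t. f (cos t))" by (rule integral_open_interval_real [symmetric])
  finally show ?thesis .
qed

lemma integral_cos_nat: "integral {0..pi} (\<lambda>t. cos (real k * t)) = (if k = 0 then pi else 0)"
proof (cases "k = 0")
  case False
  have "((\<lambda>t. cos (real k * t)) has_integral (sin (real k * pi) / real k - sin (real k * 0) / real k)) {0..pi}"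
    by (rule fundamental_theorem_of_calculus)
       (use False in \<open>auto intro!: derivative_eq_intros simp flip: has_real_derivative_iff_has_vector_derivative\<close>)
  then show ?thesis using False by (simp add: integral_unique)
qed simp

lemma integral_cos_cos:
  "integral {0..pi} (\<lambda>t. cos (real j * t) * cos (real k * t))
     = (if j = k then if k = 0 then pi else pi / 2 else 0)"
proof (induction j k rule: linorder_wlog)
  case (le j k)
  have "cos (real j * t) * cos (real k * t) = cos (real (k - j) * t) / 2 + cos (real (k + j) * t) / 2" for t
  proof -
    have "real (k - j) * t = real k * t - real j * t" "real (k + j) * t = real k * t + real j * t"
      using le by (simp_all add: of_nat_diff left_diff_distrib distrib_right)
    then show ?thesis
      using cos_times_cos [of "real k * t" "real j * t"] by (simp add: add_divide_distrib mult.commute)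
  qed
  then have "integral {0..pi} (\<lambda>t. cos (real j * t) * cos (real k * t))
     = integral {0..pi} (\<lambda>t. cos (real (k - j) * t) / 2 + cos (real (k + j) * t) / 2)" by simp
  also have "\<dots> = integral {0..pi} (\<lambda>t. cos (real (k - j) * t)) / 2 + integral {0..pi} (\<lambda>t. cos (real (k + j) * t)) / 2"
    by (subst integral_add)
       (auto intro!: integrable_continuous_real continuous_intros simp del: of_nat_add)
  finally have *: "integral {0..pi} (\<lambda>t. cos (real j * t) * cos (real k * t))
     = (if k - j = 0 then pi else 0) / 2 + (if k + j = 0 then pi else 0) / 2"
    unfolding integral_cos_nat .
  show ?case unfolding * using le by (cases "j = k") simp_all
next
  case (sym j k)
  have "(\<lambda>t. cos (real k * t) * cos (real j * t)) = (\<lambda>t. cos (real j * t) * cos (real k * t))"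
    by (simp add: mult.commute)
  with sym show ?case by (simp only:) auto
qed

definition cos_coeff :: "(real \<Rightarrow> real) \<Rightarrow> nat \<Rightarrow> real" where
  "cos_coeff h k = 2 / pi * integral {0..pi} (\<lambda>t. h t * cos (real k * t))"

text \<open>
  The remainder of the cosine series of \<open>h\<close>; for \<open>h t = F l (cos t)\<close> it is the projection remainder
  at \<open>x = cos t\<close>.
\<close>

definition cos_tail :: "(real \<Rightarrow> real) \<Rightarrow> nat \<Rightarrow> real \<Rightarrow> real" where
  "cos_tail h m t = h t - cos_coeff h 0 / 2 - (\<Sum>k=1..m. cos_coeff h k * cos (real k * t))"

context
  fixes h :: "real \<Rightarrow> real"
  assumes h: "continuous_on {0..pi} h"
begin

lemma cos_tail_continuous: "continuous_on {0..pi} (cos_tail h m)"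
  unfolding cos_tail_def [abs_def] by (intro continuous_intros h)

lemma has_integral_continuous_0_pi:
  fixes g :: "real \<Rightarrow> real"
  assumes "continuous_on {0..pi} g" shows "(g has_integral integral {0..pi} g) {0..pi}"
  using integrable_integral [OF integrable_continuous_real [OF assms]] .

lemmas linear_integral = integral_unique has_integral_diff has_integral_add has_integral_mult_right
  has_integral_sum has_integral_continuous_0_pi continuous_intros cos_tail_continuous

lemma cos_tail_orthogonal:
  assumes "j \<le> m"
  shows "integral {0..pi} (\<lambda>t. cos_tail h m t * cos (real j * t)) = 0"
proof -
  let ?I = "integral {0..pi}"
  have "?I (\<lambda>t. cos_tail h m t * cos (real j * t))
     = ?I (\<lambda>t. h t * cos (real j * t) - cos_coeff h 0 / 2 * cos (real j * t)
          - (\<Sum>k=1..m. cos_coeff h k * (cos (real k * t) * cos (real j * t))))"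
    by (simp add: cos_tail_def algebra_simps sum_distrib_left)
  also have "\<dots> = ?I (\<lambda>t. h t * cos (real j * t)) - cos_coeff h 0 / 2 * ?I (\<lambda>t. cos (real j * t))
          - (\<Sum>k=1..m. cos_coeff h k * ?I (\<lambda>t. cos (real k * t) * cos (real j * t)))"
    by (intro linear_integral h) auto
  also have "?I (\<lambda>t. h t * cos (real j * t)) = pi / 2 * cos_coeff h j" by (simp add: cos_coeff_def)
  also have "(\<Sum>k=1..m. cos_coeff h k * ?I (\<lambda>t. cos (real k * t) * cos (real j * t)))
     = (\<Sum>k=1..m. if k = j then cos_coeff h j * (pi / 2) else 0)"
    by (intro sum.cong) (auto simp: integral_cos_cos)
  also have "\<dots> = (if j = 0 then 0 else cos_coeff h j * (pi / 2))"
    using assms by (auto simp: sum.delta)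
  finally show ?thesis by (simp add: integral_cos_nat)
qed

lemma cos_tail_Suc_integral:
  "integral {0..pi} (\<lambda>t. (cos_tail h m t)\<^sup>2)
     = integral {0..pi} (\<lambda>t. (cos_tail h (Suc m) t)\<^sup>2) + pi / 2 * (cos_coeff h (Suc m))\<^sup>2"
proof -
  let ?I = "integral {0..pi}" and ?c = "cos_coeff h (Suc m)" and ?C = "\<lambda>t. cos (real (Suc m) * t)"
  have "cos_tail h m t = cos_tail h (Suc m) t + ?c * ?C t" for t by (simp add: cos_tail_def)
  then have "?I (\<lambda>t. (cos_tail h m t)\<^sup>2) = ?I (\<lambda>t. (cos_tail h (Suc m) t)\<^sup>2
       + 2 * ?c * (cos_tail h (Suc m) t * ?C t) + ?c\<^sup>2 * (?C t * ?C t))"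
    by (simp add: power2_eq_square algebra_simps)
  also have "\<dots> = ?I (\<lambda>t. (cos_tail h (Suc m) t)\<^sup>2) + 2 * ?c * ?I (\<lambda>t. cos_tail h (Suc m) t * ?C t)
       + ?c\<^sup>2 * ?I (\<lambda>t. ?C t * ?C t)"
    by (intro linear_integral)
  finally show ?thesis
    unfolding cos_tail_orthogonal [OF order_refl] integral_cos_cos by simp
qed

text \<open>
  The remainder is orthogonal to all polynomials in \<open>cos t\<close> of degree at most \<open>n\<close>. The extra factor
  \<open>cos (j t)\<close> makes an induction on the exponent possible, since multiplication by \<open>cos t\<close> only shifts
  \<open>j\<close> by one.
\<close>

lemma cos_tail_orthogonal_power:
  assumes "j + i \<le> n"
  shows "integral {0..pi} (\<lambda>t. cos_tail h n t * (cos (real j * t) * cos t ^ i)) = 0"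
  using assms
proof (induction i arbitrary: j)
  case 0
  then show ?case using cos_tail_orthogonal [of j n] by simp
next
  case (Suc i)
  let ?I = "integral {0..pi}"
  show ?case
  proof (cases j)
    case 0
    then show ?thesis using Suc.IH [of 1] Suc.prems by simp
  next
    case (Suc k)
    have e: "cos (real j * t) * cos t = 1 / 2 * cos (real (Suc j) * t) + 1 / 2 * cos (real k * t)" for t
    proof -
      have "real (Suc j) * t = real j * t + t" "real k * t = real j * t - t"
        using Suc by (simp_all add: algebra_simps)
      then show ?thesis
        using cos_times_cos [of "real j * t" t] by (simp add: add_divide_distrib add.commute)
    qed
    have "?I (\<lambda>t. cos_tail h n t * (cos (real j * t) * cos t ^ Suc i))
      = ?I (\<lambda>t. 1 / 2 * (cos_tail h n t * (cos (real (Suc j) * t) * cos t ^ i))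
               + 1 / 2 * (cos_tail h n t * (cos (real k * t) * cos t ^ i)))"
    proof (rule arg_cong [where f = ?I], rule ext)
      fix t
      have "cos (real j * t) * cos t ^ Suc i = cos t ^ i * (cos (real j * t) * cos t)" by simp
      then show "cos_tail h n t * (cos (real j * t) * cos t ^ Suc i)
         = 1 / 2 * (cos_tail h n t * (cos (real (Suc j) * t) * cos t ^ i))
               + 1 / 2 * (cos_tail h n t * (cos (real k * t) * cos t ^ i))"
        unfolding e by (simp only: distrib_left distrib_right mult_ac)
    qed
    also have "\<dots> = 1 / 2 * ?I (\<lambda>t. cos_tail h n t * (cos (real (Suc j) * t) * cos t ^ i))
               + 1 / 2 * ?I (\<lambda>t. cos_tail h n t * (cos (real k * t) * cos t ^ i))"
      by (intro linear_integral)
    also have "\<dots> = 0"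
      using Suc.IH [of "Suc j"] Suc.IH [of k] Suc.prems Suc by simp
    finally show ?thesis .
  qed
qed

text \<open>
  Orthogonal projection minimises the distance; this is how uniform approximation by polynomials
  gives convergence of the cosine series in mean square.
\<close>

lemma cos_tail_best_approximation:
  "integral {0..pi} (\<lambda>t. (cos_tail h n t)\<^sup>2)
     \<le> integral {0..pi} (\<lambda>t. (h t - (\<Sum>i\<le>n. a i * cos t ^ i))\<^sup>2)"
proof -
  let ?I = "integral {0..pi}"
  define p where "p = (\<lambda>t. \<Sum>i\<le>n. a i * cos t ^ i)"
  define e where "e = (\<lambda>k. if k = 0 then cos_coeff h 0 / 2 else cos_coeff h k)"
  define q where "q = (\<lambda>t. \<Sum>k\<le>n. e k * cos (real k * t))"
  have cp: "continuous_on {0..pi} p" unfolding p_def by (intro continuous_intros)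
  have cq: "continuous_on {0..pi} q" unfolding q_def by (intro continuous_intros)
  have hq: "h t = cos_tail h n t + q t" for t
  proof -
    have "q t = cos_coeff h 0 / 2 + (\<Sum>k=1..n. cos_coeff h k * cos (real k * t))"
      unfolding q_def atMost_atLeast0 by (subst sum.atLeast_Suc_atMost) (auto simp: e_def intro!: sum.cong)
    then show ?thesis by (simp add: cos_tail_def)
  qed
  have "?I (\<lambda>t. cos_tail h n t * p t) = (\<Sum>i\<le>n. a i * ?I (\<lambda>t. cos_tail h n t * cos t ^ i))"
    unfolding p_def sum_distrib_left mult.left_commute [of _ "a _"] by (intro linear_integral) auto
  then have 1: "?I (\<lambda>t. cos_tail h n t * p t) = 0"
    using cos_tail_orthogonal_power [of 0 _ n] by simp
  have "?I (\<lambda>t. cos_tail h n t * q t) = (\<Sum>k\<le>n. e k * ?I (\<lambda>t. cos_tail h n t * cos (real k * t)))"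
    unfolding q_def sum_distrib_left mult.left_commute [of _ "e _"] by (intro linear_integral) auto
  then have 2: "?I (\<lambda>t. cos_tail h n t * q t) = 0"
    using cos_tail_orthogonal by simp
  have "?I (\<lambda>t. (cos_tail h n t)\<^sup>2)
      = ?I (\<lambda>t. (cos_tail h n t)\<^sup>2) + 2 * ?I (\<lambda>t. cos_tail h n t * q t) - 2 * ?I (\<lambda>t. cos_tail h n t * p t)"
    unfolding 1 2 by simp
  also have "\<dots> = ?I (\<lambda>t. (cos_tail h n t)\<^sup>2 + 2 * (cos_tail h n t * q t) - 2 * (cos_tail h n t * p t))"
    by (rule sym, intro linear_integral cp cq)
  also have "\<dots> \<le> ?I (\<lambda>t. (h t - p t)\<^sup>2)"
  proof (intro integral_le integrable_continuous_real continuous_intros cos_tail_continuous cp cq h)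
    fix t
    have "(h t - p t)\<^sup>2 = (cos_tail h n t)\<^sup>2 + 2 * (cos_tail h n t * q t) - 2 * (cos_tail h n t * p t) + (q t - p t)\<^sup>2"
      unfolding hq [of t] by (simp add: power2_eq_square algebra_simps)
    then show "(cos_tail h n t)\<^sup>2 + 2 * (cos_tail h n t * q t) - 2 * (cos_tail h n t * p t) \<le> (h t - p t)\<^sup>2"
      by simp
  qed
  finally show ?thesis by (simp add: p_def)
qed

end

lemma cos_tail_tendsto_0:
  assumes f: "continuous_on {-1..1} f"
  shows "(\<lambda>n. integral {0..pi} (\<lambda>t. (cos_tail (\<lambda>t. f (cos t)) n t)\<^sup>2)) \<longlonglongrightarrow> 0"
proof -
  let ?I = "integral {0..pi}" and ?h = "\<lambda>t. f (cos t)"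
  have h: "continuous_on {0..pi} ?h"
    by (intro continuous_on_compose2 [OF f] continuous_intros) auto
  have "\<exists>N. \<forall>n\<ge>N. ?I (\<lambda>t. (cos_tail ?h n t)\<^sup>2) \<le> pi * e\<^sup>2" if e: "e > 0" for e
  proof -
    obtain g where g: "real_polynomial_function g" "\<And>x. x \<in> {-1..1} \<Longrightarrow> \<bar>f x - g x\<bar> < e"
      using Stone_Weierstrass_real_polynomial_function [OF _ f e] by auto
    obtain a N where gN: "g = (\<lambda>x. \<Sum>i\<le>N. a i * x ^ i)"
      using g(1) real_polynomial_function_imp_sum by blast
    have "?I (\<lambda>t. (cos_tail ?h n t)\<^sup>2) \<le> pi * e\<^sup>2" if n: "n \<ge> N" for n
    proof -
      have gn: "(\<Sum>i\<le>n. (if i \<le> N then a i else 0) * x ^ i) = g x" for x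
        unfolding gN using n by (intro sum.mono_neutral_cong_right) auto
      have "?I (\<lambda>t. (cos_tail ?h n t)\<^sup>2) \<le> ?I (\<lambda>t. (?h t - g (cos t))\<^sup>2)"
        using cos_tail_best_approximation [OF h, of n "\<lambda>i. if i \<le> N then a i else 0"] by (simp only: gn)
      also have "\<dots> \<le> ?I (\<lambda>t. e\<^sup>2)"
      proof (intro integral_le integrable_continuous_real)
        show "continuous_on {0..pi} (\<lambda>t. (f (cos t) - g (cos t))\<^sup>2)"
          unfolding gN by (intro continuous_intros h)
        show "(f (cos t) - g (cos t))\<^sup>2 \<le> e\<^sup>2" for t
          using g(2) [of "cos t"] e by (intro power2_le_iff_abs_le [THEN iffD2]) auto
      qed auto
      also have "\<dots> = pi * e\<^sup>2" by simp
      finally show ?thesis .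
    qed
    then show ?thesis by blast
  qed
  note key = this
  show ?thesis
  proof (rule LIMSEQ_I)
    fix r :: real assume r: "r > 0"
    define e where "e = sqrt (r / (2 * pi))"
    have e: "e > 0" "pi * e\<^sup>2 < r" using r by (auto simp: e_def field_simps)
    obtain N where N: "\<And>n. n \<ge> N \<Longrightarrow> ?I (\<lambda>t. (cos_tail ?h n t)\<^sup>2) \<le> pi * e\<^sup>2" using key [OF e(1)] by blast
    have "?I (\<lambda>t. (cos_tail ?h n t)\<^sup>2) \<ge> 0" for n
      by (intro Henstock_Kurzweil_Integration.integral_nonneg integrable_continuous_real
            continuous_intros cos_tail_continuous h) auto
    with N e(2) show "\<exists>no. \<forall>n\<ge>no. norm (?I (\<lambda>t. (cos_tail ?h n t)\<^sup>2) - 0) < r"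
      by (intro exI [of _ N]) (auto intro: le_less_trans)
  qed
qed

lemma cos_tail_parseval:
  assumes f: "continuous_on {-1..1} f"
  shows "(\<lambda>j. pi / 2 * (cos_coeff (\<lambda>t. f (cos t)) (m + Suc j))\<^sup>2)
           sums integral {0..pi} (\<lambda>t. (cos_tail (\<lambda>t. f (cos t)) m t)\<^sup>2)"
proof -
  let ?h = "\<lambda>t. f (cos t)"
  let ?J = "\<lambda>n. integral {0..pi} (\<lambda>t. (cos_tail ?h n t)\<^sup>2)"
  have h: "continuous_on {0..pi} ?h"
    by (intro continuous_on_compose2 [OF f] continuous_intros) auto
  have eq: "pi / 2 * (cos_coeff ?h (m + Suc j))\<^sup>2 = ?J (m + j) - ?J (m + Suc j)" for j
    using cos_tail_Suc_integral [OF h, of "m + j"] by simp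
  have "(\<lambda>j. ?J (m + j)) \<longlonglongrightarrow> 0"
    using LIMSEQ_ignore_initial_segment [OF cos_tail_tendsto_0 [OF f], of m] by (simp add: add.commute)
  then have "(\<lambda>j. ?J (m + j) - ?J (m + Suc j)) sums (?J (m + 0) - 0)"
    by (rule telescope_sums')
  then show ?thesis unfolding eq by simp
qed

section \<open>Chebyshev coefficients as contour integrals\<close>

text \<open>
  The real part of its integral over the upper half of the imaginary axis is, up to sign, \<open>\<pi> / 4\<close> times
  the coefficient of index \<open>n + 1\<close> (\<open>cheb_coeff_imaginary_axis\<close>).
\<close>

definition coeff_kern :: "real \<Rightarrow> nat \<Rightarrow> complex \<Rightarrow> complex" where
  "coeff_kern l n z = exp (of_real l * z\<^sup>2) * kern n z"

lemma norm_cayley_le_1: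
  assumes "Re z \<ge> 0" shows "cmod (cayley z) \<le> 1"
proof -
  have "(cmod (z - 1))\<^sup>2 \<le> (cmod (z + 1))\<^sup>2"
    unfolding cmod_power2 using assms by (simp add: power2_eq_square algebra_simps)
  then have "cmod (z - 1) \<le> cmod (z + 1)" by (rule power2_le_imp_le) simp
  moreover have "z + 1 \<noteq> 0" using assms by (auto simp: complex_eq_iff)
  ultimately show ?thesis by (simp add: cayley_def norm_divide)
qed

lemma norm_kern_le_1:
  assumes "Re z \<ge> 0" shows "cmod (kern n z) \<le> 1"
proof -
  have "1 \<le> cmod (1 + z)" using assms complex_Re_le_cmod [of "1 + z"] by simp
  then have "1 \<le> (cmod (1 + z))\<^sup>2" by (simp add: one_le_power)
  moreover have "cmod (cayley z) ^ n \<le> 1" by (intro power_le_one norm_cayley_le_1 assms) simp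
  ultimately show ?thesis
    by (simp add: kern_def norm_divide norm_power divide_le_eq)
qed

lemma norm_coeff_kern_le:
  assumes "0 \<le> x" "x \<le> c" "l \<ge> 0"
  shows "cmod (coeff_kern l n (Complex x y)) \<le> exp (l * c\<^sup>2) * exp (- (l * y\<^sup>2))"
proof -
  have "l * (x\<^sup>2 - y\<^sup>2) \<le> l * c\<^sup>2 + - (l * y\<^sup>2)"
    using mult_left_mono [OF power_mono [OF assms(2,1), of 2] assms(3)] by (simp add: algebra_simps)
  then have "cmod (exp (of_real l * (Complex x y)\<^sup>2)) \<le> exp (l * c\<^sup>2) * exp (- (l * y\<^sup>2))"
    unfolding exp_add [symmetric] by (simp add: norm_exp_eq_Re Re_power2)
  moreover have "cmod (kern n (Complex x y)) \<le> 1" by (rule norm_kern_le_1) (use assms in simp)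
  ultimately show ?thesis
    unfolding coeff_kern_def norm_mult using mult_mono [of _ _ "cmod (kern n (Complex x y))" 1] by fastforce
qed

lemma coeff_kern_holomorphic: "coeff_kern l n holomorphic_on {z. Re z > - 1}"
proof -
  have "z + 1 \<noteq> 0" "1 + z \<noteq> 0" if "Re z > - 1" for z :: complex using that by (auto simp: complex_eq_iff)
  then show ?thesis
    unfolding coeff_kern_def [abs_def] kern_def cayley_def by (intro holomorphic_intros) auto
qed

lemma coeff_kern_line_continuous:
  assumes "c \<ge> 0" shows "continuous_on UNIV (\<lambda>y. coeff_kern l n (Complex c y))"
proof -
  have e: "Complex c y = of_real c + \<i> * of_real y" for y by (simp add: complex_eq_iff)
  have "continuous_on UNIV (\<lambda>y. coeff_kern l n (of_real c + \<i> * of_real y))"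
    by (intro continuous_on_compose2 [OF holomorphic_on_imp_continuous_on [OF coeff_kern_holomorphic]]
        continuous_intros) (use assms in auto)
  then show ?thesis by (simp add: e)
qed

lemma coeff_kern_line_integrable:
  assumes "c \<ge> 0" "l > 0" shows "integrable lborel (\<lambda>y. coeff_kern l n (Complex c y))"
proof (rule Bochner_Integration.integrable_bound)
  show "integrable lborel (\<lambda>y. exp (l * c\<^sup>2) * exp (- (l * y\<^sup>2)))"
    using gaussian_has_integral(1) [OF assms(2)] by simp
  show "(\<lambda>y. coeff_kern l n (Complex c y)) \<in> borel_measurable lborel"
    using borel_measurable_continuous_onI [OF coeff_kern_line_continuous [OF assms(1)]] by simp
qed (use norm_coeff_kern_le [of c c l] assms in auto)

text \<open>
  The integrand is holomorphic to the right of its only pole \<open>-1\<close> and decays like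
  \<open>exp (- l y\<^sup>2)\<close> on horizontal segments, so the contour can be moved from the imaginary axis to any
  parallel line further to the right.
\<close>

lemma coeff_kern_line_shift:
  assumes c: "c \<ge> 0" and l: "l > 0"
  shows "(\<integral>y. coeff_kern l n (Complex 0 y) \<partial>lborel) = (\<integral>y. coeff_kern l n (Complex c y) \<partial>lborel)"
proof -
  let ?S = "{z. Re z > - 1}" and ?f = "coeff_kern l n"
  have e: "Complex x y = of_real x + of_real y * \<i>" for x y by (simp add: complex_eq_iff)
  have "\<i> * (\<integral>t. ?f (0 + of_real t * \<i>) \<partial>lborel) = \<i> * (\<integral>t. ?f (of_real c + of_real t * \<i>) \<partial>lborel)"
  proof (rule line_integral_shift [where S = ?S and g = "\<lambda>t. exp (l * c\<^sup>2) * exp (- (l * t\<^sup>2))",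
        OF convex_halfspace_Re_gt open_halfspace_Re_gt coeff_kern_holomorphic])
    show "integrable lborel (\<lambda>t. ?f (0 + of_real t * \<i>))"
      using coeff_kern_line_integrable [OF order_refl l, of n] by (simp add: e)
    show "integrable lborel (\<lambda>t. ?f (of_real c + of_real t * \<i>))"
      using coeff_kern_line_integrable [OF c l, of n] by (simp add: e)
    fix t z assume "z \<in> closed_segment (0 + of_real t * \<i>) (of_real c + of_real t * \<i>)"
    then obtain u where u: "0 \<le> u" "u \<le> 1" and "z = (1 - u) *\<^sub>R (of_real t * \<i>) + u *\<^sub>R (of_real c + of_real t * \<i>)"
      by (auto simp: closed_segment_def)
    then have zc: "z = Complex (u * c) t" by (simp add: complex_eq_iff algebra_simps)
    have uc: "0 \<le> u * c" "u * c \<le> c" using u c by (auto simp: mult_left_le_one_le)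
    show "cmod (?f z) \<le> exp (l * c\<^sup>2) * exp (- (l * t\<^sup>2))"
      unfolding zc by (rule norm_coeff_kern_le) (use uc l in auto)
  next
    have len: "cmod (0 + of_real t * \<i> - (of_real c + of_real t * \<i>)) = c" for t :: real
      using c by simp
    show "((\<lambda>t. exp (l * c\<^sup>2) * exp (- (l * t\<^sup>2)) * cmod (0 + of_real t * \<i> - (of_real c + of_real t * \<i>))) \<longlongrightarrow> 0) at_top"
      "((\<lambda>t. exp (l * c\<^sup>2) * exp (- (l * t\<^sup>2)) * cmod (0 + of_real t * \<i> - (of_real c + of_real t * \<i>))) \<longlongrightarrow> 0) at_bot"
      unfolding len using l by real_asymp+
  qed (use c in auto)
  then show ?thesis by (simp add: e)
qed

text \<open>
  Reduces the integral over the full line to the upper half, where only one of the two saddles lies.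
\<close>

lemma integral_conj_symmetric:
  fixes f :: "real \<Rightarrow> complex"
  assumes f: "integrable lborel f" and sym: "\<And>y. f (- y) = cnj (f y)"
  shows "(\<integral>y. f y \<partial>lborel) = of_real (2 * Re (\<integral>y. indicator {0<..} y *\<^sub>R f y \<partial>lborel))"
proof -
  let ?h = "\<lambda>y. indicator {0<..} y *\<^sub>R f y"
  have ih: "integrable lborel ?h" using f by (intro integrable_mult_indicator) auto
  have ih2: "integrable lborel (\<lambda>y. ?h (- y))"
    using lborel_integrable_real_affine [OF ih, of "-1" 0] by simp
  then have ih': "integrable lborel (\<lambda>y. cnj (?h (- y)))"
    by (rule integrable_bounded_linear [OF bounded_linear_cnj])
  have "(\<integral>y. f y \<partial>lborel) = (\<integral>y. ?h y + cnj (?h (- y)) \<partial>lborel)"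
  proof (rule integral_cong_AE)
    show "AE y in lborel. f y = ?h y + cnj (?h (- y))"
      using AE_lborel_singleton [of 0]
    proof eventually_elim
      case (elim y)
      then show ?case using sym [of y] by (auto simp: indicator_def)
    qed
  qed (use f ih ih' in auto)
  also have "\<dots> = (\<integral>y. ?h y \<partial>lborel) + cnj (\<integral>y. ?h (- y) \<partial>lborel)"
    using ih ih' integral_bounded_linear [OF bounded_linear_cnj ih2] by (simp only: Bochner_Integration.integral_add)
  also have "(\<integral>y. ?h (- y) \<partial>lborel) = (\<integral>y. ?h y \<partial>lborel)"
    using lborel_integral_real_affine [of "-1" ?h 0] by simp
  finally show ?thesis by (simp add: complex_add_cnj)
qed

lemma coeff_kern_conj: "coeff_kern l n (Complex c (- y)) = cnj (coeff_kern l n (Complex c y))"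
proof -
  have "Complex c (- y) = cnj (Complex c y)" by (simp add: complex_eq_iff)
  then show ?thesis by (simp add: coeff_kern_def kern_def cayley_def exp_cnj)
qed

text \<open>
  Only the endpoint \<open>-1\<close> is of interest, where the exponent tends to \<open>- \<infinity>\<close>.
\<close>

lemma F_continuous:
  assumes l: "l > 0" shows "continuous_on {-1..1} (F l)"
  unfolding continuous_on_eq_continuous_within
proof
  fix x :: real assume x: "x \<in> {-1..1}"
  show "continuous (at x within {-1..1}) (F l)"
  proof (cases "x = -1")
    case False
    then have "x > -1" using x by auto
    have "\<forall>\<^sub>F t in at x within {-1..1}. exp (- l * ((1 - t) / (1 + t))) = F l t"
    proof -
      have "\<forall>\<^sub>F t in nhds x. t \<in> {-1<..}" using \<open>x > -1\<close> by (intro eventually_nhds_in_open) auto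
      then have "\<forall>\<^sub>F t in at x within {-1..1}. t \<in> {-1<..}" 
        unfolding eventually_at_filter by (rule eventually_mono) auto
      then show ?thesis by eventually_elim (auto simp: F_def)
    qed
    moreover have "((\<lambda>t. exp (- l * ((1 - t) / (1 + t)))) \<longlongrightarrow> exp (- l * ((1 - x) / (1 + x)))) (at x within {-1..1})"
      using \<open>x > -1\<close> by (intro tendsto_intros) auto
    ultimately show ?thesis
      using False by (auto simp: continuous_within F_def intro: Lim_transform_eventually)
  next
    case True
    have "((\<lambda>t. exp (- l * ((1 - t) / (1 + t)))) \<longlongrightarrow> 0) (at_right (-1))"
      using l by real_asymp
    then have "(F l \<longlongrightarrow> 0) (at_right (-1))"
      by (rule Lim_transform_eventually) (auto simp: F_def eventually_at_filter)
    then show ?thesis using True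
      by (auto simp: continuous_within F_def at_within_Icc_at_right)
  qed
qed

lemma cheb_coeff_eq_cos_coeff:
  assumes l: "l > 0"
  shows "cheb_coeff l k = cos_coeff (\<lambda>\<theta>. F l (cos \<theta>)) k"
proof -
  have "continuous_on {-1..1} (\<lambda>x. F l x * poly (cheb_T k) x)"
    by (intro continuous_intros F_continuous l)
  from cheb_weight_integral [OF this] show ?thesis
    by (simp add: cheb_coeff_def cos_coeff_def poly_cheb_T_cos)
qed

lemma norm_2C_remainder:
  assumes l: "l > 0"
  shows "(\<lambda>j. pi / 2 * (cheb_coeff l (m + Suc j))\<^sup>2) sums (norm_2C (remainder m l))\<^sup>2"
    and "norm_2C (remainder m l) \<ge> 0"
proof -
  let ?J = "integral {0..pi} (\<lambda>\<theta>. (cos_tail (\<lambda>\<theta>. F l (cos \<theta>)) m \<theta>)\<^sup>2)"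
  have "continuous_on {-1..1} (\<lambda>x. \<bar>remainder m l x\<bar>\<^sup>2)"
    unfolding remainder_def by (intro continuous_intros F_continuous l)
  from cheb_weight_integral [OF this]
  have "norm_2C (remainder m l) = sqrt ?J"
    by (simp add: norm_2C_def remainder_def cos_tail_def cheb_coeff_eq_cos_coeff [OF l] poly_cheb_T_cos)
  moreover have "?J \<ge> 0"
    by (rule sums_le [OF _ sums_zero cos_tail_parseval [OF F_continuous [OF l]]]) auto
  ultimately show "(\<lambda>j. pi / 2 * (cheb_coeff l (m + Suc j))\<^sup>2) sums (norm_2C (remainder m l))\<^sup>2"
    and "norm_2C (remainder m l) \<ge> 0"
    using cos_tail_parseval [OF F_continuous [OF l], of m] by (simp_all add: cheb_coeff_eq_cos_coeff [OF l])
qed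

lemma coeff_kern_imaginary_axis:
  fixes t :: real
  defines "u \<equiv> (1 + \<i> * of_real t) / (1 - \<i> * of_real t)"
  shows "coeff_kern l n (Complex 0 t)
      = of_real (exp (- (l * t\<^sup>2))) * (-1) ^ Suc n * cnj (u ^ Suc n) / of_real (1 + t\<^sup>2)"
proof -
  define p q where "p = 1 + \<i> * of_real t" and "q = 1 - \<i> * of_real t"
  have ne: "p \<noteq> 0" "q \<noteq> 0" by (auto simp: p_def q_def complex_eq_iff)
  have z: "Complex 0 t = \<i> * of_real t" by (simp add: complex_eq_iff)
  have pq: "p * q = of_real (1 + t\<^sup>2)" by (simp add: p_def q_def algebra_simps power2_eq_square)
  have u: "cnj u = q / p" by (simp add: u_def p_def q_def)
  have cay: "cayley (Complex 0 t) = - (q / p)" by (simp add: z cayley_def p_def q_def add.commute minus_divide_left)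
  have "kern n (Complex 0 t) = - ((- (q / p)) ^ n / p\<^sup>2)" by (simp only: kern_def cay) (simp add: z p_def)
  also have "\<dots> = (-1) ^ Suc n * (q / p) ^ n / p\<^sup>2" by (simp add: power_minus [of "q / p"])
  also have "\<dots> = (-1) ^ Suc n * (q / p) ^ Suc n / (p * q)" using ne by (simp add: power2_eq_square)
  finally have "kern n (Complex 0 t) = (-1) ^ Suc n * (q / p) ^ Suc n / of_real (1 + t\<^sup>2)" unfolding pq .
  moreover have "exp (of_real l * (Complex 0 t)\<^sup>2) = of_real (exp (- (l * t\<^sup>2)))"
    by (simp add: z power_mult_distrib exp_of_real [symmetric] del: exp_of_real)
  ultimately show ?thesis by (simp add: coeff_kern_def u)
qed

lemma integral_half_line_real:
  fixes f :: "real \<Rightarrow> real"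
  assumes "integrable lborel f"
  shows "integral {0<..} f = (\<integral>t. indicator {0<..} t * f t \<partial>lborel)"
proof -
  have "set_integrable lborel {0<..} f"
    unfolding set_integrable_def using assms by (intro integrable_mult_indicator) auto
  from set_borel_integral_eq_integral(2) [OF this] show ?thesis
    by (simp add: set_lebesgue_integral_def)
qed

text \<open>
  The substitution \<open>\<theta> = 2 arctan t\<close> sends \<open>cos \<theta>\<close> to \<open>(1 - t\<^sup>2) / (1 + t\<^sup>2)\<close>, the real part of
  \<open>u = (1 + i t) / (1 - i t)\<close>, and \<open>F\<close> to a Gaussian. The sign \<open>(-1)\<^sup>k\<close> appears because \<open>w (i t)\<close> is minus
  the conjugate of \<open>u\<close>.
\<close>

lemma cheb_coeff_imaginary_axis:
  assumes l: "l > 0"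
  shows "cheb_coeff l (Suc n)
    = (-1) ^ Suc n * (4 / pi) * Re (\<integral>y. indicator {0<..} y *\<^sub>R coeff_kern l n (Complex 0 y) \<partial>lborel)"
proof -
  let ?k = "Suc n"
  let ?H = "\<lambda>\<theta>. F l (cos \<theta>) * cos (real ?k * \<theta>)"
  let ?G = "\<lambda>t. coeff_kern l n (Complex 0 t)"
  let ?R = "\<lambda>t. 2 * (-1) ^ ?k * Re (?G t)"
  have im: "(\<lambda>t. 2 * arctan t) ` {0<..} = {0<..<pi}"
  proof (intro equalityI subsetI)
    fix \<theta> assume "\<theta> \<in> (\<lambda>t. 2 * arctan t) ` {0<..}"
    then show "\<theta> \<in> {0<..<pi}" using arctan_ubound by (auto simp: mult.commute field_simps)
  next
    fix \<theta> :: real assume \<theta>: "\<theta> \<in> {0<..<pi}"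
    then have "arctan (tan (\<theta> / 2)) = \<theta> / 2" by (intro arctan_tan) auto
    moreover have "tan (\<theta> / 2) > 0" using \<theta> by (intro tan_gt_zero) auto
    ultimately show "\<theta> \<in> (\<lambda>t. 2 * arctan t) ` {0<..}" by (intro image_eqI [of _ _ "tan (\<theta> / 2)"]) auto
  qed
  have pt: "\<bar>2 / (1 + t\<^sup>2)\<bar> * ?H (2 * arctan t) = ?R t" if t: "t \<in> {0<..}" for t
  proof -
    define u where "u = (1 + \<i> * of_real t) / (1 - \<i> * of_real t)"
    have pos: "1 + t\<^sup>2 > 0" by (simp add: add_pos_nonneg)
    have ne: "1 - \<i> * of_real t \<noteq> 0" by (auto simp: complex_eq_iff)
    have nu: "cmod u = 1"
    proof -
      have "cmod (1 + \<i> * of_real t) = cmod (1 - \<i> * of_real t)" by (simp add: cmod_def)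
      then show ?thesis using ne by (simp add: u_def norm_divide)
    qed
    have c: "cos (2 * arctan t) = (1 - t\<^sup>2) / (1 + t\<^sup>2)"
      unfolding cos_double_cos cos_arctan using pos by (simp add: power_divide field_simps)
    have reu: "Re u = (1 - t\<^sup>2) / (1 + t\<^sup>2)"
      by (simp add: u_def Re_divide power2_eq_square)
    have T: "cos (real ?k * (2 * arctan t)) = Re (u ^ ?k)"
      using poly_cheb_T_cos [of ?k "2 * arctan t"] poly_cheb_T_Re [OF nu, of ?k] by (simp only: c reu)
    have F: "F l ((1 - t\<^sup>2) / (1 + t\<^sup>2)) = exp (- (l * t\<^sup>2))"
    proof -
      have "1 + (1 - t\<^sup>2) / (1 + t\<^sup>2) = 2 / (1 + t\<^sup>2)" "1 - (1 - t\<^sup>2) / (1 + t\<^sup>2) = 2 * t\<^sup>2 / (1 + t\<^sup>2)"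
        using pos by (simp_all add: field_simps)
      moreover from this(1) pos have "(1 - t\<^sup>2) / (1 + t\<^sup>2) \<noteq> -1" by (metis add.right_inverse divide_eq_0_iff less_irrefl zero_neq_numeral)
      ultimately show ?thesis using pos by (simp add: F_def)
    qed
    have "Re (?G t) = (-1) ^ ?k * (exp (- (l * t\<^sup>2)) * Re (u ^ ?k) / (1 + t\<^sup>2))"
    proof -
      have "?G t = of_real ((-1) ^ ?k * exp (- (l * t\<^sup>2)) / (1 + t\<^sup>2)) * cnj (u ^ ?k)"
        unfolding coeff_kern_imaginary_axis u_def by (simp add: mult_ac)
      moreover have "Re (of_real r * cnj w) = r * Re w" for r w by simp
      ultimately have "Re (?G t) = (-1) ^ ?k * exp (- (l * t\<^sup>2)) / (1 + t\<^sup>2) * Re (u ^ ?k)" by (simp only:)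
      then show ?thesis by (simp del: power_Suc)
    qed
    then have "?R t = 2 * ((-1) ^ ?k * (-1) ^ ?k) * (exp (- (l * t\<^sup>2)) * Re (u ^ ?k) / (1 + t\<^sup>2))"
      by (simp only: mult_ac)
    also have "(-1) ^ ?k * (-1) ^ ?k = (1 :: real)" by (simp flip: power_mult_distrib del: power_Suc)
    finally show ?thesis using pos unfolding c T F by (simp add: mult_ac del: power_Suc)
  qed
  have ch: "continuous_on {0..pi} ?H"
    by (intro continuous_intros continuous_on_compose2 [OF F_continuous [OF l]]) auto
  have "?H absolutely_integrable_on {0<..<pi}"
    by (rule set_integrable_subset [OF absolutely_integrable_continuous_real [OF ch]]) auto
  then have "(\<lambda>t. \<bar>2 / (1 + t\<^sup>2)\<bar> * ?H (2 * arctan t)) absolutely_integrable_on {0<..} \<and>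
     integral {0<..} (\<lambda>t. \<bar>2 / (1 + t\<^sup>2)\<bar> * ?H (2 * arctan t)) = integral {0<..<pi} ?H"
    unfolding im [symmetric]
  proof (subst has_absolute_integral_change_of_variables_1' [where g = "\<lambda>t. 2 * arctan t"])
    show "((\<lambda>t. 2 * arctan t) has_field_derivative 2 / (1 + t\<^sup>2)) (at t within {0<..})" for t :: real
      by (auto intro!: derivative_eq_intros simp: divide_inverse)
  qed (auto intro!: inj_onI simp: arctan_eq_iff)
  then have "integral {0..pi} ?H = integral {0<..} (\<lambda>t. \<bar>2 / (1 + t\<^sup>2)\<bar> * ?H (2 * arctan t))"
    by (simp only: integral_open_interval_real)
  also have "\<dots> = integral {0<..} ?R" by (rule integral_cong) (rule pt)
  also have "\<dots> = (\<integral>t. indicator {0<..} t * ?R t \<partial>lborel)"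
    by (rule integral_half_line_real) (intro integrable_mult_right integrable_Re coeff_kern_line_integrable l order_refl)
  also have "\<dots> = (\<integral>t. 2 * (-1) ^ ?k * Re (indicator {0<..} t *\<^sub>R ?G t) \<partial>lborel)"
    by (rule Bochner_Integration.integral_cong) (auto simp del: power_Suc)
  also have "\<dots> = 2 * (-1) ^ ?k * Re (\<integral>t. indicator {0<..} t *\<^sub>R ?G t \<partial>lborel)"
  proof -
    have "integrable lborel (\<lambda>t. indicator {0<..} t *\<^sub>R ?G t)"
      by (intro integrable_mult_indicator coeff_kern_line_integrable l) auto
    then show ?thesis by (simp only: integral_mult_right_zero integral_Re)
  qed
  finally show ?thesis
    unfolding cheb_coeff_eq_cos_coeff [OF l] cos_coeff_def by (simp del: power_Suc)
qed

lemma cheb_coeff_line: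
  assumes l: "l > 0" and c: "c \<ge> 0"
  shows "cheb_coeff l (Suc n)
    = (-1) ^ Suc n * (4 / pi) * Re (\<integral>y. indicator {0<..} y *\<^sub>R coeff_kern l n (Complex c y) \<partial>lborel)"
proof -
  have "of_real (2 * Re (\<integral>y. indicator {0<..} y *\<^sub>R coeff_kern l n (Complex 0 y) \<partial>lborel))
     = (of_real (2 * Re (\<integral>y. indicator {0<..} y *\<^sub>R coeff_kern l n (Complex c y) \<partial>lborel)) :: complex)"
    unfolding integral_conj_symmetric [OF coeff_kern_line_integrable [OF order_refl l] coeff_kern_conj, symmetric]
      integral_conj_symmetric [OF coeff_kern_line_integrable [OF c l] coeff_kern_conj, symmetric]
    by (rule coeff_kern_line_shift [OF c l])
  then have "Re (\<integral>y. indicator {0<..} y *\<^sub>R coeff_kern l n (Complex 0 y) \<partial>lborel)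
     = Re (\<integral>y. indicator {0<..} y *\<^sub>R coeff_kern l n (Complex c y) \<partial>lborel)"
    by (simp only: of_real_eq_iff)
  then show ?thesis unfolding cheb_coeff_imaginary_axis [OF l] by simp
qed

lemma coeff_kern_growth:
  "coeff_kern (saddle_rate c * real m) (m + i) z = growth c z ^ m * kern i z"
proof -
  have "exp (of_real (saddle_rate c * real m) * z\<^sup>2) = exp (of_real (saddle_rate c) * z\<^sup>2) ^ m"
    by (simp add: mult_ac flip: exp_of_nat_mult)
  then show ?thesis
    by (simp add: coeff_kern_def kern_def growth_def power_add power_mult_distrib)
qed

lemma cheb_coeff_upper_line:
  assumes c: "0 < c" "1 < 3 * c\<^sup>2" and m: "m \<ge> 1"
  shows "cheb_coeff (saddle_rate c * real m) (m + Suc i)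
    = (-1) ^ (m + Suc i) * (4 / pi) * Re (growth c (saddle_pt c) ^ m * (\<integral>s. upper_line c m i s \<partial>lborel))"
proof -
  let ?l = "saddle_rate c * real m"
  have l: "?l > 0" using saddle_rate_pos [OF c] m by simp
  have "(\<integral>y. indicator {0<..} y *\<^sub>R coeff_kern ?l (m + i) (Complex c y) \<partial>lborel)
     = (\<integral>s. indicator {0<..} (saddle_im c + 1 * s) *\<^sub>R coeff_kern ?l (m + i) (Complex c (saddle_im c + 1 * s)) \<partial>lborel)"
    by (subst lborel_integral_real_affine [of 1 _ "saddle_im c"]) auto
  also have "\<dots> = (\<integral>s. growth c (saddle_pt c) ^ m * upper_line c m i s \<partial>lborel)"
    by (rule Bochner_Integration.integral_cong)
       (auto simp: upper_line_def coeff_kern_growth power_divide growth_saddle_ne_0 [OF c] indicator_def)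
  finally show ?thesis
    using cheb_coeff_line [OF l, of c "m + i"] c by (simp del: power_Suc)
qed

definition saddle_leading :: "nat \<Rightarrow> nat \<Rightarrow> real \<Rightarrow> real" where
  "saddle_leading m i c = 4 / pi * Re ((growth c (saddle_pt c) / of_real (cmod (growth c (saddle_pt c)))) ^ m
     * (kern i (saddle_pt c) * of_real (sqrt pi) / csqrt (saddle_curv c)))"

lemma cheb_coeff_asymptotics:
  fixes c1 c2 :: real
  assumes c1: "0 < c1" "1 < 3 * c1\<^sup>2" and c12: "c1 \<le> c2"
  shows "\<exists>C\<ge>0. \<forall>c\<in>{c1..c2}. \<forall>m\<ge>1. \<forall>i.
     \<bar>(-1) ^ (m + Suc i) * (sqrt (real m) / cmod (growth c (saddle_pt c)) ^ m
            * cheb_coeff (saddle_rate c * real m) (m + Suc i))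
       - saddle_leading m i c\<bar>
       \<le> C / real (Suc i) / real m"
proof -
  obtain C where C: "C \<ge> 0" and est: "\<And>c m i. c \<in> {c1..c2} \<Longrightarrow> m \<ge> 1 \<Longrightarrow>
     cmod ((\<integral>s. upper_line c m i s \<partial>lborel)
          - kern i (saddle_pt c) * of_real (sqrt pi / sqrt (real m)) / csqrt (saddle_curv c))
       \<le> C / (real (Suc i) * (real m * sqrt (real m)))"
    using saddle_laplace [OF c1 c12] by blast
  have "\<bar>(-1) ^ (m + Suc i) * (sqrt (real m) / cmod (growth c (saddle_pt c)) ^ m
            * cheb_coeff (saddle_rate c * real m) (m + Suc i))
       - saddle_leading m i c\<bar>
       \<le> 4 / pi * C / real (Suc i) / real m"
    if c: "c \<in> {c1..c2}" and m: "m \<ge> 1" for c and m i :: nat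
  proof -
    have adm: "0 < c" "1 < 3 * c\<^sup>2" using admissible_mono [OF c1] c by auto
    define g where "g = growth c (saddle_pt c)"
    define I where "I = (\<integral>s. upper_line c m i s \<partial>lborel)"
    define M where "M = kern i (saddle_pt c) * of_real (sqrt pi) / csqrt (saddle_curv c)"
    have g: "g \<noteq> 0" using growth_saddle_ne_0 [OF adm] by (simp add: g_def)
    have sm: "sqrt (real m) > 0" using m by simp
    have e: "cmod (I - M / of_real (sqrt (real m))) \<le> C / (real (Suc i) * (real m * sqrt (real m)))"
      using est [OF c m, of i] by (simp add: I_def M_def mult_ac)
    have "(-1) ^ (m + Suc i) * (sqrt (real m) / cmod g ^ m * cheb_coeff (saddle_rate c * real m) (m + Suc i))
        = ((-1) ^ (m + Suc i) * (-1) ^ (m + Suc i)) * (sqrt (real m) / cmod g ^ m * (4 / pi * Re (g ^ m * I)))"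
      unfolding cheb_coeff_upper_line [OF adm m] g_def I_def by (simp only: mult_ac)
    also have "(-1) ^ (m + Suc i) * (-1) ^ (m + Suc i) = (1 :: real)"
      by (simp flip: power_mult_distrib del: power_Suc)
    also have "1 * (sqrt (real m) / cmod g ^ m * (4 / pi * Re (g ^ m * I)))
        = 4 / pi * Re (of_real (sqrt (real m)) * ((g / of_real (cmod g)) ^ m * I))"
    proof -
      have "of_real (sqrt (real m)) * ((g / of_real (cmod g)) ^ m * I) = of_real (sqrt (real m) / cmod g ^ m) * (g ^ m * I)"
        by (simp add: power_divide)
      moreover have "Re (of_real r * z) = r * Re z" for r z by simp
      ultimately have e: "Re (of_real (sqrt (real m)) * ((g / of_real (cmod g)) ^ m * I))
          = sqrt (real m) / cmod g ^ m * Re (g ^ m * I)" by (simp only:)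
      show ?thesis unfolding e by (simp only: mult_ac mult_1_left)
    qed
    finally have "(-1) ^ (m + Suc i) * (sqrt (real m) / cmod g ^ m * cheb_coeff (saddle_rate c * real m) (m + Suc i))
        - 4 / pi * Re ((g / of_real (cmod g)) ^ m * M)
      = 4 / pi * Re (of_real (sqrt (real m)) * ((g / of_real (cmod g)) ^ m * (I - M / of_real (sqrt (real m)))))"
      using sm by (simp add: algebra_simps)
    also have "\<bar>\<dots>\<bar> \<le> 4 / pi * (sqrt (real m) * cmod (I - M / of_real (sqrt (real m))))"
    proof -
      have "cmod (of_real (sqrt (real m)) * ((g / of_real (cmod g)) ^ m * (I - M / of_real (sqrt (real m)))))
         = sqrt (real m) * cmod (I - M / of_real (sqrt (real m)))"
        using g by (simp add: norm_mult norm_power norm_divide)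
      then show ?thesis
        using abs_Re_le_cmod [of "of_real (sqrt (real m)) * ((g / of_real (cmod g)) ^ m * (I - M / of_real (sqrt (real m))))"]
        by (simp only: abs_mult) (simp add: field_simps)
    qed
    also have "\<dots> \<le> 4 / pi * (sqrt (real m) * (C / (real (Suc i) * (real m * sqrt (real m)))))"
      by (intro mult_left_mono e) auto
    also have "\<dots> = 4 / pi * C / real (Suc i) / real m" using sm by simp
    finally show ?thesis by (simp only: g_def M_def saddle_leading_def)
  qed
  then show ?thesis using C by (intro exI [of _ "4 / pi * C"]) auto
qed

section \<open>The saddle as a function of the parameter; branches\<close>

lemma saddle_rate_strict_antimono:
  assumes "0 < c" "1 < 3 * c\<^sup>2" "c < d"
  shows "saddle_rate d < saddle_rate c"
proof -
  have sq: "c\<^sup>2 < d\<^sup>2" using assms by (intro power_strict_mono) auto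
  have s4: "1 < 4 * c\<^sup>2" "1 < 4 * d\<^sup>2" using assms sq by linarith+
  have "2 * c * (4 * c\<^sup>2 - 1) < 2 * d * (4 * d\<^sup>2 - 1)"
    by (rule mult_strict_mono) (use assms sq s4 in linarith)+
  then show ?thesis
    unfolding saddle_rate_def using assms s4 by (intro divide_strict_left_mono mult_pos_pos) auto
qed

lemma saddle_rate_inj:
  assumes "0 < c" "1 < 3 * c\<^sup>2" "0 < d" "1 < 3 * d\<^sup>2" "saddle_rate c = saddle_rate d"
  shows "c = d"
  using saddle_rate_strict_antimono [of c d] saddle_rate_strict_antimono [of d c] assms
  by (cases c d rule: linorder_cases) auto

text \<open>
  The inverse of \<open>saddle_rate\<close>, that is \<open>Re \<zeta>\<close> as a function of \<open>a\<close>.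
\<close>

definition saddle_re :: "real \<Rightarrow> real" where
  "saddle_re a = (THE c. 0 < c \<and> 1 < 3 * c\<^sup>2 \<and> saddle_rate c = a)"

lemma saddle_re_saddle_rate:
  assumes "0 < c" "1 < 3 * c\<^sup>2"
  shows "saddle_re (saddle_rate c) = c"
  unfolding saddle_re_def by (rule the_equality) (use assms saddle_rate_inj in auto)

lemma saddle_rate_surj:
  assumes "a \<in> {0<..<alpha_c}"
  shows "\<exists>c>0. 1 < 3 * c\<^sup>2 \<and> saddle_rate c = a"
proof -
  let ?p = "\<lambda>x::real. 2 * x * (4 * x\<^sup>2 - 1)"
  have a: "a > 0" "a < 3 * sqrt 3 / 2" using assms by (auto simp: alpha_c_def)
  have s3: "sqrt 3 > (0::real)" by simp
  have lo: "?p (1 / sqrt 3) = 1 / (3 * sqrt 3 / 2)" by (simp add: power_divide)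
  also have "\<dots> < 1 / a" using a by (intro divide_strict_left_mono) auto
  finally have lo: "?p (1 / sqrt 3) < 1 / a" .
  \<comment> \<open>The increasing function \<open>p\<close> lies above \<open>1 / a\<close> at this point, because \<open>p x \<ge> 2 x\<close> for \<open>x \<ge> 1\<close>.\<close>
  let ?x = "1 + 1 / a"
  have x1: "?x \<ge> 1" using a by simp
  have "x \<le> 2 * (1 + x) * 1" if "0 \<le> x" for x :: real using that by simp
  from this [of "1 / a"] have "1 / a \<le> 2 * ?x * 1" using a by simp
  also have "\<dots> \<le> ?p ?x"
  proof -
    have "2 * x * 1 \<le> 2 * x * (4 * x\<^sup>2 - 1)" if "1 \<le> x" for x :: real
    proof (rule mult_left_mono)
      show "1 \<le> 4 * x\<^sup>2 - 1" using one_le_power [OF that, of 2] by linarith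
    qed (use that in simp)
    from this [OF x1] show ?thesis .
  qed
  finally have hi: "1 / a \<le> ?p ?x" .
  have "1 / sqrt 3 \<le> 1" by simp
  with x1 have le: "1 / sqrt 3 \<le> ?x" by linarith
  obtain c where c: "1 / sqrt 3 \<le> c" "c \<le> ?x" "?p c = 1 / a"
  proof -
    have "continuous_on {1 / sqrt 3..?x} ?p" by (intro continuous_intros)
    from IVT' [OF less_imp_le [OF lo] hi le this] show ?thesis using that by blast
  qed
  have "c \<noteq> 1 / sqrt 3" using c(3) lo by auto
  with c have cg: "1 / sqrt 3 < c" by simp
  then have "(1 / sqrt 3)\<^sup>2 < c\<^sup>2" by (intro power_strict_mono) auto
  then have "1 < 3 * c\<^sup>2" by (simp add: power_divide)
  moreover have "c > 0" using cg s3 by (meson less_trans zero_less_divide_1_iff)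
  moreover have "saddle_rate c = a" unfolding saddle_rate_def c(3) by simp
  ultimately show ?thesis by blast
qed

lemma saddle_re:
  assumes "a \<in> {0<..<alpha_c}"
  shows "saddle_re a > 0" "1 < 3 * (saddle_re a)\<^sup>2" "saddle_rate (saddle_re a) = a"
  using saddle_rate_surj [OF assms] saddle_re_saddle_rate by auto

text \<open>
  Uniqueness of the root: the imaginary part of the equation gives \<open>y\<^sup>2 = 3 x\<^sup>2 - 1\<close> and then the real
  part gives \<open>saddle_rate x = a\<close>, which determines \<open>x\<close> by monotonicity.
\<close>

lemma zeta_eq:
  assumes "a \<in> {0<..<alpha_c}"
  shows "zeta a = saddle_pt (saddle_re a)"
proof -
  note c = saddle_re [OF assms]
  show ?thesis unfolding zeta_def
  proof (rule the_equality)
    show "0 < Re (saddle_pt (saddle_re a)) \<and> 0 < Im (saddle_pt (saddle_re a)) \<and>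
        of_real a * ((saddle_pt (saddle_re a)) ^ 3 - saddle_pt (saddle_re a)) + 1 = 0"
      using saddle_pt_cubic [OF c(1,2)] saddle_im_pos [OF c(1,2)] c by simp
  next
    fix z assume "0 < Re z \<and> 0 < Im z \<and> of_real a * (z ^ 3 - z) + 1 = 0"
    then have x: "0 < Re z" and y: "0 < Im z" and eq: "of_real a * (z ^ 3 - z) + 1 = 0" by auto
    have a: "a > 0" using assms by simp
    have "Im (of_real a * (z ^ 3 - z) + 1) = a * (Im z * (3 * (Re z)\<^sup>2 - (Im z)\<^sup>2 - 1))"
      by (simp add: power3_eq_cube power2_eq_square algebra_simps)
    then have y2: "(Im z)\<^sup>2 = 3 * (Re z)\<^sup>2 - 1" using eq a y by simp
    then have adm: "1 < 3 * (Re z)\<^sup>2" using zero_less_power [OF y, of 2] by linarith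
    have "Re (of_real a * (z ^ 3 - z) + 1) = a * (Re z * ((Re z)\<^sup>2 - 3 * (Im z)\<^sup>2 - 1)) + 1"
      by (simp add: power3_eq_cube power2_eq_square algebra_simps)
    moreover have "Re (of_real a * (z ^ 3 - z) + 1) = 0" by (simp only: eq zero_complex.sel)
    ultimately have "a * (Re z * ((Re z)\<^sup>2 - 3 * (3 * (Re z)\<^sup>2 - 1) - 1)) + 1 = 0" by (simp only: y2)
    then have "a * (2 * Re z * (4 * (Re z)\<^sup>2 - 1)) = 1" by (simp add: algebra_simps)
    then have "saddle_rate (Re z) = a" unfolding saddle_rate_def
      by (metis divide_eq_eq zero_neq_one mult_zero_right)
    then have re: "Re z = saddle_re a" using saddle_re_saddle_rate [OF x adm] by simp
    have "Im z = saddle_im (Re z)" using y y2 by (simp add: saddle_im_def real_sqrt_unique)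
    then show "z = saddle_pt (saddle_re a)" using re by (simp add: complex_eq_iff)
  qed
qed

lemma isCont_saddle_re:
  assumes "a \<in> {0<..<alpha_c}"
  shows "isCont saddle_re a"
proof -
  note c = saddle_re [OF assms]
  define c where "c = saddle_re a"
  have lo: "1 / sqrt 3 < c"
  proof (rule power2_less_imp_less)
    show "(1 / sqrt 3)\<^sup>2 < c\<^sup>2" using c by (simp add: c_def power_divide)
  qed (use c in \<open>simp add: c_def\<close>)
  define d where "d = (c - 1 / sqrt 3) / 2"
  have d: "d > 0" using lo by (simp add: d_def)
  have adm: "0 < z \<and> 1 < 3 * z\<^sup>2" if "\<bar>z - c\<bar> \<le> d" for z
  proof -
    have "z > 1 / sqrt 3" using that lo unfolding d_def by (simp add: abs_le_iff field_simps)
    then have "(1 / sqrt 3)\<^sup>2 < z\<^sup>2" by (intro power_strict_mono) auto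
    moreover have "z > 0" using \<open>z > 1 / sqrt 3\<close> by (rule less_trans [rotated]) simp
    ultimately show ?thesis by (simp add: power_divide)
  qed
  have "isCont saddle_re (saddle_rate c)"
  proof (rule isCont_inverse_function [where f = saddle_rate and x = c, OF d])
    show "saddle_re (saddle_rate z) = z" if "\<bar>z - c\<bar> \<le> d" for z
      using adm [OF that] saddle_re_saddle_rate by blast
    show "isCont saddle_rate z" if "\<bar>z - c\<bar> \<le> d" for z
      using adm [OF that] unfolding saddle_rate_def by (intro continuous_intros) auto
  qed
  then show ?thesis using c by (simp add: c_def)
qed

lemma saddle_re_continuous: "continuous_on {0<..<alpha_c} saddle_re"
  using isCont_saddle_re by (auto intro: continuous_at_imp_continuous_on)

lemma zeta_continuous: "continuous_on {0<..<alpha_c} zeta"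
proof -
  have "continuous_on {0<..<alpha_c} (\<lambda>a. Complex (saddle_re a) (sqrt (3 * (saddle_re a)\<^sup>2 - 1)))"
    by (intro continuous_on_Complex continuous_intros saddle_re_continuous)
  then show ?thesis
    by (rule continuous_on_cong [THEN iffD1, rotated -1]) (auto simp: zeta_eq saddle_pt_def saddle_im_def)
qed

lemma eventually_in_range: "eventually (\<lambda>a. a \<in> {0<..<alpha_c}) (at_right 0)"
  by (rule eventually_at_right_real) (simp add: alpha_c_def)

lemma saddle_re_at_top: "filterlim saddle_re at_top (at_right 0)"
  unfolding filterlim_at_top_gt [where c = 1]
proof (intro allI impI)
  fix Z :: real assume Z: "1 < Z"
  have admZ: "0 < Z" "1 < 3 * Z\<^sup>2" using Z one_less_power [OF Z, of 2] by linarith+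
  have "eventually (\<lambda>a. a \<in> {0<..<saddle_rate Z}) (at_right 0)"
    by (rule eventually_at_right_real) (use saddle_rate_pos [OF admZ] in simp)
  with eventually_in_range show "\<forall>\<^sub>F a in at_right 0. Z \<le> saddle_re a"
  proof eventually_elim
    case (elim a)
    note c = saddle_re [OF elim(1)]
    show ?case
      using admissible_mono(4) [OF c(1,2), of Z] c(3) elim(2) by (cases "Z \<le> saddle_re a") auto
  qed
qed

lemma rho_omega:
  assumes "a \<in> {0<..<alpha_c}"
  shows "cayley (zeta a) = of_real (rho a) * exp (\<i> * of_real (omega a))"
    and "0 < rho a" "rho a < 1" "0 < omega a" "omega a < pi"
proof -
  note c = saddle_re [OF assms]
  let ?w = "cayley (zeta a)"
  have rho: "rho a = cmod ?w" by (simp add: rho_def cayley_def)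
  have im: "Im (zeta a) > 0" using saddle_im_pos [OF c(1,2)] by (simp add: zeta_eq [OF assms])
  have imw: "Im ?w > 0"
  proof -
    have "Im ?w = 2 * Im (zeta a) / (cmod (zeta a + 1))\<^sup>2"
      by (simp add: cayley_def Im_divide cmod_power2 algebra_simps)
    moreover have "zeta a + 1 \<noteq> 0" using one_minus_sq_ne_0 [OF im] by simp
    ultimately show ?thesis using im by simp
  qed
  then have w0: "?w \<noteq> 0" by auto
  then show "0 < rho a" by (simp add: rho)
  have "(rho a)\<^sup>2 < 1"
    using norm_cayley_sq' [OF c(1,2), of "saddle_im (saddle_re a)"] c(1)
    by (simp add: rho zeta_eq [OF assms] saddle_pt_def add_pos_nonneg)
  then show "rho a < 1" by (simp add: power_less_one_iff rho abs_square_less_1)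
  have "\<exists>!w. 0 < w \<and> w < pi \<and> (zeta a - 1) / (zeta a + 1) = of_real (rho a) * exp (\<i> * of_real w)"
  proof (rule ex1I [of _ "Arg ?w"])
    show "0 < Arg ?w \<and> Arg ?w < pi \<and> (zeta a - 1) / (zeta a + 1) = of_real (rho a) * exp (\<i> * of_real (Arg ?w))"
      using Arg_eq [OF w0] imw Arg_lt_pi [of ?w] by (simp add: rho cayley_def)
  next
    fix w assume "0 < w \<and> w < pi \<and> (zeta a - 1) / (zeta a + 1) = of_real (rho a) * exp (\<i> * of_real w)"
    then show "w = Arg ?w"
      using w0 by (intro Arg_unique [symmetric, of "rho a"]) (auto simp: rho cayley_def)
  qed
  from theI' [OF this] have "0 < omega a \<and> omega a < pi \<and>
     (zeta a - 1) / (zeta a + 1) = of_real (rho a) * exp (\<i> * of_real (omega a))"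
    by (simp only: omega_def)
  then show "?w = of_real (rho a) * exp (\<i> * of_real (omega a))" "0 < omega a" "omega a < pi"
    by (auto simp: cayley_def)
qed

lemma exp_psi_saddle:
  assumes "a \<in> {0<..<alpha_c}"
  shows "exp (psi_saddle a) = growth (saddle_re a) (saddle_pt (saddle_re a))"
proof -
  note r = rho_omega [OF assms]
  have "exp (psi_saddle a) = of_real (exp (ln (rho a))) * exp (\<i> * of_real (omega a)) * exp (of_real a * (zeta a)\<^sup>2)"
    by (simp only: psi_saddle_def exp_add exp_of_real)
  also have "\<dots> = cayley (zeta a) * exp (of_real a * (zeta a)\<^sup>2)" using r by simp
  finally show ?thesis
    using saddle_re(3) [OF assms] by (simp add: growth_def zeta_eq [OF assms])
qed

lemma growth_saddle_eq:
  assumes "a \<in> {0<..<alpha_c}"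
  shows "cmod (growth (saddle_re a) (saddle_pt (saddle_re a))) = H_e a"
    and "growth (saddle_re a) (saddle_pt (saddle_re a)) / of_real (H_e a) = exp (\<i> * of_real (Theta a))"
proof -
  show "cmod (growth (saddle_re a) (saddle_pt (saddle_re a))) = H_e a"
    unfolding exp_psi_saddle [OF assms, symmetric] H_e_def by (rule norm_exp_eq_Re)
  have "exp (psi_saddle a) = of_real (H_e a) * exp (\<i> * of_real (Theta a))"
    unfolding H_e_def Theta_def exp_of_real [symmetric] exp_add [symmetric]
    by (rule arg_cong [where f = exp]) (simp add: complex_eq_iff)
  then show "growth (saddle_re a) (saddle_pt (saddle_re a)) / of_real (H_e a) = exp (\<i> * of_real (Theta a))"
    unfolding exp_psi_saddle [OF assms] by (simp add: H_e_def)
qed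

text \<open>
  The radicand stays in the right half plane (\<open>Re_radicand_pos\<close>), so the continuous branch that
  starts at \<open>sqrt 3\<close> is the principal one.
\<close>

definition principal_branch :: "real \<Rightarrow> complex" where
  "principal_branch a = csqrt (3 - 2 * of_real a * zeta a)"

lemma Re_radicand_pos:
  assumes "a \<in> {0<..<alpha_c}" shows "Re (3 - 2 * of_real a * zeta a) > 0"
proof -
  note c = saddle_re [OF assms]
  have "saddle_rate (saddle_re a) * (saddle_im (saddle_re a))\<^sup>2 / (4 * (saddle_re a)\<^sup>2 + 2 * saddle_re a) > 0"
    using saddle_rate_pos [OF c(1,2)] saddle_im_pos [OF c(1,2)] c by (simp add: add_pos_pos)
  with Re_saddle_curv [OF c(1,2)] have "Re (saddle_curv (saddle_re a)) > 0" by linarith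
  then show ?thesis
    using assms by (simp add: saddle_curv_def c(3) zeta_eq [OF assms] zero_less_mult_iff)
qed

lemma principal_branch_sq: "(principal_branch a)\<^sup>2 = 3 - 2 * of_real a * zeta a"
  by (simp add: principal_branch_def)

lemma principal_branch_continuous: "continuous_on {0<..<alpha_c} principal_branch"
proof -
  have "3 - 2 * of_real a * zeta a \<notin> \<real>\<^sub>\<le>\<^sub>0" if "a \<in> {0<..<alpha_c}" for a
    using Re_radicand_pos [OF that] by (auto simp: complex_nonpos_Reals_iff)
  then show ?thesis
    unfolding principal_branch_def [abs_def]
    by (intro continuous_on_compose2 [OF continuous_on_csqrt] continuous_intros zeta_continuous) auto
qed

lemma principal_branch_ne_0:
  assumes "a \<in> {0<..<alpha_c}" shows "principal_branch a \<noteq> 0"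
proof -
  have "Re ((principal_branch a)\<^sup>2) > 0"
    unfolding principal_branch_sq by (rule Re_radicand_pos [OF assms])
  then show ?thesis by auto
qed

lemma radicand_tendsto: "((\<lambda>a. 3 - 2 * of_real a * zeta a) \<longlongrightarrow> 3) (at_right 0)"
proof -
  have "((\<lambda>a. of_real a * zeta a) \<longlongrightarrow> 0) (at_right 0)"
  proof (rule Lim_null_comparison)
    show "\<forall>\<^sub>F a in at_right 0. cmod (of_real a * zeta a) \<le> 1 / (4 * (saddle_re a)\<^sup>2 - 1)"
      using eventually_in_range
    proof eventually_elim
      case (elim a)
      note c = saddle_re [OF elim]
      have "(cmod (zeta a))\<^sup>2 \<le> (2 * saddle_re a)\<^sup>2"
        using saddle_im_sq [OF c(1,2)] by (simp add: zeta_eq [OF elim] cmod_power2 power_mult_distrib)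
      then have "cmod (zeta a) \<le> 2 * saddle_re a" by (rule power2_le_imp_le) (use c in simp)
      then have "cmod (of_real a * zeta a) \<le> saddle_rate (saddle_re a) * (2 * saddle_re a)"
        using elim c by (simp add: norm_mult mult_left_mono)
      also have "\<dots> = 1 / (4 * (saddle_re a)\<^sup>2 - 1)" using c(1) by (simp add: saddle_rate_def)
      finally show ?case .
    qed
    have "((\<lambda>c::real. 1 / (4 * c\<^sup>2 - 1)) \<longlongrightarrow> 0) at_top" by real_asymp
    from filterlim_compose [OF this saddle_re_at_top]
    show "((\<lambda>a. 1 / (4 * (saddle_re a)\<^sup>2 - 1)) \<longlongrightarrow> 0) (at_right 0)" .
  qed
  from tendsto_diff [OF tendsto_const [of 3] tendsto_mult [OF tendsto_const [of 2] this]]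
  show ?thesis by (simp add: mult.assoc)
qed

lemma principal_branch_tendsto: "(principal_branch \<longlongrightarrow> of_real (sqrt 3)) (at_right 0)"
proof -
  have "isCont csqrt (3::complex)" by (intro isCont_csqrt') (auto simp: complex_nonpos_Reals_iff)
  from isCont_tendsto_compose [OF this radicand_tendsto]
  have "(principal_branch \<longlongrightarrow> csqrt 3) (at_right 0)" by (simp add: principal_branch_def [abs_def])
  moreover have "csqrt 3 = of_real (sqrt 3)" using csqrt_of_real [of 3] by simp
  ultimately show ?thesis by simp
qed

text \<open>
  The quotient of two continuous square roots takes values in \<open>{1, -1}\<close>, hence is constant on the
  interval, and the limit at \<open>0\<close> decides the sign.
\<close>

lemma sqrt_branch_eq:
  assumes "a \<in> {0<..<alpha_c}" shows "sqrt_branch a = principal_branch a"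
proof -
  let ?I = "{0<..<alpha_c}"
  let ?P = "\<lambda>s. continuous_on ?I s \<and> (\<forall>x\<in>?I. (s x)\<^sup>2 = 3 - 2 * of_real x * zeta x) \<and>
       (s \<longlongrightarrow> complex_of_real (sqrt 3)) (at_right 0)"
  have "?P principal_branch"
    using principal_branch_continuous principal_branch_sq principal_branch_tendsto by blast
  then have "?P sqrt_branch" unfolding sqrt_branch_def by (rule someI [of ?P])
  then have s: "continuous_on ?I sqrt_branch" "\<And>x. x \<in> ?I \<Longrightarrow> (sqrt_branch x)\<^sup>2 = 3 - 2 * of_real x * zeta x"
     "(sqrt_branch \<longlongrightarrow> complex_of_real (sqrt 3)) (at_right 0)" by auto
  define q where "q = (\<lambda>x. sqrt_branch x / principal_branch x)"
  have "q x \<in> {1, -1}" if "x \<in> ?I" for x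
  proof -
    have "(q x)\<^sup>2 = 1"
      unfolding q_def power_divide s(2) [OF that] principal_branch_sq [symmetric]
      using principal_branch_ne_0 [OF that] by simp
    then show ?thesis by (simp add: power2_eq_1_iff)
  qed
  then have "q ` ?I \<subseteq> {1, -1}" by blast
  then have "finite (q ` ?I)" by (rule finite_subset) simp
  moreover have "continuous_on ?I q"
    unfolding q_def using principal_branch_ne_0
    by (intro continuous_intros s principal_branch_continuous) auto
  ultimately have "q constant_on ?I" by (intro continuous_finite_range_constant) auto
  then obtain k where k: "\<And>x. x \<in> ?I \<Longrightarrow> q x = k" by (auto simp: constant_on_def)
  have "(q \<longlongrightarrow> of_real (sqrt 3) / of_real (sqrt 3)) (at_right 0)"
    unfolding q_def by (intro tendsto_divide s principal_branch_tendsto) auto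
  then have "(q \<longlongrightarrow> 1) (at_right 0)" by simp
  moreover have "(q \<longlongrightarrow> k) (at_right 0)"
    by (rule tendsto_eventually) (use eventually_in_range in \<open>rule eventually_mono\<close>, use k in auto)
  ultimately have "k = 1" by (intro tendsto_unique [of "at_right 0" q]) auto
  then show ?thesis using k [OF assms] principal_branch_ne_0 [OF assms] by (simp add: q_def)
qed

text \<open>
  The saddle lies in the first quadrant and the square root in the fourth, so the argument of the
  amplitude stays between \<open>0\<close> and \<open>\<pi>\<close>; its principal argument is therefore continuous.
\<close>

lemma Im_quotient_pos:
  assumes "a \<in> {0<..<alpha_c}" shows "Im (zeta a / principal_branch a) > 0"
proof -
  note c = saddle_re [OF assms]
  let ?S = "principal_branch a"
  have z: "Re (zeta a) > 0" "Im (zeta a) > 0"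
    using saddle_im_pos [OF c(1,2)] c by (auto simp: zeta_eq [OF assms])
  have re0: "Re ?S \<ge> 0" unfolding principal_branch_def by (rule Re_csqrt)
  have "(Re ?S)\<^sup>2 - (Im ?S)\<^sup>2 > 0"
    using Re_radicand_pos [OF assms] unfolding principal_branch_sq [symmetric] Re_power2 .
  then have "Re ?S \<noteq> 0" by (auto simp: not_less)
  with re0 have re: "Re ?S > 0" by simp
  have "2 * Re ?S * Im ?S = - (2 * a * Im (zeta a))"
    using arg_cong [OF principal_branch_sq [of a], of Im] by (simp add: power2_eq_square)
  also have "\<dots> < 0" using assms z by simp
  finally have im: "Im ?S < 0" using re by (simp add: mult_less_0_iff)
  have "Im (zeta a / ?S) = (Im (zeta a) * Re ?S - Re (zeta a) * Im ?S) / (cmod ?S)\<^sup>2"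
    by (simp add: Im_divide cmod_power2)
  moreover have "Im (zeta a) * Re ?S > 0" "Re (zeta a) * Im ?S < 0"
    using z re im by (auto simp: mult_pos_neg)
  ultimately show ?thesis using principal_branch_ne_0 [OF assms] by simp
qed

lemma amplitude_eq:
  assumes "a \<in> {0<..<alpha_c}"
  shows "amplitude a = of_real (4 * sqrt a / sqrt pi) * (zeta a / principal_branch a)"
  by (simp add: amplitude_def sqrt_branch_eq [OF assms])

lemma Im_amplitude_pos:
  assumes "a \<in> {0<..<alpha_c}" shows "Im (amplitude a) > 0"
proof -
  have "Im (of_real r * z) = r * Im z" for r z by simp
  then have "Im (amplitude a) = 4 * sqrt a / sqrt pi * Im (zeta a / principal_branch a)"
    unfolding amplitude_eq [OF assms] .
  moreover have "4 * sqrt a / sqrt pi > 0" using assms by simp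
  ultimately show ?thesis using Im_quotient_pos [OF assms] by (simp only: mult_pos_pos)
qed

lemma amplitude_continuous: "continuous_on {0<..<alpha_c} amplitude"
proof -
  have "continuous_on {0<..<alpha_c} (\<lambda>a. of_real (4 * sqrt a / sqrt pi) * (zeta a / principal_branch a))"
    using principal_branch_ne_0
    by (intro continuous_intros zeta_continuous principal_branch_continuous) auto
  then show ?thesis
    by (rule continuous_on_cong [THEN iffD1, rotated -1]) (auto simp: amplitude_eq)
qed

text \<open>
  As \<open>a \<rightarrow> 0\<close> the saddle escapes to infinity in the direction \<open>1 + i sqrt 3\<close>, while the square root
  tends to \<open>sqrt 3\<close>.
\<close>

lemma Arg_amplitude_tendsto: "((\<lambda>a. Arg (amplitude a)) \<longlongrightarrow> pi / 3) (at_right 0)"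
proof -
  let ?v = "Complex 1 (sqrt 3)"
  have "((\<lambda>c::real. sqrt (3 * c\<^sup>2 - 1) / c) \<longlongrightarrow> 3 powr (1 / 2)) at_top" by real_asymp
  then have "((\<lambda>c::real. sqrt (3 * c\<^sup>2 - 1) / c) \<longlongrightarrow> sqrt 3) at_top" by (simp add: powr_half_sqrt)
  from filterlim_compose [OF this saddle_re_at_top]
  have "((\<lambda>a. Complex 1 (sqrt (3 * (saddle_re a)\<^sup>2 - 1) / saddle_re a)) \<longlongrightarrow> ?v) (at_right 0)"
    by (intro tendsto_Complex tendsto_const)
  then have lim: "((\<lambda>a. Complex 1 (sqrt (3 * (saddle_re a)\<^sup>2 - 1) / saddle_re a) / principal_branch a)
      \<longlongrightarrow> ?v / of_real (sqrt 3)) (at_right 0)"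
    by (intro tendsto_divide principal_branch_tendsto) auto
  have "?v / of_real (sqrt 3) = of_real (2 / sqrt 3) * exp (\<i> * of_real (pi / 3))"
    unfolding cis_conv_exp [symmetric] by (simp add: complex_eq_iff cos_60 sin_60)
  then have arg: "Arg (?v / of_real (sqrt 3)) = pi / 3"
    by (intro Arg_unique [of "2 / sqrt 3"]) auto
  have "?v / of_real (sqrt 3) \<notin> \<real>\<^sub>\<le>\<^sub>0"
    by (auto simp: complex_nonpos_Reals_iff Im_divide_of_real)
  then have "isCont Arg (?v / of_real (sqrt 3))" by (rule continuous_at_Arg)
  from isCont_tendsto_compose [OF this lim]
  have *: "((\<lambda>a. Arg (Complex 1 (sqrt (3 * (saddle_re a)\<^sup>2 - 1) / saddle_re a) / principal_branch a)) \<longlongrightarrow> pi / 3) (at_right 0)"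
    unfolding arg .
  show ?thesis
  proof (rule Lim_transform_eventually [OF *])
    show "\<forall>\<^sub>F a in at_right 0. Arg (Complex 1 (sqrt (3 * (saddle_re a)\<^sup>2 - 1) / saddle_re a) / principal_branch a)
        = Arg (amplitude a)"
      using eventually_in_range
    proof eventually_elim
      case (elim a)
      note c = saddle_re [OF elim]
      let ?r = "4 * sqrt a / sqrt pi * saddle_re a"
      have r: "?r > 0" using elim c by simp
      have z: "zeta a = of_real (saddle_re a) * Complex 1 (sqrt (3 * (saddle_re a)\<^sup>2 - 1) / saddle_re a)"
        using c(1) by (simp add: zeta_eq [OF elim] complex_eq_iff saddle_im_def)
      have x: "amplitude a = of_real ?r * (Complex 1 (sqrt (3 * (saddle_re a)\<^sup>2 - 1) / saddle_re a) / principal_branch a)"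
        unfolding amplitude_eq [OF elim] by (subst z) simp
      show ?case unfolding x by (rule Arg_times_of_real [OF r, symmetric])
    qed
  qed
qed

text \<open>
  The principal argument satisfies all conditions imposed on \<open>beta\<close>, so the choice in the definition
  of \<open>beta\<close> is not vacuous. What the asymptotics use is that \<open>beta\<close> is an argument of the
  amplitude.
\<close>

lemma amplitude_polar:
  assumes "a \<in> {0<..<alpha_c}"
  shows "amplitude a = of_real (B a) * exp (\<i> * of_real (beta a))"
proof -
  let ?I = "{0<..<alpha_c}"
  let ?P = "\<lambda>b. continuous_on ?I b \<and>
     (\<forall>x\<in>?I. amplitude x = of_real (B x) * exp (\<i> * of_real (b x))) \<and> (b \<longlongrightarrow> pi / 3) (at_right 0)"
  have "?P (\<lambda>x. Arg (amplitude x))"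
  proof (intro conjI ballI)
    have "amplitude x \<notin> \<real>\<^sub>\<le>\<^sub>0" if "x \<in> ?I" for x
      using Im_amplitude_pos [OF that] by (auto simp: complex_nonpos_Reals_iff)
    then show "continuous_on ?I (\<lambda>x. Arg (amplitude x))"
      by (intro continuous_on_compose2 [OF continuous_on_Arg amplitude_continuous]) auto
    fix x assume "x \<in> ?I"
    from Im_amplitude_pos [OF this] have "amplitude x \<noteq> 0" by auto
    from Arg_eq [OF this] show "amplitude x = of_real (B x) * exp (\<i> * of_real (Arg (amplitude x)))"
      by (simp add: B_def)
  qed (rule Arg_amplitude_tendsto)
  then have "?P beta" unfolding beta_def by (rule someI [of ?P])
  with assms show ?thesis by blast
qed

section \<open>The profile and the norm of the remainder\<close>

text \<open>
  The values of Laplace's method at the saddle combine to \<open>w\<^sup>j\<close> times the amplitude, because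
  \<open>1 / (1 - \<zeta>\<^sup>2) = a \<zeta>\<close> and the square root of \<open>saddle_curv\<close> is \<open>sqrt a\<close> times the branch.
\<close>

lemma leading_coefficient:
  assumes "a \<in> {0<..<alpha_c}"
  shows "of_real (4 / pi) * (kern i (saddle_pt (saddle_re a)) * of_real (sqrt pi) / csqrt (saddle_curv (saddle_re a)))
     = cayley (zeta a) ^ Suc i * amplitude a"
proof -
  note c = saddle_re [OF assms]
  note z = zeta_eq [OF assms]
  have a: "a > 0" using assms by simp
  have im: "Im (zeta a) > 0" using saddle_im_pos [OF c(1,2)] by (simp add: z)
  have "1 / (1 - (zeta a)\<^sup>2) = of_real a * zeta a"
  proof -
    have "1 / (1 - (zeta a)\<^sup>2) = - (1 / ((zeta a)\<^sup>2 - 1))"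
      by (metis minus_diff_eq minus_divide_right)
    then show ?thesis using saddle_pt_inverse [OF c(1,2)] by (simp add: z c(3))
  qed
  then have kern: "kern i (zeta a) = of_real a * zeta a * cayley (zeta a) ^ Suc i"
    using kern_eq [OF im, of i] by simp
  have cs: "csqrt (saddle_curv (saddle_re a)) = of_real (sqrt a) * principal_branch a"
    unfolding saddle_curv_def c(3) z [symmetric] principal_branch_def
    by (rule csqrt_of_real_mult_nonneg [OF a])
  have r: "4 / pi * a * sqrt pi / sqrt a = 4 * sqrt a / sqrt pi"
    using a by (simp add: field_simps)
  have "of_real (4 / pi) * (kern i (zeta a) * of_real (sqrt pi) / csqrt (saddle_curv (saddle_re a)))
     = cayley (zeta a) ^ Suc i * (of_real (4 / pi * a * sqrt pi / sqrt a) * (zeta a / principal_branch a))"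
    unfolding kern cs by (simp add: mult_ac)
  then show ?thesis unfolding r amplitude_eq [OF assms] z [symmetric] .
qed

lemma leading_term:
  assumes "a \<in> {0<..<alpha_c}"
  shows "saddle_leading m i (saddle_re a)
     = B a * (rho a ^ Suc i * cos (phase m a + real (Suc i) * omega a))"
proof -
  define g where "g = growth (saddle_re a) (saddle_pt (saddle_re a))"
  let ?X = "kern i (saddle_pt (saddle_re a)) * of_real (sqrt pi) / csqrt (saddle_curv (saddle_re a))"
  have "(g / of_real (cmod g)) ^ m = exp (\<i> * of_real (real m * Theta a))"
    unfolding g_def growth_saddle_eq [OF assms] exp_of_nat_mult [symmetric] by (simp add: mult_ac)
  moreover have "cayley (zeta a) ^ Suc i = of_real (rho a ^ Suc i) * exp (\<i> * of_real (real (Suc i) * omega a))"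
    unfolding rho_omega(1) [OF assms] power_mult_distrib exp_of_nat_mult [symmetric]
    by (simp add: mult_ac del: power_Suc of_nat_Suc)
  ultimately have "(g / of_real (cmod g)) ^ m * (of_real (4 / pi) * ?X)
     = exp (\<i> * of_real (real m * Theta a)) * (of_real (rho a ^ Suc i) * exp (\<i> * of_real (real (Suc i) * omega a))
          * (of_real (B a) * exp (\<i> * of_real (beta a))))"
    unfolding leading_coefficient [OF assms] amplitude_polar [OF assms] by simp
  also have "\<dots> = of_real (B a * rho a ^ Suc i) * (exp (\<i> * of_real (real m * Theta a))
       * exp (\<i> * of_real (beta a)) * exp (\<i> * of_real (real (Suc i) * omega a)))"
    by (simp add: mult_ac del: power_Suc of_nat_Suc)
  also have "exp (\<i> * of_real (real m * Theta a))
       * exp (\<i> * of_real (beta a)) * exp (\<i> * of_real (real (Suc i) * omega a))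
     = cis (phase m a + real (Suc i) * omega a)"
    unfolding cis_conv_exp phase_def exp_add [symmetric] of_real_add distrib_left ..
  finally have "(g / of_real (cmod g)) ^ m * (of_real (4 / pi) * ?X)
     = of_real (B a * rho a ^ Suc i) * cis (phase m a + real (Suc i) * omega a)" .
  moreover have "(g / of_real (cmod g)) ^ m * (of_real (4 / pi) * ?X) = of_real (4 / pi) * ((g / of_real (cmod g)) ^ m * ?X)"
    by (rule mult.left_commute)
  moreover have R: "Re (of_real r * w) = r * Re w" for r w by simp
  ultimately have "4 / pi * Re ((g / of_real (cmod g)) ^ m * ?X)
     = B a * rho a ^ Suc i * Re (cis (phase m a + real (Suc i) * omega a))"
    by (metis R)
  then show ?thesis by (simp add: saddle_leading_def g_def)
qed

text \<open>
  The reverse triangle inequality in \<open>\<ell>\<^sup>2\<close>, obtained from finite sections.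
\<close>

lemma sqrt_suminf_diff_le:
  fixes x y e :: "nat \<Rightarrow> real"
  assumes x: "summable (\<lambda>i. (x i)\<^sup>2)" and y: "summable (\<lambda>i. (y i)\<^sup>2)" and e: "summable (\<lambda>i. (e i)\<^sup>2)"
    and le: "\<And>i. \<bar>x i - y i\<bar> \<le> e i"
  shows "\<bar>sqrt (\<Sum>i. (x i)\<^sup>2) - sqrt (\<Sum>i. (y i)\<^sup>2)\<bar> \<le> sqrt (\<Sum>i. (e i)\<^sup>2)"
proof (rule tendsto_upperbound)
  have lim: "(\<lambda>n. L2_set f {..<n}) \<longlonglongrightarrow> sqrt (\<Sum>i. (f i)\<^sup>2)" if "summable (\<lambda>i. (f i)\<^sup>2)" for f :: "nat \<Rightarrow> real"
    unfolding L2_set_def by (intro tendsto_intros summable_LIMSEQ that)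
  show "(\<lambda>n. \<bar>L2_set x {..<n} - L2_set y {..<n}\<bar>) \<longlonglongrightarrow> \<bar>sqrt (\<Sum>i. (x i)\<^sup>2) - sqrt (\<Sum>i. (y i)\<^sup>2)\<bar>"
    by (intro tendsto_intros lim x y)
  have "\<bar>L2_set x A - L2_set y A\<bar> \<le> L2_set e A" if "finite A" for A
  proof -
    have tri: "L2_set u A \<le> L2_set v A + L2_set e A" if "\<And>i. \<bar>u i - v i\<bar> \<le> e i" for u v :: "nat \<Rightarrow> real"
    proof -
      have "L2_set u A = L2_set (\<lambda>i. v i + (u i - v i)) A" by simp
      also have "\<dots> \<le> L2_set v A + L2_set (\<lambda>i. u i - v i) A" by (rule L2_set_triangle_ineq)
      also have "L2_set (\<lambda>i. u i - v i) A \<le> L2_set e A"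
        unfolding L2_set_def using that
        by (intro real_sqrt_le_mono sum_mono) (metis abs_ge_zero power2_abs power_mono)
      finally show ?thesis by simp
    qed
    from tri [of x y] tri [of y x] le show ?thesis by (simp add: abs_minus_commute abs_le_iff)
  qed
  moreover have "L2_set e {..<n} \<le> sqrt (\<Sum>i. (e i)\<^sup>2)" for n
    unfolding L2_set_def by (intro real_sqrt_le_mono sum_le_suminf e) auto
  ultimately show "\<forall>\<^sub>F n in sequentially. \<bar>L2_set x {..<n} - L2_set y {..<n}\<bar> \<le> sqrt (\<Sum>i. (e i)\<^sup>2)"
    by (intro always_eventually allI) (meson finite_lessThan order_trans)
qed simp

lemma summable_profile:
  fixes r :: real
  assumes "0 \<le> r" "r < 1"
  shows "summable (\<lambda>i. (r ^ Suc i * cos (\<phi> + real (Suc i) * w))\<^sup>2)"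
proof (rule summable_comparison_test')
  show "summable (\<lambda>i. (r\<^sup>2) ^ i)"
    using assms by (intro summable_geometric) (simp add: power_less_one_iff abs_square_less_1)
  fix i :: nat
  have "(r ^ Suc i * cos (\<phi> + real (Suc i) * w))\<^sup>2 = (r\<^sup>2) ^ Suc i * (cos (\<phi> + real (Suc i) * w))\<^sup>2"
    by (simp only: power_mult_distrib power_mult [symmetric] mult.commute)
  also have "\<dots> \<le> (r\<^sup>2) ^ i * 1"
    using assms by (intro mult_mono power_decreasing) (auto simp: abs_square_le_1 power_le_one)
  finally show "norm ((r ^ Suc i * cos (\<phi> + real (Suc i) * w))\<^sup>2) \<le> (r\<^sup>2) ^ i" by simp
qed

lemma profile_alt:
  "profile a \<phi> = sqrt (\<Sum>i. (rho a ^ Suc i * cos (\<phi> + real (Suc i) * omega a))\<^sup>2)"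
  by (simp only: profile_def power_mult_distrib power_mult [symmetric] mult.commute)

text \<open>
  Signs of the coefficients disappear in the norm, so the factor \<open>(-1)\<^sup>k\<close> can be moved into the
  sequence \<open>x\<close> that is compared with the leading terms \<open>y\<close>. The comparison of norms
  takes place before squaring, so the error stays additive.
\<close>

lemma norm_asymptotics:
  fixes c1 c2 :: real
  assumes c1: "0 < c1" "1 < 3 * c1\<^sup>2" and c12: "c1 \<le> c2"
  shows "\<exists>C. \<forall>a\<in>{0<..<alpha_c}. \<forall>m\<ge>1. saddle_re a \<in> {c1..c2} \<longrightarrow>
        \<bar>sqrt (real m) / H_e a ^ m * norm_2C (remainder m (a * real m))
           - sqrt (pi / 2) * B a * profile a (phase m a)\<bar> \<le> C / real m"
proof -
  obtain C where C: "C \<ge> 0" and est: "\<And>c m i. c \<in> {c1..c2} \<Longrightarrow> m \<ge> 1 \<Longrightarrow>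
     \<bar>(-1) ^ (m + Suc i) * (sqrt (real m) / cmod (growth c (saddle_pt c)) ^ m
            * cheb_coeff (saddle_rate c * real m) (m + Suc i))
       - saddle_leading m i c\<bar>
       \<le> C / real (Suc i) / real m"
    using cheb_coeff_asymptotics [OF c1 c12] by blast
  define S where "S = sqrt (\<Sum>i. (1 / real (Suc i))\<^sup>2)"
  have sumS: "summable (\<lambda>i. (1 / real (Suc i))\<^sup>2)"
    using inverse_squares_sums by (simp add: sums_iff power_divide add.commute)
  have "\<bar>sqrt (real m) / H_e a ^ m * norm_2C (remainder m (a * real m))
           - sqrt (pi / 2) * B a * profile a (phase m a)\<bar> \<le> sqrt (pi / 2) * (C * S) / real m"
    if a: "a \<in> {0<..<alpha_c}" and m: "m \<ge> 1" and cc: "saddle_re a \<in> {c1..c2}" for a and m :: nat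
  proof -
    note c = saddle_re [OF a]
    note r = rho_omega [OF a]
    define K where "K = sqrt (real m) / H_e a ^ m"
    have K: "K \<ge> 0" by (simp add: K_def H_e_def)
    define v where "v = (\<lambda>i. cheb_coeff (a * real m) (m + Suc i))"
    define x where "x = (\<lambda>i. (-1) ^ (m + Suc i) * (K * v i))"
    define y where "y = (\<lambda>i. B a * (rho a ^ Suc i * cos (phase m a + real (Suc i) * omega a)))"
    define e where "e = (\<lambda>i. C / real m * (1 / real (Suc i)))"
    have xy: "\<bar>x i - y i\<bar> \<le> e i" for i
      using est [OF cc m, of i]
      unfolding leading_term [OF a] unfolding growth_saddle_eq(1) [OF a] c(3)
      by (simp add: x_def y_def e_def K_def v_def mult_ac)
    have N: "(\<lambda>i. pi / 2 * (v i)\<^sup>2) sums (norm_2C (remainder m (a * real m)))\<^sup>2"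
      unfolding v_def using a m by (intro norm_2C_remainder(1)) simp
    from sums_mult [OF N, of "2 / pi * K\<^sup>2"]
    have "(\<lambda>i. (x i)\<^sup>2) sums (2 / pi * K\<^sup>2 * (norm_2C (remainder m (a * real m)))\<^sup>2)"
      by (simp add: x_def power_mult_distrib flip: power_mult)
    then have xs: "summable (\<lambda>i. (x i)\<^sup>2)"
      and xe: "(\<Sum>i. (x i)\<^sup>2) = 2 / pi * K\<^sup>2 * (norm_2C (remainder m (a * real m)))\<^sup>2"
      by (auto simp: sums_iff)
    have npos: "norm_2C (remainder m (a * real m)) \<ge> 0"
      using a m by (intro norm_2C_remainder(2)) simp
    have sx: "sqrt (pi / 2) * sqrt (\<Sum>i. (x i)\<^sup>2) = K * norm_2C (remainder m (a * real m))"
      unfolding xe real_sqrt_mult [symmetric] using K npos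
      by (simp add: real_sqrt_mult)
    have ps: "summable (\<lambda>i. (rho a ^ Suc i * cos (phase m a + real (Suc i) * omega a))\<^sup>2)"
      using r by (intro summable_profile) auto
    have ys: "summable (\<lambda>i. (y i)\<^sup>2)"
      unfolding y_def power_mult_distrib [of "B a"] by (intro summable_mult ps)
    have sy: "sqrt (\<Sum>i. (y i)\<^sup>2) = B a * profile a (phase m a)"
      unfolding y_def power_mult_distrib [of "B a"] suminf_mult [OF ps] profile_alt
      by (simp add: real_sqrt_mult B_def)
    have es: "summable (\<lambda>i. (e i)\<^sup>2)"
      unfolding e_def power_mult_distrib [of "C / real m"] by (intro summable_mult sumS)
    have se: "sqrt (\<Sum>i. (e i)\<^sup>2) = C / real m * S"
      unfolding e_def power_mult_distrib [of "C / real m"] suminf_mult [OF sumS] S_def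
      using C by (simp add: real_sqrt_mult)
    have "\<bar>sqrt (\<Sum>i. (x i)\<^sup>2) - B a * profile a (phase m a)\<bar> \<le> C / real m * S"
      using sqrt_suminf_diff_le [OF xs ys es xy] unfolding sy se .
    then have "sqrt (pi / 2) * \<bar>sqrt (\<Sum>i. (x i)\<^sup>2) - B a * profile a (phase m a)\<bar> \<le> sqrt (pi / 2) * (C / real m * S)"
      by (rule mult_left_mono) simp
    also have "sqrt (pi / 2) * \<bar>sqrt (\<Sum>i. (x i)\<^sup>2) - B a * profile a (phase m a)\<bar>
       = \<bar>sqrt (pi / 2) * sqrt (\<Sum>i. (x i)\<^sup>2) - sqrt (pi / 2) * (B a * profile a (phase m a))\<bar>"
      by (simp add: abs_mult flip: right_diff_distrib)
    finally show ?thesis unfolding sx K_def by (simp add: mult.assoc)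
  qed
  then show ?thesis by blast
qed

lemma profile_sq_sums:
  assumes "a \<in> {0<..<alpha_c}"
  shows "(\<lambda>i. (rho a ^ Suc i * cos (\<phi> + real (Suc i) * omega a))\<^sup>2) sums (profile a \<phi>)\<^sup>2"
proof -
  note r = rho_omega [OF assms]
  have s: "summable (\<lambda>i. (rho a ^ Suc i * cos (\<phi> + real (Suc i) * omega a))\<^sup>2)"
    using r by (intro summable_profile) auto
  have "(\<Sum>i. (rho a ^ Suc i * cos (\<phi> + real (Suc i) * omega a))\<^sup>2) \<ge> 0" by (intro suminf_nonneg s) auto
  then show ?thesis using s by (simp add: profile_alt sums_iff)
qed

lemma profile_closed_form:
  assumes "a \<in> {0<..<alpha_c}"
  shows "(profile a \<phi>)\<^sup>2 =
        (rho a)\<^sup>2 / (2 * (1 - (rho a)\<^sup>2))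
        + 1 / 2 * Re (of_real ((rho a)\<^sup>2) * exp (2 * \<i> * of_real (\<phi> + omega a))
                      / (1 - of_real ((rho a)\<^sup>2) * exp (2 * \<i> * of_real (omega a))))"
proof -
  note r = rho_omega [OF assms]
  let ?r = "(rho a)\<^sup>2" and ?w = "omega a"
  have r1: "0 \<le> ?r" "?r < 1" using r by (auto simp: power_less_one_iff abs_square_less_1)
  define q where "q = of_real ?r * exp (2 * \<i> * of_real ?w)"
  define p where "p = of_real ?r * exp (2 * \<i> * of_real (\<phi> + ?w))"
  have nq: "cmod q < 1" using r1 by (simp add: q_def norm_mult norm_power norm_exp_eq_Re)
  have 1: "(\<lambda>i. ?r ^ i) sums (1 / (1 - ?r))" using r1 by (intro geometric_sums) simp
  have 2: "(\<lambda>i. q ^ i) sums (1 / (1 - q))" using nq by (intro geometric_sums)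
  have 3: "(\<lambda>i. Re (p * q ^ i)) sums Re (p * (1 / (1 - q)))"
    by (intro sums_Re sums_mult 2)
  have "(\<lambda>i. ?r / 2 * ?r ^ i + 1 / 2 * Re (p * q ^ i)) sums
      (?r / 2 * (1 / (1 - ?r)) + 1 / 2 * Re (p * (1 / (1 - q))))"
    by (intro sums_add sums_mult 1 3)
  moreover have "?r / 2 * ?r ^ i + 1 / 2 * Re (p * q ^ i) = (rho a ^ Suc i * cos (\<phi> + real (Suc i) * ?w))\<^sup>2" for i
  proof -
    have "p * q ^ i = of_real (?r ^ Suc i) * (exp (2 * \<i> * of_real (\<phi> + ?w)) * exp (of_nat i * (2 * \<i> * of_real ?w)))"
      by (simp add: p_def q_def power_mult_distrib exp_of_nat_mult)
    also have "exp (2 * \<i> * of_real (\<phi> + ?w)) * exp (of_nat i * (2 * \<i> * of_real ?w)) = cis (2 * (\<phi> + real (Suc i) * ?w))"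
      unfolding exp_add [symmetric] cis_conv_exp by (rule arg_cong [where f = exp]) (simp add: algebra_simps)
    finally have "Re (p * q ^ i) = ?r ^ Suc i * cos (2 * (\<phi> + real (Suc i) * ?w))" by simp
    also have "\<dots> = ?r ^ Suc i * (2 * (cos (\<phi> + real (Suc i) * ?w))\<^sup>2 - 1)" by (simp only: cos_double_cos)
    finally have "?r / 2 * ?r ^ i + 1 / 2 * Re (p * q ^ i) = ?r ^ Suc i * (cos (\<phi> + real (Suc i) * ?w))\<^sup>2"
      by (simp add: algebra_simps)
    also have "\<dots> = (rho a ^ Suc i * cos (\<phi> + real (Suc i) * ?w))\<^sup>2"
      by (simp only: power_mult_distrib power_mult [symmetric] mult.commute)
    finally show ?thesis .
  qed
  ultimately have "(profile a \<phi>)\<^sup>2 = ?r / 2 * (1 / (1 - ?r)) + 1 / 2 * Re (p * (1 / (1 - q)))"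
    using profile_sq_sums [OF assms, of \<phi>] sums_unique2 by fastforce
  then show ?thesis by (simp add: p_def q_def)
qed

text \<open>
  The first two terms of the series cannot both be small: the sum of the squares of \<open>cos v\<close> and
  \<open>cos (v + \<omega>)\<close> equals \<open>1 + cos (2 v + \<omega>) cos \<omega>\<close>.
\<close>

lemma profile_lower:
  assumes "a \<in> {0<..<alpha_c}"
  shows "(rho a) ^ 4 * (1 - \<bar>cos (omega a)\<bar>) \<le> (profile a \<phi>)\<^sup>2"
proof -
  note r = rho_omega [OF assms]
  let ?f = "\<lambda>i. (rho a ^ Suc i * cos (\<phi> + real (Suc i) * omega a))\<^sup>2"
  define v where "v = \<phi> + omega a"
  have "(\<Sum>i<2. ?f i) \<le> (profile a \<phi>)\<^sup>2"
    using sum_le_suminf [OF sums_summable [OF profile_sq_sums [OF assms, of \<phi>]], of "{..<2}"]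
      sums_unique [OF profile_sq_sums [OF assms, of \<phi>]] by simp
  moreover have "(\<Sum>i<2. ?f i) = (rho a)\<^sup>2 * (cos v)\<^sup>2 + (rho a) ^ 4 * (cos (v + omega a))\<^sup>2"
    by (simp add: v_def eval_nat_numeral power_mult_distrib algebra_simps)
  moreover have "(rho a) ^ 4 * (cos v)\<^sup>2 \<le> (rho a)\<^sup>2 * (cos v)\<^sup>2"
    using r by (intro mult_right_mono power_decreasing) auto
  moreover have "(rho a) ^ 4 * (1 - \<bar>cos (omega a)\<bar>) \<le> (rho a) ^ 4 * ((cos v)\<^sup>2 + (cos (v + omega a))\<^sup>2)"
  proof (rule mult_left_mono)
    have "(cos v)\<^sup>2 + (cos (v + omega a))\<^sup>2 = 1 + (cos (2 * v) + cos (2 * (v + omega a))) / 2"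
      unfolding cos_double_cos by (simp add: field_simps)
    also have "cos (2 * v) + cos (2 * (v + omega a)) = 2 * (cos (2 * v + omega a) * cos (omega a))"
      using cos_times_cos [of "2 * v + omega a" "omega a"] by (simp add: algebra_simps)
    finally have e: "(cos v)\<^sup>2 + (cos (v + omega a))\<^sup>2 = 1 + cos (2 * v + omega a) * cos (omega a)" by simp
    have "\<bar>cos (2 * v + omega a) * cos (omega a)\<bar> \<le> 1 * \<bar>cos (omega a)\<bar>"
      unfolding abs_mult by (intro mult_right_mono) auto
    then show "1 - \<bar>cos (omega a)\<bar> \<le> (cos v)\<^sup>2 + (cos (v + omega a))\<^sup>2" unfolding e by linarith
  qed (use r in simp)
  ultimately show ?thesis by (simp add: distrib_left)
qed

lemma profile_upper:
  assumes "a \<in> {0<..<alpha_c}"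
  shows "(profile a \<phi>)\<^sup>2 \<le> (rho a)\<^sup>2 / (1 - (rho a)\<^sup>2)"
proof -
  note r = rho_omega [OF assms]
  have r1: "0 \<le> (rho a)\<^sup>2" "(rho a)\<^sup>2 < 1" using r by (auto simp: power_less_one_iff abs_square_less_1)
  have "(\<lambda>i. (rho a)\<^sup>2 * ((rho a)\<^sup>2) ^ i) sums ((rho a)\<^sup>2 * (1 / (1 - (rho a)\<^sup>2)))"
    using r1 by (intro sums_mult geometric_sums) simp
  moreover have "(rho a ^ Suc i * cos (\<phi> + real (Suc i) * omega a))\<^sup>2 \<le> (rho a)\<^sup>2 * ((rho a)\<^sup>2) ^ i" for i
  proof -
    have "(rho a ^ Suc i * cos (\<phi> + real (Suc i) * omega a))\<^sup>2
        = ((rho a)\<^sup>2) ^ Suc i * (cos (\<phi> + real (Suc i) * omega a))\<^sup>2"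
      by (simp only: power_mult_distrib power_mult [symmetric] mult.commute)
    also have "\<dots> \<le> ((rho a)\<^sup>2) ^ Suc i * 1"
      using r1 by (intro mult_left_mono) (auto simp: abs_square_le_1)
    finally show ?thesis by simp
  qed
  ultimately show ?thesis
    using sums_le [OF _ profile_sq_sums [OF assms, of \<phi>]] by fastforce
qed

lemma cos_omega_lt_1:
  assumes "a \<in> {0<..<alpha_c}" shows "\<bar>cos (omega a)\<bar> < 1"
proof -
  note r = rho_omega [OF assms]
  show ?thesis
    using cos_monotone_0_pi [of 0 "omega a"] cos_monotone_0_pi [of "omega a" pi] r by (simp add: abs_less_iff)
qed

lemma rho_continuous: "continuous_on {0<..<alpha_c} rho"
proof -
  have "zeta a + 1 \<noteq> 0" if "a \<in> {0<..<alpha_c}" for a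
    using saddle_re [OF that] by (auto simp: zeta_eq [OF that] complex_eq_iff)
  then show ?thesis
    unfolding rho_def [abs_def] by (intro continuous_intros zeta_continuous) auto
qed

lemma cos_omega_continuous: "continuous_on {0<..<alpha_c} (\<lambda>a. cos (omega a))"
proof -
  have ne: "zeta a + 1 \<noteq> 0" if "a \<in> {0<..<alpha_c}" for a
    using saddle_re [OF that] by (auto simp: zeta_eq [OF that] complex_eq_iff)
  have r0: "rho a \<noteq> 0" if "a \<in> {0<..<alpha_c}" for a using rho_omega [OF that] by simp
  have "continuous_on {0<..<alpha_c} (\<lambda>a. Re (cayley (zeta a)) / rho a)"
    unfolding cayley_def using ne r0 by (intro continuous_intros zeta_continuous rho_continuous) auto
  moreover have e: "Re (cayley (zeta a)) / rho a = cos (omega a)" if "a \<in> {0<..<alpha_c}" for a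
    using rho_omega [OF that] by (simp flip: cis_conv_exp)
  ultimately show ?thesis by (simp only: continuous_on_cong [OF refl e])
qed

lemma profile_pos:
  assumes "a \<in> {0<..<alpha_c}" shows "profile a \<phi> > 0"
proof -
  have "0 < (rho a) ^ 4 * (1 - \<bar>cos (omega a)\<bar>)"
    using rho_omega [OF assms] cos_omega_lt_1 [OF assms] by simp
  with profile_lower [OF assms, of \<phi>] have "(profile a \<phi>)\<^sup>2 > 0" by linarith
  moreover have "profile a \<phi> \<ge> 0"
    unfolding profile_alt using rho_omega [OF assms]
    by (intro real_sqrt_ge_zero suminf_nonneg summable_profile) auto
  ultimately show ?thesis by (cases "profile a \<phi> = 0") auto
qed

lemma profile_periodic: "profile a (\<phi> + pi) = profile a \<phi>"
proof -
  have "cos (\<phi> + pi + x) = - cos (\<phi> + x)" for x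
    using cos_periodic_pi [of "\<phi> + x"] by (simp add: add_ac)
  then show ?thesis by (simp add: profile_def)
qed

lemma compact_pos_lower_bound:
  fixes f :: "real \<Rightarrow> real"
  assumes "compact K" "continuous_on K f" "\<And>x. x \<in> K \<Longrightarrow> f x > 0"
  shows "\<exists>d>0. \<forall>x\<in>K. d \<le> f x"
proof (cases "K = {}")
  case True then show ?thesis by (intro exI [of _ 1]) auto
next
  case False
  with continuous_attains_inf [OF assms(1) _ assms(2)] assms(3) show ?thesis by blast
qed

lemma profile_bounds:
  assumes K: "compact K" and sub: "K \<subseteq> {0<..<alpha_c}"
  shows "\<exists>c C. 0 < c \<and> (\<forall>a\<in>K. \<forall>\<phi>. c \<le> profile a \<phi> \<and> profile a \<phi> \<le> C)"
proof -
  note cr = continuous_on_subset [OF rho_continuous sub] and co = continuous_on_subset [OF cos_omega_continuous sub]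
  obtain d where d: "d > 0" "\<And>a. a \<in> K \<Longrightarrow> d \<le> (rho a) ^ 4 * (1 - \<bar>cos (omega a)\<bar>)"
  proof -
    have "\<exists>d>0. \<forall>a\<in>K. d \<le> (rho a) ^ 4 * (1 - \<bar>cos (omega a)\<bar>)"
    proof (rule compact_pos_lower_bound [OF K])
      show "continuous_on K (\<lambda>a. (rho a) ^ 4 * (1 - \<bar>cos (omega a)\<bar>))" by (intro continuous_intros cr co)
      fix a assume "a \<in> K"
      with sub have "a \<in> {0<..<alpha_c}" by auto
      from rho_omega(2) [OF this] cos_omega_lt_1 [OF this] show "0 < (rho a) ^ 4 * (1 - \<bar>cos (omega a)\<bar>)" by simp
    qed
    then show ?thesis using that by blast
  qed
  obtain u where u: "u > 0" "\<And>a. a \<in> K \<Longrightarrow> u \<le> 1 - (rho a)\<^sup>2"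
  proof -
    have "\<exists>d>0. \<forall>a\<in>K. d \<le> 1 - (rho a)\<^sup>2"
    proof (rule compact_pos_lower_bound [OF K])
      show "continuous_on K (\<lambda>a. 1 - (rho a)\<^sup>2)" by (intro continuous_intros cr)
      fix a assume "a \<in> K"
      with sub have "a \<in> {0<..<alpha_c}" by auto
      from rho_omega(2,3) [OF this] show "0 < 1 - (rho a)\<^sup>2" by (simp add: abs_square_less_1)
    qed
    then show ?thesis using that by blast
  qed
  have "sqrt d \<le> profile a \<phi> \<and> profile a \<phi> \<le> sqrt (1 / u)" if "a \<in> K" for a \<phi>
  proof -
    have a: "a \<in> {0<..<alpha_c}" using that sub by auto
    note r = rho_omega [OF a]
    have "d \<le> (profile a \<phi>)\<^sup>2" using d(2) [OF that] profile_lower [OF a, of \<phi>] by linarith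
    moreover have "(profile a \<phi>)\<^sup>2 \<le> 1 / u"
    proof -
      have "(rho a)\<^sup>2 / (1 - (rho a)\<^sup>2) \<le> 1 / u"
        using r u(1) u(2) [OF that] by (intro frac_le) (auto simp: power_le_one)
      with profile_upper [OF a, of \<phi>] show ?thesis by linarith
    qed
    ultimately show ?thesis
      using profile_pos [OF a, of \<phi>] by (auto intro: real_le_lsqrt real_le_rsqrt)
  qed
  then show ?thesis using d(1) by (intro exI [of _ "sqrt d"] exI [of _ "sqrt (1 / u)"]) auto
qed

lemma saddle_re_range:
  assumes K: "compact K" and sub: "K \<subseteq> {0<..<alpha_c}"
  shows "\<exists>c1 c2. 0 < c1 \<and> 1 < 3 * c1\<^sup>2 \<and> c1 \<le> c2 \<and> (\<forall>a\<in>K. saddle_re a \<in> {c1..c2})"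
proof (cases "K = {}")
  case True
  then show ?thesis by (intro exI [of _ 1]) auto
next
  case False
  have cont: "continuous_on K saddle_re" by (rule continuous_on_subset [OF saddle_re_continuous sub])
  obtain v b where "v \<in> K" "b \<in> K" "\<And>a. a \<in> K \<Longrightarrow> saddle_re v \<le> saddle_re a \<and> saddle_re a \<le> saddle_re b"
    using continuous_attains_inf [OF K False cont] continuous_attains_sup [OF K False cont] by blast
  then show ?thesis using saddle_re [of v] sub by (intro exI [of _ "saddle_re v"] exI [of _ "saddle_re b"]) auto
qed

theorem proposition5p8:
  fixes K :: "real set"
  assumes "compact K" and "K \<subseteq> {0<..<alpha_c}"
  shows
    "(\<forall>\<alpha>\<in>K. \<forall>\<phi>. profile \<alpha> \<phi> > 0 \<and> profile \<alpha> (\<phi> + pi) = profile \<alpha> \<phi>) \<and>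
     (\<exists>C. \<forall>\<^sub>F m in sequentially. \<forall>\<alpha>\<in>K.
        \<bar>sqrt (real m) / H_e \<alpha> ^ m * norm_2C (remainder m (\<alpha> * real m))
           - sqrt (pi / 2) * B \<alpha> * profile \<alpha> (phase m \<alpha>)\<bar> \<le> C / real m) \<and>
     (\<forall>\<alpha>\<in>K. \<forall>\<phi>. (profile \<alpha> \<phi>)\<^sup>2 =
        (rho \<alpha>)\<^sup>2 / (2 * (1 - (rho \<alpha>)\<^sup>2))
        + 1 / 2 * Re (of_real ((rho \<alpha>)\<^sup>2) * exp (2 * \<i> * of_real (\<phi> + omega \<alpha>))
                      / (1 - of_real ((rho \<alpha>)\<^sup>2) * exp (2 * \<i> * of_real (omega \<alpha>))))) \<and>
     (\<exists>c C. 0 < c \<and> (\<forall>\<alpha>\<in>K. \<forall>\<phi>. c \<le> profile \<alpha> \<phi> \<and> profile \<alpha> \<phi> \<le> C))"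
proof (intro conjI ballI allI)
  fix \<alpha> \<phi> assume "\<alpha> \<in> K"
  then have \<alpha>: "\<alpha> \<in> {0<..<alpha_c}" using assms by auto
  show "profile \<alpha> \<phi> > 0" by (rule profile_pos [OF \<alpha>])
  show "profile \<alpha> (\<phi> + pi) = profile \<alpha> \<phi>" by (rule profile_periodic)
  show "(profile \<alpha> \<phi>)\<^sup>2 =
        (rho \<alpha>)\<^sup>2 / (2 * (1 - (rho \<alpha>)\<^sup>2))
        + 1 / 2 * Re (of_real ((rho \<alpha>)\<^sup>2) * exp (2 * \<i> * of_real (\<phi> + omega \<alpha>))
                      / (1 - of_real ((rho \<alpha>)\<^sup>2) * exp (2 * \<i> * of_real (omega \<alpha>))))"
    by (rule profile_closed_form [OF \<alpha>])
next
  obtain c1 c2 where c: "0 < c1" "1 < 3 * c1\<^sup>2" "c1 \<le> c2" and range: "\<forall>\<alpha>\<in>K. saddle_re \<alpha> \<in> {c1..c2}"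
    using saddle_re_range [OF assms] by blast
  obtain C where C: "\<forall>\<alpha>\<in>{0<..<alpha_c}. \<forall>m\<ge>1. saddle_re \<alpha> \<in> {c1..c2} \<longrightarrow>
        \<bar>sqrt (real m) / H_e \<alpha> ^ m * norm_2C (remainder m (\<alpha> * real m))
           - sqrt (pi / 2) * B \<alpha> * profile \<alpha> (phase m \<alpha>)\<bar> \<le> C / real m"
    using norm_asymptotics [OF c] by blast
  show "\<exists>C. \<forall>\<^sub>F m in sequentially. \<forall>\<alpha>\<in>K.
        \<bar>sqrt (real m) / H_e \<alpha> ^ m * norm_2C (remainder m (\<alpha> * real m))
           - sqrt (pi / 2) * B \<alpha> * profile \<alpha> (phase m \<alpha>)\<bar> \<le> C / real m"
    by (intro exI [of _ C] eventually_sequentiallyI [of 1] ballI) (use C range assms(2) in blast)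
next
  show "\<exists>c C. 0 < c \<and> (\<forall>\<alpha>\<in>K. \<forall>\<phi>. c \<le> profile \<alpha> \<phi> \<and> profile \<alpha> \<phi> \<le> C)"
    by (rule profile_bounds [OF assms])
qed

end
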